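(* Let $(R,\mathfrak m)$ be a Noetherian local Cohen-Macaulay ring of Krull dimension $d\ge 1$ and let $I$ be a proper ideal of $R$ that is regular (i.e. contains a regular element) and is a maximal Cohen-Macaulay $R$-module. Let $a,b\in R$ and let $J=(x_1,x_2,\dots,x_d)$ be an ideal of $R$ generated by an $R$-regular sequence $x_1,\dots,x_d$ (of elements of $\mathfrak m$). Then the Cohen-Macaulay type of $R(I)_{a,b}$ is $$t(R(I)_{a,b})=\lambda_R\left(\frac{(J:\mathfrak m)\cap(JI:I)}{J}\right)+\lambda_R\left(\frac{(JI:\mathfrak m)}{JI}\right).$$ In particular, the type of $R(I)_{a,b}$ is independent of $a,b$.
   Context: All rings are commutative with unity. For a Noetherian ring $R$, a nonzero proper ideal $I$ and $a,b\in R$, the Rees algebra is the subring $\bigoplus_{n\ge 0} I^n t^n$ of $R[t]$, and $R(I)_{a,b}$ denotes the quotient of $\bigoplus_{n\ge 0} I^n t^n$ by the ideal $\big((t^2+at+b)R[t]\big)\cap \bigoplus_{n\ge 0} I^n t^n$. As an $R$-module $R(I)_{a,b}\cong R\oplus I$; its elements are written uniquely as $r+it$ with $r\in R$, $i\in I$, with product $(r+it)(s+jt)=rs-bij+(rj+is-aij)t$. If $(R,\mathfrak m)$ is local, then $R(I)_{a,b}$ is local with maximal ideal $\{m+it \mid m\in\mathfrak m, i\in I\}$. Here $\lambda_R(\cdot)$ denotes the length of an $R$-module, and for $R$-submodules $A,B$ of the total ring of fractions $Q(R)$, $(A:B)=\{q\in Q(R)\mid qB\subseteq A\}$. The Cohen-Macaulay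 type of a Cohen-Macaulay local ring $(S,\mathfrak n)$ of dimension $d$ is $t(S)=\lambda_S(\operatorname{Ext}^d_S(S/\mathfrak n,S))$. A maximal Cohen-Macaulay $R$-module is a finitely generated module whose depth equals $\dim R$. *)

theory Defs
  imports
    "HOL-Algebra.UnivPoly"
    "HOL-Algebra.Ideal_Product"
    "HOL-Algebra.Ring_Divisibility"
    "HOL-Library.Extended_Nat"
begin

section \<open>Modules\<close>

text \<open>The fields \<open>mult\<close> and \<open>one\<close> of a module record, inherited from \<^typ>\<open>'b ring\<close>, are not
  constrained by the locale \<^locale>\<open>module\<close>; constructions without a ring structure leave them
  \<open>undefined\<close>. A submodule \<open>N\<close> of \<open>M\<close> is regarded as a module by replacing the carrier.\<close>

definition self_module :: "('a, 'r) ring_scheme \<Rightarrow> ('a, 'a) module" where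
  "self_module R = \<lparr>carrier = carrier R, monoid.mult = monoid.mult R, one = one R,
     zero = zero R, add = add R,
     smult = monoid.mult R\<rparr>"

definition submodule_span ::
    "('a, 'r) ring_scheme \<Rightarrow> ('a, 'm, 's) module_scheme \<Rightarrow> 'm set \<Rightarrow> 'm set" where
  "submodule_span R M A = \<Inter>{N. submodule N R M \<and> A \<subseteq> N}"

definition fin_gen_module :: "('a, 'r) ring_scheme \<Rightarrow> ('a, 'm, 's) module_scheme \<Rightarrow> bool" where
  "fin_gen_module R M \<longleftrightarrow> (\<exists>A. finite A \<and> A \<subseteq> carrier M \<and> submodule_span R M A = carrier M)"

text \<open>\<open>(X)M\<close>, where \<open>(X)\<close> is the ideal generated by \<open>X\<close>.\<close>
definition ideal_times ::
    "('a, 'r) ring_scheme \<Rightarrow> 'a set \<Rightarrow> ('a, 'm, 's) module_scheme \<Rightarrow> 'm set" where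
  "ideal_times R X M = submodule_span R M {x \<odot>\<^bsub>M\<^esub> m | x m. x \<in> X \<and> m \<in> carrier M}"

definition quot_module :: "('a, 'm, 's) module_scheme \<Rightarrow> 'm set \<Rightarrow> ('a, 'm set) module" where
  "quot_module M N = \<lparr>carrier = a_rcosets\<^bsub>M\<^esub> N, monoid.mult = undefined, one = undefined,
     zero = N, add = set_add M, smult = (\<lambda>r X. \<Union>x\<in>X. N +>\<^bsub>M\<^esub> (r \<odot>\<^bsub>M\<^esub> x))\<rparr>"

definition module_length :: "('a, 'r) ring_scheme \<Rightarrow> ('a, 'm, 's) module_scheme \<Rightarrow> enat" where
  "module_length R M = Sup {enat n | n N. (\<forall>i\<le>n. submodule (N i) R M) \<and> (\<forall>i<n. N i \<subset> N (Suc i))}"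

text \<open>Homomorphisms are extensional functions, so that equality of homomorphisms is equality on
  the carrier.\<close>
definition module_hom :: "('a, 'r) ring_scheme \<Rightarrow> ('a, 'm, 's) module_scheme \<Rightarrow>
    ('a, 'n, 't) module_scheme \<Rightarrow> ('m \<Rightarrow> 'n) set" where
  "module_hom R M N = {h \<in> carrier M \<rightarrow>\<^sub>E carrier N.
     (\<forall>x\<in>carrier M. \<forall>y\<in>carrier M. h (x \<oplus>\<^bsub>M\<^esub> y) = h x \<oplus>\<^bsub>N\<^esub> h y) \<and>
     (\<forall>r\<in>carrier R. \<forall>x\<in>carrier M. h (r \<odot>\<^bsub>M\<^esub> x) = r \<odot>\<^bsub>N\<^esub> h x)}"

definition hom_module :: "('a, 'r) ring_scheme \<Rightarrow> ('a, 'm, 's) module_scheme \<Rightarrow>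
    ('a, 'n, 't) module_scheme \<Rightarrow> ('a, 'm \<Rightarrow> 'n) module" where
  "hom_module R M N = \<lparr>carrier = module_hom R M N, monoid.mult = undefined, one = undefined,
     zero = (\<lambda>x\<in>carrier M. \<zero>\<^bsub>N\<^esub>), add = (\<lambda>f g. \<lambda>x\<in>carrier M. f x \<oplus>\<^bsub>N\<^esub> g x),
     smult = (\<lambda>r f. \<lambda>x\<in>carrier M. r \<odot>\<^bsub>N\<^esub> f x)\<rparr>"


section \<open>Ext\<close>

definition free_module :: "('a, 'r) ring_scheme \<Rightarrow> nat \<Rightarrow> ('a, nat \<Rightarrow> 'a) module" where
  "free_module R n = \<lparr>carrier = {..<n} \<rightarrow>\<^sub>E carrier R, monoid.mult = undefined, one = undefined,
     zero = (\<lambda>i\<in>{..<n}. \<zero>\<^bsub>R\<^esub>), add = (\<lambda>u v. \<lambda>i\<in>{..<n}. u i \<oplus>\<^bsub>R\<^esub> v i),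
     smult = (\<lambda>r v. \<lambda>i\<in>{..<n}. r \<otimes>\<^bsub>R\<^esub> v i)\<rparr>"

text \<open>An exact sequence
  \<open>\<dots> \<rightarrow> R\<^bsup>rk 2\<^esup> \<rightarrow> R\<^bsup>rk 1\<^esup> \<rightarrow> R\<^bsup>rk 0\<^esup> \<rightarrow> M \<rightarrow> 0\<close> with maps \<open>\<dots>, \<delta> 1, \<delta> 0, \<epsilon>\<close>.\<close>
definition free_resolution :: "('a, 'r) ring_scheme \<Rightarrow> ('a, 'm, 's) module_scheme \<Rightarrow>
    (nat \<Rightarrow> nat) \<Rightarrow> (nat \<Rightarrow> (nat \<Rightarrow> 'a) \<Rightarrow> (nat \<Rightarrow> 'a)) \<Rightarrow> ((nat \<Rightarrow> 'a) \<Rightarrow> 'm) \<Rightarrow> bool" where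
  "free_resolution R M rk \<delta> \<epsilon> \<longleftrightarrow>
     \<epsilon> \<in> module_hom R (free_module R (rk 0)) M \<and>
     (\<forall>i. \<delta> i \<in> module_hom R (free_module R (rk (Suc i))) (free_module R (rk i))) \<and>
     \<epsilon> ` carrier (free_module R (rk 0)) = carrier M \<and>
     \<delta> 0 ` carrier (free_module R (rk 1)) =
       {v \<in> carrier (free_module R (rk 0)). \<epsilon> v = \<zero>\<^bsub>M\<^esub>} \<and>
     (\<forall>i. \<delta> (Suc i) ` carrier (free_module R (rk (Suc (Suc i)))) =
       {v \<in> carrier (free_module R (rk (Suc i))). \<delta> i v = \<zero>\<^bsub>free_module R (rk i)\<^esub>})"

definition ext_cocycles :: "('a, 'r) ring_scheme \<Rightarrow> (nat \<Rightarrow> nat) \<Rightarrow>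
    (nat \<Rightarrow> (nat \<Rightarrow> 'a) \<Rightarrow> (nat \<Rightarrow> 'a)) \<Rightarrow> ('a, 'n, 't) module_scheme \<Rightarrow> nat \<Rightarrow>
    ((nat \<Rightarrow> 'a) \<Rightarrow> 'n) set" where
  "ext_cocycles R rk \<delta> N n = {f \<in> module_hom R (free_module R (rk n)) N.
     \<forall>v \<in> carrier (free_module R (rk (Suc n))). f (\<delta> n v) = \<zero>\<^bsub>N\<^esub>}"

definition ext_coboundaries :: "('a, 'r) ring_scheme \<Rightarrow> (nat \<Rightarrow> nat) \<Rightarrow>
    (nat \<Rightarrow> (nat \<Rightarrow> 'a) \<Rightarrow> (nat \<Rightarrow> 'a)) \<Rightarrow> ('a, 'n, 't) module_scheme \<Rightarrow> nat \<Rightarrow>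
    ((nat \<Rightarrow> 'a) \<Rightarrow> 'n) set" where
  "ext_coboundaries R rk \<delta> N n = (case n of
       0 \<Rightarrow> {\<lambda>v\<in>carrier (free_module R (rk 0)). \<zero>\<^bsub>N\<^esub>}
     | Suc k \<Rightarrow> (\<lambda>g. compose (carrier (free_module R (rk (Suc k)))) g (\<delta> k)) `
                  module_hom R (free_module R (rk k)) N)"

text \<open>\<open>Ext\<^bsup>n\<^esup>(M, N)\<close> as the \<open>n\<close>-th cohomology of \<open>Hom(F, N)\<close> for a resolution \<open>F\<close> of \<open>M\<close> by free
  modules of finite rank. Such a resolution exists for every finitely generated module over a
  Noetherian ring, the only situation in which this constant is meaningful; up to isomorphism
  the result does not depend on the resolution chosen.\<close>
definition Ext :: "('a, 'r) ring_scheme \<Rightarrow> nat \<Rightarrow> ('a, 'm, 's) module_scheme \<Rightarrow>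
    ('a, 'n, 't) module_scheme \<Rightarrow> ('a, ((nat \<Rightarrow> 'a) \<Rightarrow> 'n) set) module" where
  "Ext R n M N =
     (let (rk, \<delta>, \<epsilon>) = (SOME (rk, \<delta>, \<epsilon>). free_resolution R M rk \<delta> \<epsilon>)
      in quot_module ((hom_module R (free_module R (rk n)) N)\<lparr>carrier := ext_cocycles R rk \<delta> N n\<rparr>)
           (ext_coboundaries R rk \<delta> N n))"


section \<open>Local rings, dimension, depth, Cohen-Macaulay type\<close>

definition local_ring :: "('a, 'r) ring_scheme \<Rightarrow> 'a set \<Rightarrow> bool" where
  "local_ring R \<mm> \<longleftrightarrow> cring R \<and> maximalideal \<mm> R \<and> (\<forall>M. maximalideal M R \<longrightarrow> M = \<mm>)"

definition krull_dim :: "('a, 'r) ring_scheme \<Rightarrow> enat" where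
  "krull_dim R = Sup {enat n | n P. (\<forall>i\<le>n. primeideal (P i) R) \<and> (\<forall>i<n. P i \<subset> P (Suc i))}"

definition regular_elements :: "('a, 'r) ring_scheme \<Rightarrow> 'a set" where
  "regular_elements R = {s \<in> carrier R. \<forall>r\<in>carrier R. s \<otimes>\<^bsub>R\<^esub> r = \<zero>\<^bsub>R\<^esub> \<longrightarrow> r = \<zero>\<^bsub>R\<^esub>}"

text \<open>The first condition says that \<open>xs ! i\<close> is a nonzerodivisor on \<open>M/(xs ! 0, \<dots>, xs ! (i - 1))M\<close>.\<close>
definition regular_sequence ::
    "('a, 'r) ring_scheme \<Rightarrow> ('a, 'm, 's) module_scheme \<Rightarrow> 'a list \<Rightarrow> bool" where
  "regular_sequence R M xs \<longleftrightarrow> set xs \<subseteq> carrier R \<and>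
     (\<forall>i<length xs. \<forall>m\<in>carrier M. (xs ! i) \<odot>\<^bsub>M\<^esub> m \<in> ideal_times R (set (take i xs)) M \<longrightarrow>
        m \<in> ideal_times R (set (take i xs)) M) \<and>
     ideal_times R (set xs) M \<noteq> carrier M"

text \<open>The depth over a local ring with maximal ideal \<open>\<mm>\<close>; the zero module has depth \<open>\<infinity>\<close>.\<close>
definition depth :: "('a, 'r) ring_scheme \<Rightarrow> 'a set \<Rightarrow> ('a, 'm, 's) module_scheme \<Rightarrow> enat" where
  "depth R \<mm> M = (if ideal_times R \<mm> M = carrier M then \<infinity>
     else Sup {enat (length xs) | xs. set xs \<subseteq> \<mm> \<and> regular_sequence R M xs})"

definition cohen_macaulay_ring :: "('a, 'r) ring_scheme \<Rightarrow> 'a set \<Rightarrow> bool" where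
  "cohen_macaulay_ring R \<mm> \<longleftrightarrow> depth R \<mm> (self_module R) = krull_dim R"

definition maximal_cohen_macaulay ::
    "('a, 'r) ring_scheme \<Rightarrow> 'a set \<Rightarrow> ('a, 'm, 's) module_scheme \<Rightarrow> bool" where
  "maximal_cohen_macaulay R \<mm> M \<longleftrightarrow> module R M \<and> fin_gen_module R M \<and> depth R \<mm> M = krull_dim R"

text \<open>The maximal ideal of \<open>S\<close> and its (finite) Krull dimension are recovered from \<open>S\<close>, which is
  supposed to be local and Noetherian.\<close>
definition cm_type :: "('a, 'r) ring_scheme \<Rightarrow> enat" where
  "cm_type S = (let \<nn> = (THE \<nn>. local_ring S \<nn>); d = the_enat (krull_dim S)
     in module_length S (Ext S d (quot_module (self_module S) \<nn>) (self_module S)))"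


section \<open>Total ring of fractions\<close>

text \<open>The fraction \<open>r/s\<close> as an equivalence class of pairs. Since denominators are regular,
  \<open>r/s = r'/s'\<close> amounts to \<open>r s' = r' s\<close>.\<close>
definition fraction :: "('a, 'r) ring_scheme \<Rightarrow> 'a \<Rightarrow> 'a \<Rightarrow> ('a \<times> 'a) set" where
  "fraction R r s = {(r', s'). r' \<in> carrier R \<and> s' \<in> regular_elements R \<and>
     r \<otimes>\<^bsub>R\<^esub> s' = r' \<otimes>\<^bsub>R\<^esub> s}"

text \<open>\<open>Q(R)\<close> as an \<open>R\<close>-algebra.\<close>
definition total_fractions :: "('a, 'r) ring_scheme \<Rightarrow> ('a, ('a \<times> 'a) set) module" where
  "total_fractions R = \<lparr>carrier = {fraction R r s | r s. r \<in> carrier R \<and> s \<in> regular_elements R},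
     monoid.mult = (\<lambda>x y. \<Union>(r, s)\<in>x. \<Union>(r', s')\<in>y. fraction R (r \<otimes>\<^bsub>R\<^esub> r') (s \<otimes>\<^bsub>R\<^esub> s')),
     one = fraction R \<one>\<^bsub>R\<^esub> \<one>\<^bsub>R\<^esub>,
     zero = fraction R \<zero>\<^bsub>R\<^esub> \<one>\<^bsub>R\<^esub>,
     add = (\<lambda>x y. \<Union>(r, s)\<in>x. \<Union>(r', s')\<in>y.
              fraction R (r \<otimes>\<^bsub>R\<^esub> s' \<oplus>\<^bsub>R\<^esub> r' \<otimes>\<^bsub>R\<^esub> s) (s \<otimes>\<^bsub>R\<^esub> s')),
     smult = (\<lambda>a x. \<Union>(r, s)\<in>x. fraction R (a \<otimes>\<^bsub>R\<^esub> r) s)\<rparr>"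

text \<open>The image in \<open>Q(R)\<close> of a subset of \<open>R\<close>.\<close>
definition in_fractions :: "('a, 'r) ring_scheme \<Rightarrow> 'a set \<Rightarrow> ('a \<times> 'a) set set" where
  "in_fractions R A = (\<lambda>r. fraction R r \<one>\<^bsub>R\<^esub>) ` A"

definition colon ::
    "('a, 'r) ring_scheme \<Rightarrow> ('a \<times> 'a) set set \<Rightarrow> ('a \<times> 'a) set set \<Rightarrow> ('a \<times> 'a) set set" where
  "colon R A B = {q \<in> carrier (total_fractions R). \<forall>b\<in>B. q \<otimes>\<^bsub>total_fractions R\<^esub> b \<in> A}"

text \<open>\<open>\<lambda>\<^sub>R(A/B)\<close> for submodules \<open>B \<subseteq> A\<close> of \<open>Q(R)\<close>.\<close>
definition quot_length ::
    "('a, 'r) ring_scheme \<Rightarrow> ('a \<times> 'a) set set \<Rightarrow> ('a \<times> 'a) set set \<Rightarrow> enat" where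
  "quot_length R A B = module_length R (quot_module ((total_fractions R)\<lparr>carrier := A\<rparr>) B)"


section \<open>The rings \<open>R(I)\<^bsub>a,b\<^esub>\<close>\<close>

definition rees_algebra :: "('a, 'r) ring_scheme \<Rightarrow> 'a set \<Rightarrow> ('a, nat \<Rightarrow> 'a) up_ring" where
  "rees_algebra R I = (UP R)\<lparr>carrier :=
     {p \<in> carrier (UP R). \<forall>n. up_ring.coeff (UP R) p n \<in> I [^]\<^bsub>ideals_set R\<^esub> n}\<rparr>"

definition quadratic_poly :: "('a, 'r) ring_scheme \<Rightarrow> 'a \<Rightarrow> 'a \<Rightarrow> nat \<Rightarrow> 'a" where
  "quadratic_poly R a b = up_ring.monom (UP R) \<one>\<^bsub>R\<^esub> 2 \<oplus>\<^bsub>UP R\<^esub> up_ring.monom (UP R) a 1 \<oplus>\<^bsub>UP R\<^esub> up_ring.monom (UP R) b 0"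

definition rees_quotient ::
    "('a, 'r) ring_scheme \<Rightarrow> 'a set \<Rightarrow> 'a \<Rightarrow> 'a \<Rightarrow> (nat \<Rightarrow> 'a) set ring" where
  "rees_quotient R I a b = rees_algebra R I Quot
     ((PIdl\<^bsub>UP R\<^esub> (quadratic_poly R a b)) \<inter> carrier (rees_algebra R I))"

end

theory Submission
  imports Defs "HOL-Algebra.Subrings"
begin

text \<open>
  Write \<open>S = R(I)\<^bsub>a,b\<^esub>\<close>. It is the ring \<open>R \<oplus> It\<close> with \<open>t\<^sup>2 = - a t - b\<close>
  (\<open>rees_extension_rees_quotient\<close>), it is local with maximal ideal \<open>\<nn> = \<mm> \<oplus> It\<close>, and, as an
  \<open>R\<close>-module, it is the direct sum of \<open>R\<close> and \<open>I\<close>. The proof computes the type of \<open>S\<close> as a length in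
  \<open>S/(x\<^sub>1, \<dots>, x\<^sub>d)S\<close> and reads this length off in the two summands.

  \<^item> The type is a socle length. For \<open>x\<close> regular on a module \<open>M\<close>, multiplication by \<open>x \<in> \<nn>\<close> is
    null-homotopic on a free resolution of \<open>S/\<nn>\<close> and hence zero on \<open>Ext(S/\<nn>, M)\<close>. The long exact
    sequence of \<open>0 \<rightarrow> M \<rightarrow> M \<rightarrow> M/xM \<rightarrow> 0\<close> therefore gives \<open>Ext\<^sup>n(S/\<nn>, M/xM) \<cong> Ext\<^bsup>n+1\<^esup>(S/\<nn>, M)\<close> if
    \<open>Ext\<^sup>n(S/\<nn>, M) = 0\<close> (\<open>cohomology_length_shift\<close>). Along a sequence that is regular on \<open>S\<close>, this
    identifies \<open>Ext\<^sup>d(S/\<nn>, S)\<close> with \<open>Hom(S/\<nn>, S/(x)S)\<close>, so that the type is the length of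
    \<open>((x)S : \<nn>)/(x)S\<close> (\<open>cm_type_eq\<close>). Lengths are suprema of lengths of chains of submodules and
    are compared along relations that induce isomorphisms (\<open>chain_length_eq_of_correspondence\<close>).

  \<^item> The given sequence is regular on \<open>S\<close>, that is, on \<open>R\<close> and on \<open>I\<close>. That it is regular on \<open>I\<close>
    follows from \<open>I\<close> being maximal Cohen-Macaulay
    (\<open>regular_chain_on_maximal_cohen_macaulay\<close>): the vanishing of \<open>Ext\<^sup>n(R/\<mm>, I)\<close> for \<open>n < d\<close> gives the
    vanishing of \<open>Ext\<^sup>n(R/\<mm>, I/(x\<^sub>1, \<dots>, x\<^sub>j)I)\<close> for \<open>n < d - j\<close>. If \<open>x\<^bsub>j+1\<^esub>\<close> were in an associated prime
    of \<open>I/(x\<^sub>1, \<dots>, x\<^sub>j)I\<close>, there would be chains of primes of length \<open>j + 1\<close> below it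
    (\<open>chain_below_prime\<close>) and of length \<open>d - j\<close> above it (\<open>chain_above_associated_prime\<close>), but \<open>R\<close>
    has dimension \<open>d\<close>. The dimension of \<open>S\<close> is also \<open>d\<close>, because every element of \<open>S\<close> satisfies a
    quadratic equation over \<open>R\<close> (\<open>krull_dim_eq\<close>).

  \<^item> As \<open>(x)S = J \<oplus> JI t\<close>, multiplication in \<open>S\<close> shows that \<open>((x)S : \<nn>) = U \<oplus> V t\<close>, where \<open>U\<close> is the
    set of all \<open>r \<in> R\<close> with \<open>\<mm> r \<subseteq> J\<close> and \<open>I r \<subseteq> JI\<close>, and \<open>V\<close> is the set of all \<open>i \<in> I\<close> with
    \<open>\<mm> i \<subseteq> JI\<close> (\<open>socle_els\<close>). The coefficients \<open>a\<close> and \<open>b\<close> occur only in products that lie in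
    \<open>JI\<close> anyway. The two lengths add up (\<open>chain_length_els\<close>).

  \<^item> The colons are taken in the total ring of fractions. An element \<open>q\<close> with \<open>q \<mm> \<subseteq> J\<close> or
    \<open>q \<mm> \<subseteq> JI\<close> already lies in \<open>R\<close> or in \<open>I\<close>, respectively; for \<open>d \<ge> 2\<close> this uses two members of the
    regular sequence. So the colons are \<open>U\<close> and \<open>V\<close> (\<open>colon_eq_in_fractions\<close>).
\<close>


section \<open>Lengths of chains\<close>

text \<open>Both the Krull dimension and the length of a module are of this form, for the family of prime
  ideals and of submodules.\<close>

definition chain_length :: "'a set set \<Rightarrow> enat" where
  "chain_length L = Sup {enat n | n N. (\<forall>i\<le>n. N i \<in> L) \<and> (\<forall>i<n. N i \<subset> N (Suc i))}"

text \<open>Building a chain from the bottom up, step by step, gives an induction rule for chains with a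
  prescribed top.\<close>
inductive chain_to :: "'a set set \<Rightarrow> nat \<Rightarrow> 'a set \<Rightarrow> bool" for L where
  chain_to_0: "X \<in> L \<Longrightarrow> chain_to L 0 X"
| chain_to_Suc: "chain_to L n X \<Longrightarrow> X \<subset> Y \<Longrightarrow> Y \<in> L \<Longrightarrow> chain_to L (Suc n) Y"

lemma chain_to_mem: "chain_to L n X \<Longrightarrow> X \<in> L"
  by (induction rule: chain_to.induct) auto

lemma chain_to_iff:
  "chain_to L n X \<longleftrightarrow> (\<exists>N. (\<forall>i\<le>n. N i \<in> L) \<and> (\<forall>i<n. N i \<subset> N (Suc i)) \<and> N n = X)"
proof
  assume "chain_to L n X"
  then show "\<exists>N. (\<forall>i\<le>n. N i \<in> L) \<and> (\<forall>i<n. N i \<subset> N (Suc i)) \<and> N n = X"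
  proof induction
    case (chain_to_0 X) then show ?case by (intro exI[of _ "\<lambda>_. X"]) auto
  next
    case (chain_to_Suc n X Y)
    then obtain N where "\<forall>i\<le>n. N i \<in> L" "\<forall>i<n. N i \<subset> N (Suc i)" "N n = X" by blast
    with chain_to_Suc show ?case
      by (intro exI[of _ "N(Suc n := Y)"]) (auto simp: less_Suc_eq le_Suc_eq)
  qed
next
  assume "\<exists>N. (\<forall>i\<le>n. N i \<in> L) \<and> (\<forall>i<n. N i \<subset> N (Suc i)) \<and> N n = X"
  then obtain N where N: "\<forall>i\<le>n. N i \<in> L" "\<forall>i<n. N i \<subset> N (Suc i)" "N n = X" by blast
  have "k \<le> n \<Longrightarrow> chain_to L k (N k)" for k
  proof (induction k)
    case 0 then show ?case using N chain_to_0[of "N 0" L] by simp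
  next
    case (Suc k)
    then have "chain_to L k (N k)" "N k \<subset> N (Suc k)" "N (Suc k) \<in> L" using N by auto
    then show ?case by (rule chain_to_Suc)
  qed
  with N show "chain_to L n X" by blast
qed

lemma chain_length_eq_Sup: "chain_length L = Sup {enat n | n. \<exists>X. chain_to L n X}"
  unfolding chain_length_def chain_to_iff by (rule arg_cong[where f = Sup]) blast

lemma chain_to_shorter: "chain_to L n X \<Longrightarrow> k \<le> n \<Longrightarrow> \<exists>Y. chain_to L k Y"
  by (induction rule: chain_to.induct) (auto simp: le_Suc_eq intro: chain_to.intros)

lemma chain_length_ge_iff:
  assumes "L \<noteq> {}"
  shows "enat n \<le> chain_length L \<longleftrightarrow> (\<exists>X. chain_to L n X)"
proof
  assume n: "enat n \<le> chain_length L"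
  show "\<exists>X. chain_to L n X"
  proof (rule ccontr)
    assume no: "\<not> ?thesis"
    obtain Z where "Z \<in> L" using assms by auto
    then have "chain_to L 0 Z" by (rule chain_to_0)
    with no have "n \<noteq> 0" by metis
    have "chain_length L \<le> enat (n - 1)"
      unfolding chain_length_eq_Sup
    proof (rule Sup_least, clarify)
      fix k X assume "chain_to L k X"
      then have "k < n" using no chain_to_shorter[of L k X n] not_less by metis
      then show "enat k \<le> enat (n - 1)" by simp
    qed
    with n have "enat n \<le> enat (n - 1)" by (rule order_trans)
    with \<open>n \<noteq> 0\<close> show False by simp
  qed
next
  assume "\<exists>X. chain_to L n X"
  then show "enat n \<le> chain_length L" unfolding chain_length_eq_Sup by (auto intro: Sup_upper)
qed

lemma enat_leI: "(\<And>n. enat n \<le> x \<Longrightarrow> enat n \<le> y) \<Longrightarrow> x \<le> y" for x y :: enat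
proof (cases y)
  case (enat k)
  assume *: "\<And>n. enat n \<le> x \<Longrightarrow> enat n \<le> y"
  show ?thesis
  proof (rule ccontr)
    assume "\<not> x \<le> y"
    then have "enat (Suc k) \<le> x" using enat by (simp add: Suc_ile_eq)
    from *[OF this] enat show False by simp
  qed
qed auto

lemma chain_to_image:
  assumes "chain_to L n X" and f: "\<And>X. X \<in> L \<Longrightarrow> f X \<in> L'"
    and mono: "\<And>X Y. X \<in> L \<Longrightarrow> Y \<in> L \<Longrightarrow> X \<subset> Y \<Longrightarrow> f X \<subset> f Y"
  shows "chain_to L' n (f X)"
  using assms(1)
proof induction
  case (chain_to_0 X) then show ?case by (intro chain_to.chain_to_0 f)
next
  case (chain_to_Suc n X Y)
  then have "f X \<subset> f Y" using chain_to_mem[of L n X] by (intro mono)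
  with chain_to_Suc f show ?case by (auto intro: chain_to.chain_to_Suc)
qed

lemma chain_length_mono:
  assumes f: "\<And>X. X \<in> L \<Longrightarrow> f X \<in> L'"
    and mono: "\<And>X Y. X \<in> L \<Longrightarrow> Y \<in> L \<Longrightarrow> X \<subset> Y \<Longrightarrow> f X \<subset> f Y"
  shows "chain_length L \<le> chain_length L'"
  unfolding chain_length_eq_Sup
proof (rule Sup_subset_mono, clarify)
  fix n X assume "chain_to L n X"
  then have "chain_to L' n (f X)" using f mono by (rule chain_to_image)
  then show "\<exists>n'. enat n = enat n' \<and> (\<exists>X. chain_to L' n' X)" by blast
qed

text \<open>Every strict step of a chain is strict in at least one of the two coordinates \<open>f\<close> and \<open>g\<close>,
  because together they determine the members.\<close>
lemma chain_length_le_add: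
  assumes ne: "L \<noteq> {}"
    and f: "\<And>X. X \<in> L \<Longrightarrow> f X \<in> L1" and g: "\<And>X. X \<in> L \<Longrightarrow> g X \<in> L2"
    and fm: "\<And>X Y. X \<in> L \<Longrightarrow> Y \<in> L \<Longrightarrow> X \<subseteq> Y \<Longrightarrow> f X \<subseteq> f Y"
    and gm: "\<And>X Y. X \<in> L \<Longrightarrow> Y \<in> L \<Longrightarrow> X \<subseteq> Y \<Longrightarrow> g X \<subseteq> g Y"
    and fg: "\<And>X Y. X \<in> L \<Longrightarrow> Y \<in> L \<Longrightarrow> X \<subseteq> Y \<Longrightarrow> f X = f Y \<Longrightarrow> g X = g Y \<Longrightarrow> X = Y"
  shows "chain_length L \<le> chain_length L1 + chain_length L2"
proof (rule enat_leI)
  fix n assume "enat n \<le> chain_length L"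
  then obtain X where "chain_to L n X" using chain_length_ge_iff[OF ne] by blast
  then have "\<exists>p q. n \<le> p + q \<and> chain_to L1 p (f X) \<and> chain_to L2 q (g X)"
  proof induction
    case (chain_to_0 X)
    then show ?case using f g chain_to.chain_to_0 by (metis zero_le)
  next
    case (chain_to_Suc n X Y)
    then obtain p q where pq: "n \<le> p + q" "chain_to L1 p (f X)" "chain_to L2 q (g X)" by blast
    have XY: "X \<in> L" "Y \<in> L" "X \<subseteq> Y" "X \<noteq> Y" using chain_to_Suc chain_to_mem by auto
    have "f X \<subset> f Y \<and> g X = g Y \<or> g X \<subset> g Y \<and> f X = f Y \<or> f X \<subset> f Y \<and> g X \<subset> g Y"
      using fm[of X Y] gm[of X Y] fg[of X Y] XY by blast
    moreover have "chain_to L1 (Suc p) (f Y)" if "f X \<subset> f Y"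
      using that pq f XY by (auto intro: chain_to.intros)
    moreover have "chain_to L2 (Suc q) (g Y)" if "g X \<subset> g Y"
      using that pq g XY by (auto intro: chain_to.intros)
    ultimately show ?case using pq
      by (elim disjE) (metis Suc_le_mono add_Suc, metis Suc_le_mono add_Suc_right,
          metis Suc_le_mono add_Suc le_Suc_eq add_Suc_right)
  qed
  then obtain p q where pq: "n \<le> p + q" "chain_to L1 p (f X)" "chain_to L2 q (g X)" by blast
  then have "enat p \<le> chain_length L1" "enat q \<le> chain_length L2"
    using chain_length_ge_iff chain_to_mem by (metis empty_iff)+
  then have "enat p + enat q \<le> chain_length L1 + chain_length L2" by (rule add_mono)
  moreover have "enat n \<le> enat p + enat q" using pq by simp
  ultimately show "enat n \<le> chain_length L1 + chain_length L2" by (rule order_trans[rotated])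
qed

text \<open>A chain of the first family is followed by one of the second.\<close>
lemma chain_length_add_le:
  assumes ne: "L1 \<noteq> {}" "L2 \<noteq> {}"
    and f: "\<And>X. X \<in> L1 \<Longrightarrow> f X \<in> L" and g: "\<And>X. X \<in> L2 \<Longrightarrow> g X \<in> L"
    and fm: "\<And>X Y. X \<in> L1 \<Longrightarrow> Y \<in> L1 \<Longrightarrow> X \<subset> Y \<Longrightarrow> f X \<subset> f Y"
    and gm: "\<And>X Y. X \<in> L2 \<Longrightarrow> Y \<in> L2 \<Longrightarrow> X \<subset> Y \<Longrightarrow> g X \<subset> g Y"
    and fg: "\<And>X Y. X \<in> L1 \<Longrightarrow> Y \<in> L2 \<Longrightarrow> f X \<subseteq> g Y"
  shows "chain_length L1 + chain_length L2 \<le> chain_length L"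
proof (rule enat_leI)
  have Lne: "L \<noteq> {}" using ne f by blast
  fix n assume n: "enat n \<le> chain_length L1 + chain_length L2"
  obtain p q where pq: "n = p + q" "enat p \<le> chain_length L1" "enat q \<le> chain_length L2"
  proof (cases "chain_length L1")
    case (enat k)
    show thesis
    proof (cases "n \<le> k")
      case True then show thesis using that[of n 0] enat by (simp add: zero_enat_def[symmetric])
    next
      case False
      then have "enat (n - k) \<le> chain_length L2"
        using n enat by (cases "chain_length L2") auto
      then show thesis using that[of k "n - k"] enat False by simp
    qed
  next
    case infinity then show thesis using that[of n 0] by (simp add: zero_enat_def[symmetric])
  qed
  then obtain X Y where X: "chain_to L1 p X" and Y: "chain_to L2 q Y"
    using chain_length_ge_iff ne by metis
  from X f fm have fX: "chain_to L p (f X)" by (rule chain_to_image)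
  from Y have "\<exists>k. p + q \<le> k \<and> chain_to L k (g Y)"
  proof induction
    case (chain_to_0 Y)
    then have "f X = g Y \<or> f X \<subset> g Y" using fg chain_to_mem[OF X] by blast
    then show ?case using fX g chain_to_0 by (metis chain_to_Suc add_0_right le_refl le_Suc_eq)
  next
    case (chain_to_Suc q Y Z)
    then obtain k where k: "p + q \<le> k" "chain_to L k (g Y)" by blast
    have "g Y \<subset> g Z" using chain_to_Suc chain_to_mem[of L2 q Y] by (intro gm)
    then have "chain_to L (Suc k) (g Z)"
      using chain_to.chain_to_Suc[OF k(2)] chain_to_Suc g by blast
    then show ?case using k by (metis Suc_le_mono add_Suc_right)
  qed
  then obtain k where "p + q \<le> k" "chain_to L k (g Y)" by blast
  then show "enat n \<le> chain_length L" using pq chain_length_ge_iff[OF Lne] chain_to_shorter by metis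
qed

lemma module_length_eq_chain_length: "module_length R M = chain_length {N. submodule N R M}"
  unfolding module_length_def chain_length_def by simp

lemma krull_dim_eq_chain_length: "krull_dim R = chain_length {P. primeideal P R}"
  unfolding krull_dim_def chain_length_def by simp


section \<open>Submodules and subquotients\<close>

lemma (in module) submodule_iff:
  "submodule H R M \<longleftrightarrow> H \<subseteq> carrier M \<and> \<zero>\<^bsub>M\<^esub> \<in> H \<and> (\<forall>x\<in>H. \<forall>y\<in>H. x \<oplus>\<^bsub>M\<^esub> y \<in> H) \<and>
     (\<forall>r\<in>carrier R. \<forall>x\<in>H. r \<odot>\<^bsub>M\<^esub> x \<in> H)"
proof
  assume H: "submodule H R M"
  then interpret H: submodule H R M .
  have "\<zero>\<^bsub>M\<^esub> \<in> H" using H.one_closed by simp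
  then show "H \<subseteq> carrier M \<and> \<zero>\<^bsub>M\<^esub> \<in> H \<and> (\<forall>x\<in>H. \<forall>y\<in>H. x \<oplus>\<^bsub>M\<^esub> y \<in> H) \<and>
     (\<forall>r\<in>carrier R. \<forall>x\<in>H. r \<odot>\<^bsub>M\<^esub> x \<in> H)"
    using submoduleE(1,4,5)[OF H] by simp
next
  assume H: "H \<subseteq> carrier M \<and> \<zero>\<^bsub>M\<^esub> \<in> H \<and> (\<forall>x\<in>H. \<forall>y\<in>H. x \<oplus>\<^bsub>M\<^esub> y \<in> H) \<and>
     (\<forall>r\<in>carrier R. \<forall>x\<in>H. r \<odot>\<^bsub>M\<^esub> x \<in> H)"
  have "\<ominus>\<^bsub>M\<^esub> x \<in> H" if "x \<in> H" for x
  proof -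
    have "\<ominus>\<^bsub>M\<^esub> x = (\<ominus> \<one>) \<odot>\<^bsub>M\<^esub> x" using that H smult_l_minus[of \<one> x] by auto
    then show ?thesis using that H by simp
  qed
  with H show "submodule H R M" by (intro submoduleI) auto
qed

lemma (in module) module_carrier_update:
  assumes "submodule H R M"
  shows "module R (M\<lparr>carrier := H\<rparr>)"
  using submodule.submodule_is_module[OF assms module_axioms] .

lemma (in module) abelian_subgroup_submodule:
  assumes "submodule B R M" shows "abelian_subgroup B M"
proof (rule abelian_subgroupI3)
  show "additive_subgroup B M"
    using assms by (simp add: additive_subgroup_def submodule.axioms(1))
  show "abelian_group M" by (rule abelian_group_axioms)
qed

lemma module_homD:
  assumes "h \<in> module_hom R M N"
  shows "x \<in> carrier M \<Longrightarrow> h x \<in> carrier N"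
    "x \<in> carrier M \<Longrightarrow> y \<in> carrier M \<Longrightarrow> h (x \<oplus>\<^bsub>M\<^esub> y) = h x \<oplus>\<^bsub>N\<^esub> h y"
    "r \<in> carrier R \<Longrightarrow> x \<in> carrier M \<Longrightarrow> h (r \<odot>\<^bsub>M\<^esub> x) = r \<odot>\<^bsub>N\<^esub> h x"
  using assms unfolding module_hom_def by auto

lemma module_hom_zero:
  assumes "module R M" "module R N" "h \<in> module_hom R M N"
  shows "h \<zero>\<^bsub>M\<^esub> = \<zero>\<^bsub>N\<^esub>"
proof -
  interpret M: module R M by fact
  interpret N: module R N by fact
  show ?thesis
    using module_homD(3)[OF assms(3), of "\<zero>\<^bsub>R\<^esub>" "\<zero>\<^bsub>M\<^esub>"] module_homD(1)[OF assms(3), of "\<zero>\<^bsub>M\<^esub>"] by simp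
qed

lemma module_hom_image_submodule:
  assumes "module R M" "module R N" "h \<in> module_hom R M N" "submodule K R M"
  shows "submodule (h ` K) R N"
proof -
  interpret M: module R M by fact
  interpret N: module R N by fact
  note h = module_homD[OF assms(3)] module_hom_zero[OF assms(1-3)]
  have K: "K \<subseteq> carrier M" "\<zero>\<^bsub>M\<^esub> \<in> K" "\<And>x y. x \<in> K \<Longrightarrow> y \<in> K \<Longrightarrow> x \<oplus>\<^bsub>M\<^esub> y \<in> K"
    "\<And>r x. r \<in> carrier R \<Longrightarrow> x \<in> K \<Longrightarrow> r \<odot>\<^bsub>M\<^esub> x \<in> K" using assms(4) M.submodule_iff by auto
  then show ?thesis
    unfolding N.submodule_iff using h(1)
    by (auto simp: h(4)[symmetric] h(2,3)[symmetric] subset_iff)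
qed

lemma module_hom_preimage_submodule:
  assumes "module R M" "module R N" "h \<in> module_hom R M N" "submodule K R N"
  shows "submodule {x \<in> carrier M. h x \<in> K} R M"
proof -
  interpret M: module R M by fact
  interpret N: module R N by fact
  have "\<zero>\<^bsub>N\<^esub> \<in> K" "\<And>x y. x \<in> K \<Longrightarrow> y \<in> K \<Longrightarrow> x \<oplus>\<^bsub>N\<^esub> y \<in> K"
    "\<And>r x. r \<in> carrier R \<Longrightarrow> x \<in> K \<Longrightarrow> r \<odot>\<^bsub>N\<^esub> x \<in> K" using assms(4) N.submodule_iff by auto
  then show ?thesis
    unfolding M.submodule_iff by (auto simp: module_homD[OF assms(3)] module_hom_zero[OF assms(1-3)])
qed

lemma module_hom_kernel_submodule:
  assumes "module R M" "module R N" "h \<in> module_hom R M N"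
  shows "submodule {v \<in> carrier M. h v = \<zero>\<^bsub>N\<^esub>} R M"
proof -
  interpret N: module R N by fact
  have "submodule {\<zero>\<^bsub>N\<^esub>} R N" by (simp add: N.submodule_iff)
  from module_hom_preimage_submodule[OF assms this] show ?thesis by simp
qed

lemma module_hom_diff:
  assumes "module R M" "module R N" "h \<in> module_hom R M N" "x \<in> carrier M" "y \<in> carrier M" "h x = h y"
  shows "h (x \<ominus>\<^bsub>M\<^esub> y) = \<zero>\<^bsub>N\<^esub>"
proof -
  interpret M: module R M by fact
  interpret N: module R N by fact
  have "x \<ominus>\<^bsub>M\<^esub> y = x \<oplus>\<^bsub>M\<^esub> (\<ominus>\<^bsub>R\<^esub> \<one>\<^bsub>R\<^esub>) \<odot>\<^bsub>M\<^esub> y"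
    using assms(5) by (simp add: M.minus_eq M.smult_l_minus)
  then show ?thesis
    using module_homD[OF assms(3)] assms(4-6) by (simp add: N.smult_l_minus N.r_neg)
qed

lemma module_length_of_surjective_hom:
  assumes M: "module R M" and N: "module R N" and h: "h \<in> module_hom R M N"
    and surj: "h ` carrier M = carrier N"
  shows "module_length R N = chain_length {K. submodule K R M \<and> {x \<in> carrier M. h x = \<zero>\<^bsub>N\<^esub>} \<subseteq> K}"
    (is "_ = chain_length ?L")
proof -
  interpret M: module R M by fact
  interpret N: module R N by fact
  have "chain_length ?L \<le> chain_length {K. submodule K R N}"
  proof (rule chain_length_mono[where f = "\<lambda>K. h ` K"])
    show "h ` K \<in> {K. submodule K R N}" if "K \<in> ?L" for K
      using that module_hom_image_submodule[OF M N h] by simp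
    fix K K' assume K: "K \<in> ?L" "K' \<in> ?L" "K \<subset> K'"
    then obtain x where x: "x \<in> K'" "x \<notin> K" by blast
    have "h x \<notin> h ` K"
    proof
      assume "h x \<in> h ` K"
      then obtain y where y: "y \<in> K" "h x = h y" by auto
      have c: "x \<in> carrier M" "y \<in> carrier M" using x y K M.submoduleE(1)[of K] M.submoduleE(1)[of K'] by auto
      then have "x \<ominus>\<^bsub>M\<^esub> y \<in> K" using K(1) module_hom_diff[OF M N h c y(2)] by auto
      then have "(x \<ominus>\<^bsub>M\<^esub> y) \<oplus>\<^bsub>M\<^esub> y \<in> K" using y(1) K(1) M.submodule_iff[of K] by simp
      then show False using x(2) c by (simp add: M.minus_eq M.a_assoc M.l_neg)
    qed
    then show "h ` K \<subset> h ` K'" using x K(3) by blast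
  qed
  moreover have "chain_length {K. submodule K R N} \<le> chain_length ?L"
  proof (rule chain_length_mono[where f = "\<lambda>K. {x \<in> carrier M. h x \<in> K}"])
    show "{x \<in> carrier M. h x \<in> K} \<in> ?L" if "K \<in> {K. submodule K R N}" for K
      using that module_hom_preimage_submodule[OF M N h, of K] N.submodule_iff[of K] by auto
    fix K K' assume K: "K \<in> {K. submodule K R N}" "K' \<in> {K. submodule K R N}" "K \<subset> K'"
    then have "K' \<subseteq> h ` carrier M" using N.submoduleE(1)[of K'] surj by simp
    with K(3) show "{x \<in> carrier M. h x \<in> K} \<subset> {x \<in> carrier M. h x \<in> K'}" by blast
  qed
  ultimately show ?thesis unfolding module_length_eq_chain_length by (rule antisym[rotated])
qed

lemma quot_module_cosets:
  assumes "module R M" "submodule B R M"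
  shows "carrier (quot_module M B) = (\<lambda>x. B +>\<^bsub>M\<^esub> x) ` carrier M"
    and "x \<in> carrier M \<Longrightarrow> y \<in> carrier M \<Longrightarrow>
      (B +>\<^bsub>M\<^esub> x) \<oplus>\<^bsub>quot_module M B\<^esub> (B +>\<^bsub>M\<^esub> y) = B +>\<^bsub>M\<^esub> (x \<oplus>\<^bsub>M\<^esub> y)"
    and "r \<in> carrier R \<Longrightarrow> x \<in> carrier M \<Longrightarrow>
      r \<odot>\<^bsub>quot_module M B\<^esub> (B +>\<^bsub>M\<^esub> x) = B +>\<^bsub>M\<^esub> (r \<odot>\<^bsub>M\<^esub> x)"
    and "\<zero>\<^bsub>quot_module M B\<^esub> = B +>\<^bsub>M\<^esub> \<zero>\<^bsub>M\<^esub>"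
    and "x \<in> carrier M \<Longrightarrow> B +>\<^bsub>M\<^esub> x = \<zero>\<^bsub>quot_module M B\<^esub> \<longleftrightarrow> x \<in> B"
proof -
  interpret module R M by fact
  interpret B: abelian_subgroup B M by (rule abelian_subgroup_submodule) fact
  show "carrier (quot_module M B) = (\<lambda>x. B +>\<^bsub>M\<^esub> x) ` carrier M"
    by (auto simp: quot_module_def A_RCOSETS_def')
  show "(B +>\<^bsub>M\<^esub> x) \<oplus>\<^bsub>quot_module M B\<^esub> (B +>\<^bsub>M\<^esub> y) = B +>\<^bsub>M\<^esub> (x \<oplus>\<^bsub>M\<^esub> y)"
    if "x \<in> carrier M" "y \<in> carrier M" for x y
    using that B.a_rcos_sum by (simp add: quot_module_def)
  show "\<zero>\<^bsub>quot_module M B\<^esub> = B +>\<^bsub>M\<^esub> \<zero>\<^bsub>M\<^esub>"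
    by (simp add: quot_module_def B.a_subset)
  show "B +>\<^bsub>M\<^esub> x = \<zero>\<^bsub>quot_module M B\<^esub> \<longleftrightarrow> x \<in> B" if "x \<in> carrier M"
    using that B.a_rcos_self[of x] a_coset_join2[OF that B.a_subgroup] by (auto simp: quot_module_def)
  assume r: "r \<in> carrier R" and x: "x \<in> carrier M"
  have "B +>\<^bsub>M\<^esub> (r \<odot>\<^bsub>M\<^esub> y) = B +>\<^bsub>M\<^esub> (r \<odot>\<^bsub>M\<^esub> x)" if y: "y \<in> B +>\<^bsub>M\<^esub> x" for y
  proof -
    from y obtain b where b: "b \<in> B" "y = b \<oplus>\<^bsub>M\<^esub> x" by (auto simp: a_r_coset_def')
    then have "r \<odot>\<^bsub>M\<^esub> y \<in> B +>\<^bsub>M\<^esub> (r \<odot>\<^bsub>M\<^esub> x)"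
      using submoduleE(4)[OF assms(2) r] r x by (auto simp: smult_r_distr a_r_coset_def')
    then show ?thesis using B.a_repr_independence'[of "r \<odot>\<^bsub>M\<^esub> y" "r \<odot>\<^bsub>M\<^esub> x"] r x by simp
  qed
  moreover have "x \<in> B +>\<^bsub>M\<^esub> x" using B.a_rcos_self x by simp
  ultimately have "(\<Union>y\<in>B +>\<^bsub>M\<^esub> x. B +>\<^bsub>M\<^esub> (r \<odot>\<^bsub>M\<^esub> y)) = B +>\<^bsub>M\<^esub> (r \<odot>\<^bsub>M\<^esub> x)"
    by blast
  then show "r \<odot>\<^bsub>quot_module M B\<^esub> (B +>\<^bsub>M\<^esub> x) = B +>\<^bsub>M\<^esub> (r \<odot>\<^bsub>M\<^esub> x)" by (simp add: quot_module_def)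
qed

lemma module_quot_module:
  assumes "module R M" "submodule B R M"
  shows "module R (quot_module M B)"
proof -
  interpret module R M by fact
  note q = quot_module_cosets[OF assms]
  have "abelian_group (quot_module M B)"
  proof (rule abelian_groupI)
    fix X assume "X \<in> carrier (quot_module M B)"
    then obtain x where x: "x \<in> carrier M" "X = B +>\<^bsub>M\<^esub> x" unfolding q(1) by blast
    then have "(B +>\<^bsub>M\<^esub> (\<ominus>\<^bsub>M\<^esub> x)) \<oplus>\<^bsub>quot_module M B\<^esub> X = \<zero>\<^bsub>quot_module M B\<^esub>"
      unfolding q(4) by (simp add: q(2) l_neg del: a_coset_add_zero)
    with x show "\<exists>Y\<in>carrier (quot_module M B). Y \<oplus>\<^bsub>quot_module M B\<^esub> X = \<zero>\<^bsub>quot_module M B\<^esub>"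
      unfolding q(1) by blast
  qed (auto simp: q(1,2,4) a_ac simp del: a_coset_add_zero)
  then show ?thesis
    by (intro moduleI is_cring) (auto simp: q(1-3) smult_l_distr smult_r_distr smult_assoc1)
qed

lemma coset_hom:
  assumes "module R M" "submodule B R M"
  shows "(\<lambda>x\<in>carrier M. B +>\<^bsub>M\<^esub> x) \<in> module_hom R M (quot_module M B)"
proof -
  interpret module R M by fact
  show ?thesis unfolding module_hom_def by (auto simp: quot_module_cosets[OF assms])
qed

lemma module_length_quot_module:
  assumes "module R M" "submodule B R M"
  shows "module_length R (quot_module M B) = chain_length {N. submodule N R M \<and> B \<subseteq> N}"
proof -
  have "{x \<in> carrier M. (\<lambda>x\<in>carrier M. B +>\<^bsub>M\<^esub> x) x = \<zero>\<^bsub>quot_module M B\<^esub>} = B"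
    using quot_module_cosets(5)[OF assms] module.submoduleE(1)[OF assms] by auto
  then show ?thesis
    using module_length_of_surjective_hom[OF assms(1) module_quot_module[OF assms] coset_hom[OF assms]]
    by (simp add: quot_module_cosets(1)[OF assms])
qed

text \<open>\<open>T\<close> is a submodule of \<open>Z \<times> Z'\<close> that induces an isomorphism \<open>Z/B \<rightarrow> Z'/B'\<close>. A relation instead
  of a map makes it possible to define connecting homomorphisms without choosing preimages.\<close>
lemma chain_length_le_of_correspondence:
  assumes "module R M" "module R M'"
    and Z: "submodule Z R M" and Z': "submodule Z' R M'"
    and B': "submodule B' R M'"
    and T: "T \<subseteq> Z \<times> Z'" and T0: "(\<zero>\<^bsub>M\<^esub>, \<zero>\<^bsub>M'\<^esub>) \<in> T"
    and Tadd: "\<And>x x' y y'. (x, x') \<in> T \<Longrightarrow> (y, y') \<in> T \<Longrightarrow> (x \<oplus>\<^bsub>M\<^esub> y, x' \<oplus>\<^bsub>M'\<^esub> y') \<in> T"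
    and Tsmult: "\<And>r x x'. r \<in> carrier R \<Longrightarrow> (x, x') \<in> T \<Longrightarrow> (r \<odot>\<^bsub>M\<^esub> x, r \<odot>\<^bsub>M'\<^esub> x') \<in> T"
    and total: "\<And>x. x \<in> Z \<Longrightarrow> \<exists>x'. (x, x') \<in> T" "\<And>x'. x' \<in> Z' \<Longrightarrow> \<exists>x. (x, x') \<in> T"
    and TB: "\<And>x x'. (x, x') \<in> T \<Longrightarrow> x \<in> B \<longleftrightarrow> x' \<in> B'"
    and BZ': "B' \<subseteq> Z'"
  shows "chain_length {N. submodule N R M \<and> B \<subseteq> N \<and> N \<subseteq> Z}
    \<le> chain_length {N. submodule N R M' \<and> B' \<subseteq> N \<and> N \<subseteq> Z'}"
proof -
  interpret module R M by fact
  interpret M': module R M' by fact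
  show ?thesis
  proof (rule chain_length_mono[where f = "\<lambda>N. T `` N"], goal_cases)
    case (1 N)
    then have N: "N \<subseteq> carrier M" "\<zero>\<^bsub>M\<^esub> \<in> N" "\<And>x y. x \<in> N \<Longrightarrow> y \<in> N \<Longrightarrow> x \<oplus>\<^bsub>M\<^esub> y \<in> N"
      "\<And>r x. r \<in> carrier R \<Longrightarrow> x \<in> N \<Longrightarrow> r \<odot>\<^bsub>M\<^esub> x \<in> N" using submodule_iff by auto
    have "Z' \<subseteq> carrier M'" by (rule M'.submoduleE(1)[OF Z'])
    then have "submodule (T `` N) R M'"
      unfolding M'.submodule_iff
    proof (intro conjI ballI)
      show "T `` N \<subseteq> carrier M'" using \<open>Z' \<subseteq> carrier M'\<close> T by blast
      show "\<zero>\<^bsub>M'\<^esub> \<in> T `` N" using N(2) T0 by (rule ImageI[rotated])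
    next
      fix x' y' assume "x' \<in> T `` N" "y' \<in> T `` N"
      then obtain x y where "(x, x') \<in> T" "x \<in> N" "(y, y') \<in> T" "y \<in> N" by blast
      then have "(x \<oplus>\<^bsub>M\<^esub> y, x' \<oplus>\<^bsub>M'\<^esub> y') \<in> T" "x \<oplus>\<^bsub>M\<^esub> y \<in> N" using Tadd N(3) by simp_all
      then show "x' \<oplus>\<^bsub>M'\<^esub> y' \<in> T `` N" by (rule ImageI)
    next
      fix r x' assume r: "r \<in> carrier R" "x' \<in> T `` N"
      then obtain x where "(x, x') \<in> T" "x \<in> N" by blast
      then have "(r \<odot>\<^bsub>M\<^esub> x, r \<odot>\<^bsub>M'\<^esub> x') \<in> T" "r \<odot>\<^bsub>M\<^esub> x \<in> N" using Tsmult N(4) r by simp_all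
      then show "r \<odot>\<^bsub>M'\<^esub> x' \<in> T `` N" by (rule ImageI)
    qed
    moreover have "B' \<subseteq> T `` N"
    proof
      fix y assume y: "y \<in> B'"
      then obtain x where "(x, y) \<in> T" using total(2) BZ' by blast
      then show "y \<in> T `` N" using TB y 1 by blast
    qed
    ultimately show ?case using T by blast
  next
    case (2 N N')
    then obtain x where x: "x \<in> N'" "x \<notin> N" "x \<in> Z" by blast
    then obtain x' where x': "(x, x') \<in> T" using total by blast
    have "x' \<notin> T `` N"
    proof
      assume "x' \<in> T `` N"
      then obtain y where y: "y \<in> N" "(y, x') \<in> T" by blast
      have car: "x \<in> carrier M" "y \<in> carrier M" "x' \<in> carrier M'"
        using x y x' T 2 submoduleE(1)[OF Z] M'.submoduleE(1)[OF Z'] by auto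
      have "((\<ominus>\<^bsub>R\<^esub> \<one>\<^bsub>R\<^esub>) \<odot>\<^bsub>M\<^esub> y, (\<ominus>\<^bsub>R\<^esub> \<one>\<^bsub>R\<^esub>) \<odot>\<^bsub>M'\<^esub> x') \<in> T" using Tsmult y by simp
      then have "(\<ominus>\<^bsub>M\<^esub> y, \<ominus>\<^bsub>M'\<^esub> x') \<in> T" using car by (simp add: smult_l_minus M'.smult_l_minus)
      from Tadd[OF x' this] have "(x \<oplus>\<^bsub>M\<^esub> \<ominus>\<^bsub>M\<^esub> y, \<zero>\<^bsub>M'\<^esub>) \<in> T" using car by (simp add: M'.r_neg)
      moreover have "\<zero>\<^bsub>M'\<^esub> \<in> B'" using B' M'.submodule_iff by simp
      ultimately have "x \<oplus>\<^bsub>M\<^esub> \<ominus>\<^bsub>M\<^esub> y \<in> N" using TB 2 by auto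
      then have "(x \<oplus>\<^bsub>M\<^esub> \<ominus>\<^bsub>M\<^esub> y) \<oplus>\<^bsub>M\<^esub> y \<in> N" using y 2 submodule_iff[of N] by simp
      then show False using x car by (simp add: a_assoc l_neg)
    qed
    with x x' 2 show ?case by blast
  qed
qed

lemma chain_length_eq_of_correspondence:
  assumes "module R M" "module R M'"
    and Z: "submodule Z R M" and Z': "submodule Z' R M'"
    and B: "submodule B R M" and B': "submodule B' R M'" and BZ: "B \<subseteq> Z" "B' \<subseteq> Z'"
    and T: "T \<subseteq> Z \<times> Z'" and T0: "(\<zero>\<^bsub>M\<^esub>, \<zero>\<^bsub>M'\<^esub>) \<in> T"
    and Tadd: "\<And>x x' y y'. (x, x') \<in> T \<Longrightarrow> (y, y') \<in> T \<Longrightarrow> (x \<oplus>\<^bsub>M\<^esub> y, x' \<oplus>\<^bsub>M'\<^esub> y') \<in> T"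
    and Tsmult: "\<And>r x x'. r \<in> carrier R \<Longrightarrow> (x, x') \<in> T \<Longrightarrow> (r \<odot>\<^bsub>M\<^esub> x, r \<odot>\<^bsub>M'\<^esub> x') \<in> T"
    and total: "\<And>x. x \<in> Z \<Longrightarrow> \<exists>x'. (x, x') \<in> T" "\<And>x'. x' \<in> Z' \<Longrightarrow> \<exists>x. (x, x') \<in> T"
    and TB: "\<And>x x'. (x, x') \<in> T \<Longrightarrow> x \<in> B \<longleftrightarrow> x' \<in> B'"
  shows "chain_length {N. submodule N R M \<and> B \<subseteq> N \<and> N \<subseteq> Z}
    = chain_length {N. submodule N R M' \<and> B' \<subseteq> N \<and> N \<subseteq> Z'}"
proof (rule antisym)
  show "chain_length {N. submodule N R M \<and> B \<subseteq> N \<and> N \<subseteq> Z}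
    \<le> chain_length {N. submodule N R M' \<and> B' \<subseteq> N \<and> N \<subseteq> Z'}"
    by (rule chain_length_le_of_correspondence[of R M M' Z Z' B' T B])
      (use assms in \<open>auto; fail\<close>)+
  show "chain_length {N. submodule N R M' \<and> B' \<subseteq> N \<and> N \<subseteq> Z'}
    \<le> chain_length {N. submodule N R M \<and> B \<subseteq> N \<and> N \<subseteq> Z}"
    by (rule chain_length_le_of_correspondence[of R M' M Z' Z B "T\<inverse>" B'])
      (use assms in \<open>auto; fail\<close>)+
qed


section \<open>Ideals of Noetherian rings\<close>

lemma (in cring) ideal_iff:
  "ideal A R \<longleftrightarrow> A \<subseteq> carrier R \<and> \<zero> \<in> A \<and> (\<forall>x\<in>A. \<forall>y\<in>A. x \<oplus> y \<in> A) \<and>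
     (\<forall>r\<in>carrier R. \<forall>x\<in>A. r \<otimes> x \<in> A)"
proof
  assume "ideal A R"
  then interpret A: ideal A R .
  show "A \<subseteq> carrier R \<and> \<zero> \<in> A \<and> (\<forall>x\<in>A. \<forall>y\<in>A. x \<oplus> y \<in> A) \<and>
     (\<forall>r\<in>carrier R. \<forall>x\<in>A. r \<otimes> x \<in> A)" using A.a_subset A.I_l_closed by simp
next
  assume A: "A \<subseteq> carrier R \<and> \<zero> \<in> A \<and> (\<forall>x\<in>A. \<forall>y\<in>A. x \<oplus> y \<in> A) \<and>
     (\<forall>r\<in>carrier R. \<forall>x\<in>A. r \<otimes> x \<in> A)"
  have inv: "\<ominus> x \<in> A" if "x \<in> A" for x
  proof -
    have "\<ominus> x = (\<ominus> \<one>) \<otimes> x" using that A by (auto simp: l_minus)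
    then show ?thesis using that A by simp
  qed
  show "ideal A R"
  proof (rule idealI)
    show "ring R" by (rule ring_axioms)
    show "subgroup A (add_monoid R)"
      using A inv by (intro subgroup.intro) (auto simp: a_inv_def)
    show "\<And>a x. a \<in> A \<Longrightarrow> x \<in> carrier R \<Longrightarrow> x \<otimes> a \<in> A" using A by simp
    show "a \<otimes> x \<in> A" if "a \<in> A" "x \<in> carrier R" for a x
      using A that m_comm[of a x] by auto
  qed
qed

lemma (in cring) idealD:
  assumes "ideal A R"
  shows "x \<in> A \<Longrightarrow> x \<in> carrier R" "\<zero> \<in> A" "x \<in> A \<Longrightarrow> y \<in> A \<Longrightarrow> x \<oplus> y \<in> A"
    "r \<in> carrier R \<Longrightarrow> x \<in> A \<Longrightarrow> r \<otimes> x \<in> A" "r \<in> carrier R \<Longrightarrow> x \<in> A \<Longrightarrow> x \<otimes> r \<in> A"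
    "x \<in> A \<Longrightarrow> \<ominus> x \<in> A" "x \<in> A \<Longrightarrow> y \<in> A \<Longrightarrow> x \<ominus> y \<in> A"
proof -
  interpret A: ideal A R by fact
  show "x \<in> A \<Longrightarrow> x \<in> carrier R" "\<zero> \<in> A" "x \<in> A \<Longrightarrow> y \<in> A \<Longrightarrow> x \<oplus> y \<in> A"
    "r \<in> carrier R \<Longrightarrow> x \<in> A \<Longrightarrow> r \<otimes> x \<in> A" "r \<in> carrier R \<Longrightarrow> x \<in> A \<Longrightarrow> x \<otimes> r \<in> A"
    "x \<in> A \<Longrightarrow> \<ominus> x \<in> A" "x \<in> A \<Longrightarrow> y \<in> A \<Longrightarrow> x \<ominus> y \<in> A"
    using A.I_l_closed A.I_r_closed by (simp_all add: minus_eq)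
qed

lemma (in cring) module_self_module: "module R (self_module R)"
proof -
  have "abelian_group (self_module R)"
    by (rule abelian_groupI)
      (auto simp: self_module_def a_ac intro: bexI[of _ "\<ominus> _"] l_neg)
  then show ?thesis
    by (intro moduleI is_cring) (auto simp: self_module_def l_distr r_distr m_assoc)
qed

lemma (in cring) submodule_self_module_iff: "submodule N R (self_module R) \<longleftrightarrow> ideal N R"
  unfolding module.submodule_iff[OF module_self_module] ideal_iff by (simp add: self_module_def)

lemma (in cring) module_self_module_ideal:
  assumes "ideal M R" shows "module R (self_module R\<lparr>carrier := M\<rparr>)"
  using assms by (intro module.module_carrier_update[OF module_self_module])
    (simp add: submodule_self_module_iff)

lemma (in cring) submodule_ideal_iff:
  assumes "ideal M R"
  shows "submodule N R (self_module R\<lparr>carrier := M\<rparr>) \<longleftrightarrow> ideal N R \<and> N \<subseteq> M"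
  using idealD(1)[OF assms]
  unfolding module.submodule_iff[OF module_self_module_ideal[OF assms]] ideal_iff
  by (auto simp add: self_module_def)

definition times_ideal :: "('a, 'r) ring_scheme \<Rightarrow> 'a set \<Rightarrow> 'a set \<Rightarrow> 'a set" where
  "times_ideal R X M = Idl\<^bsub>R\<^esub> {x \<otimes>\<^bsub>R\<^esub> m | x m. x \<in> X \<and> m \<in> M}"

lemma (in cring) times_ideal_generators:
  assumes "ideal M R" "X \<subseteq> carrier R"
  shows "{x \<otimes> m | x m. x \<in> X \<and> m \<in> M} \<subseteq> M" "{x \<otimes> m | x m. x \<in> X \<and> m \<in> M} \<subseteq> carrier R"
  using idealD(1,4)[OF assms(1)] assms(2) by auto

lemma (in cring) ideal_times_ideal:
  assumes "ideal M R" "X \<subseteq> carrier R"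
  shows "ideal (times_ideal R X M) R"
  unfolding times_ideal_def using times_ideal_generators(2)[OF assms] by (rule genideal_ideal)

lemma (in cring) times_ideal_subset:
  assumes "ideal M R" "X \<subseteq> carrier R"
  shows "times_ideal R X M \<subseteq> M"
  unfolding times_ideal_def using times_ideal_generators(1)[OF assms] assms(1) by (intro genideal_minimal)

lemma (in cring) times_ideal_mem:
  assumes "ideal M R" "X \<subseteq> carrier R" "x \<in> X" "m \<in> M"
  shows "x \<otimes> m \<in> times_ideal R X M"
  unfolding times_ideal_def using genideal_self[OF times_ideal_generators(2)[OF assms(1,2)]] assms(3,4)
  by blast

lemma (in cring) times_ideal_minimal:
  assumes "ideal N R" "\<And>x m. x \<in> X \<Longrightarrow> m \<in> M \<Longrightarrow> x \<otimes> m \<in> N"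
  shows "times_ideal R X M \<subseteq> N"
  unfolding times_ideal_def using assms by (intro genideal_minimal) auto

lemma (in cring) ideal_times_self_module:
  assumes "ideal M R" "X \<subseteq> carrier R"
  shows "ideal_times R X (self_module R\<lparr>carrier := M\<rparr>) = times_ideal R X M"
proof -
  have "{N. submodule N R (self_module R\<lparr>carrier := M\<rparr>) \<and> {x \<otimes> m | x m. x \<in> X \<and> m \<in> M} \<subseteq> N}
    = {N. ideal N R \<and> N \<subseteq> M \<and> {x \<otimes> m | x m. x \<in> X \<and> m \<in> M} \<subseteq> N}"
    using submodule_ideal_iff[OF assms(1)] by auto
  then have e: "ideal_times R X (self_module R\<lparr>carrier := M\<rparr>)
      = \<Inter>{N. ideal N R \<and> N \<subseteq> M \<and> {x \<otimes> m | x m. x \<in> X \<and> m \<in> M} \<subseteq> N}"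
    unfolding ideal_times_def submodule_span_def by (simp add: self_module_def)
  show ?thesis
  proof (rule antisym)
    show "ideal_times R X (self_module R\<lparr>carrier := M\<rparr>) \<subseteq> times_ideal R X M"
      unfolding e using ideal_times_ideal[OF assms] times_ideal_subset[OF assms] times_ideal_mem[OF assms]
      by (intro Inter_lower) auto
    show "times_ideal R X M \<subseteq> ideal_times R X (self_module R\<lparr>carrier := M\<rparr>)"
      unfolding e by (intro Inter_greatest times_ideal_minimal) auto
  qed
qed

lemma (in cring) times_ideal_carrier:
  assumes "X \<subseteq> carrier R"
  shows "times_ideal R X (carrier R) = Idl X"
proof (rule antisym)
  have "ideal (Idl X) R" "X \<subseteq> Idl X" using genideal_ideal genideal_self assms by auto
  then show "times_ideal R X (carrier R) \<subseteq> Idl X"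
    by (intro times_ideal_minimal) (auto intro: idealD(5))
  have "x \<in> times_ideal R X (carrier R)" if "x \<in> X" for x
    using times_ideal_mem[OF oneideal assms that one_closed] that assms by auto
  then show "Idl X \<subseteq> times_ideal R X (carrier R)"
    using ideal_times_ideal[OF oneideal assms] by (intro genideal_minimal) auto
qed

lemma (in cring) ideal_prod_Idl:
  assumes "ideal M R" "X \<subseteq> carrier R"
  shows "(Idl X) \<cdot> M = times_ideal R X M"
proof (rule antisym)
  have T: "ideal (times_ideal R X M) R" by (rule ideal_times_ideal[OF assms])
  have "Idl X \<subseteq> {r \<in> carrier R. \<forall>m\<in>M. r \<otimes> m \<in> times_ideal R X M}"
  proof (rule genideal_minimal)
    show "ideal {r \<in> carrier R. \<forall>m\<in>M. r \<otimes> m \<in> times_ideal R X M} R"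
      unfolding ideal_iff using idealD[OF T] idealD[OF assms(1)] by (auto simp: l_distr m_assoc)
    show "X \<subseteq> {r \<in> carrier R. \<forall>m\<in>M. r \<otimes> m \<in> times_ideal R X M}"
      using times_ideal_mem[OF assms] assms(2) by auto
  qed
  then have mem: "r \<otimes> m \<in> times_ideal R X M" if "r \<in> Idl X" "m \<in> M" for r m using that by auto
  show "(Idl X) \<cdot> M \<subseteq> times_ideal R X M"
  proof
    fix s assume "s \<in> (Idl X) \<cdot> M"
    then show "s \<in> times_ideal R X M"
      by (induction s rule: ideal_prod.induct) (auto intro: mem idealD(3)[OF T])
  qed
  show "times_ideal R X M \<subseteq> (Idl X) \<cdot> M"
  proof (rule times_ideal_minimal)
    show "ideal ((Idl X) \<cdot> M) R" using genideal_ideal assms by (intro ideal_prod_is_ideal) auto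
    show "x \<otimes> m \<in> (Idl X) \<cdot> M" if "x \<in> X" "m \<in> M" for x m
      using genideal_self[OF assms(2)] that by (intro ideal_prod.prod) auto
  qed
qed

definition add_multiples :: "('a, 'r) ring_scheme \<Rightarrow> 'a set \<Rightarrow> 'a \<Rightarrow> 'a set \<Rightarrow> 'a set" where
  "add_multiples R A x M = {a \<oplus>\<^bsub>R\<^esub> x \<otimes>\<^bsub>R\<^esub> m | a m. a \<in> A \<and> m \<in> M}"

lemma (in cring) add_multiples_ideal:
  assumes A: "ideal A R" and M: "ideal M R" and x: "x \<in> carrier R"
  shows "ideal (add_multiples R A x M) R" "A \<subseteq> add_multiples R A x M"
    "m \<in> M \<Longrightarrow> x \<otimes> m \<in> add_multiples R A x M"
proof -
  note a = idealD[OF A] and m = idealD[OF M]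
  show "ideal (add_multiples R A x M) R"
    unfolding ideal_iff add_multiples_def
  proof (intro conjI ballI; (clarify | simp))
    fix b n assume "b \<in> A" "n \<in> M" then show "b \<oplus> x \<otimes> n \<in> carrier R" using a(1) m(1) x by simp
  next
    show "\<exists>b n. \<zero> = b \<oplus> x \<otimes> n \<and> b \<in> A \<and> n \<in> M"
      using a(2) m(2) x by (intro exI[of _ \<zero>]) simp
  next
    fix b n b' n' assume *: "b \<in> A" "n \<in> M" "b' \<in> A" "n' \<in> M"
    then have "b \<oplus> x \<otimes> n \<oplus> (b' \<oplus> x \<otimes> n') = (b \<oplus> b') \<oplus> x \<otimes> (n \<oplus> n')"
      using a(1)[of b] a(1)[of b'] m(1)[of n] m(1)[of n'] x by algebra
    then show "\<exists>c k. b \<oplus> x \<otimes> n \<oplus> (b' \<oplus> x \<otimes> n') = c \<oplus> x \<otimes> k \<and> c \<in> A \<and> k \<in> M"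
      using * a(3) m(3) by blast
  next
    fix r b n assume *: "r \<in> carrier R" "b \<in> A" "n \<in> M"
    then have "r \<otimes> (b \<oplus> x \<otimes> n) = (r \<otimes> b) \<oplus> x \<otimes> (r \<otimes> n)"
      using a(1)[of b] m(1)[of n] x by algebra
    then show "\<exists>c k. r \<otimes> (b \<oplus> x \<otimes> n) = c \<oplus> x \<otimes> k \<and> c \<in> A \<and> k \<in> M"
      using * a(4) m(4) by blast
  qed
  show "A \<subseteq> add_multiples R A x M"
  proof
    fix b assume "b \<in> A"
    then have "b = b \<oplus> x \<otimes> \<zero>" using a(1) x by simp
    then show "b \<in> add_multiples R A x M" using \<open>b \<in> A\<close> m(2) unfolding add_multiples_def by blast
  qed
  assume "m \<in> M"
  then have "x \<otimes> m = \<zero> \<oplus> x \<otimes> m" using m(1) x by simp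
  then show "x \<otimes> m \<in> add_multiples R A x M" using \<open>m \<in> M\<close> a(2) unfolding add_multiples_def by blast
qed

lemma (in cring) add_multiples_subset:
  assumes "ideal M R" "A \<subseteq> M" "x \<in> carrier R"
  shows "add_multiples R A x M \<subseteq> M"
  using idealD(3,4)[OF assms(1)] assms(2,3) unfolding add_multiples_def by blast

lemma (in cring) times_ideal_empty:
  assumes "ideal M R" shows "times_ideal R {} M = {\<zero>}"
proof (rule antisym)
  show "times_ideal R {} M \<subseteq> {\<zero>}" by (rule times_ideal_minimal[OF zeroideal]) simp
  show "{\<zero>} \<subseteq> times_ideal R {} M" using idealD(2)[OF ideal_times_ideal[OF assms]] by simp
qed

lemma (in cring) times_ideal_insert:
  assumes M: "ideal M R" and X: "X \<subseteq> carrier R" and x: "x \<in> carrier R"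
  shows "times_ideal R (insert x X) M = add_multiples R (times_ideal R X M) x M"
proof (rule antisym)
  have T: "ideal (times_ideal R X M) R" by (rule ideal_times_ideal[OF M X])
  have X': "insert x X \<subseteq> carrier R" using X x by simp
  have T': "ideal (times_ideal R (insert x X) M) R" by (rule ideal_times_ideal[OF M X'])
  show "times_ideal R (insert x X) M \<subseteq> add_multiples R (times_ideal R X M) x M"
    using add_multiples_ideal[OF T M x] times_ideal_mem[OF M X]
    by (intro times_ideal_minimal) auto
  have "times_ideal R X M \<subseteq> times_ideal R (insert x X) M"
    using times_ideal_mem[OF M X'] by (intro times_ideal_minimal[OF T']) auto
  then show "add_multiples R (times_ideal R X M) x M \<subseteq> times_ideal R (insert x X) M"
    unfolding add_multiples_def using times_ideal_mem[OF M X', of x] idealD(3)[OF T'] by auto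
qed

definition annih_mod :: "('a, 'r) ring_scheme \<Rightarrow> 'a set \<Rightarrow> 'a \<Rightarrow> 'a set" where
  "annih_mod R A u = {r \<in> carrier R. r \<otimes>\<^bsub>R\<^esub> u \<in> A}"

lemma (in cring) ideal_annih_mod:
  assumes "ideal A R" "u \<in> carrier R" shows "ideal (annih_mod R A u) R"
  unfolding ideal_iff annih_mod_def using idealD[OF assms(1)] assms(2)
  by (auto simp: l_distr m_assoc)

lemma (in cring) annih_mod_multiple:
  assumes w: "w \<in> carrier R" and P: "primeideal (annih_mod R A w) R" and r: "r \<in> carrier R" "r \<otimes> w \<notin> A"
  shows "annih_mod R A (r \<otimes> w) = annih_mod R A w"
proof -
  have id: "ideal (annih_mod R A w) R" using P by (simp add: primeideal_def)
  have rn: "r \<notin> annih_mod R A w" using r(2) by (simp add: annih_mod_def)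
  have "x \<in> annih_mod R A (r \<otimes> w) \<longleftrightarrow> x \<in> annih_mod R A w" if x: "x \<in> carrier R" for x
  proof -
    have "x \<in> annih_mod R A (r \<otimes> w) \<longleftrightarrow> x \<otimes> r \<in> annih_mod R A w"
      using w r(1) x by (simp add: annih_mod_def m_assoc)
    also have "\<dots> \<longleftrightarrow> x \<in> annih_mod R A w"
    proof
      assume "x \<otimes> r \<in> annih_mod R A w"
      then show "x \<in> annih_mod R A w" using primeideal.I_prime[OF P x r(1)] rn by simp
    next
      assume "x \<in> annih_mod R A w"
      then show "x \<otimes> r \<in> annih_mod R A w" by (rule ideal.I_r_closed[OF id _ r(1)])
    qed
    finally show ?thesis .
  qed
  moreover have "annih_mod R A v \<subseteq> carrier R" for v by (auto simp: annih_mod_def)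
  ultimately show ?thesis by blast
qed

locale noetherian_cring = noetherian_ring + cring
begin

lemma exists_maximal:
  assumes ne: "Q A0" and id: "\<And>A. Q A \<Longrightarrow> ideal A R"
  obtains A where "Q A" "\<And>B. Q B \<Longrightarrow> A \<subseteq> B \<Longrightarrow> B = A"
proof -
  define \<C> where "\<C> = {A. Q A}"
  have \<C>: "\<C> \<noteq> {}" "\<C> \<subseteq> {A. ideal A R}" unfolding \<C>_def using ne id by auto
  have "\<Union>C \<in> \<C>" if "C \<noteq> {}" "subset.chain \<C> C" for C
  proof -
    have "C \<subseteq> \<C>" using that unfolding pred_on.chain_def by blast
    with \<C>(2) have "C \<subseteq> {A. ideal A R}" by (rule subset_trans[rotated])
    then have "subset.chain {I. ideal I R} C" using that(2) unfolding pred_on.chain_def by blast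
    with that(1) have "\<Union>C \<in> C" by (rule ideal_chain_is_trivial)
    with \<open>C \<subseteq> \<C>\<close> show ?thesis by blast
  qed
  from subset_Zorn_nonempty[OF \<C>(1) this] have "\<exists>M\<in>\<C>. \<forall>X\<in>\<C>. M \<subseteq> X \<longrightarrow> X = M" .
  then show thesis using that unfolding \<C>_def by auto
qed

text \<open>An ideal maximal among those above \<open>A\<close> and disjoint from \<open>S\<close> is prime.\<close>
lemma exists_prime_avoiding:
  assumes A: "ideal A R" and S: "S \<subseteq> carrier R" "\<one> \<in> S" "\<And>s t. s \<in> S \<Longrightarrow> t \<in> S \<Longrightarrow> s \<otimes> t \<in> S"
    and AS: "A \<inter> S = {}"
  obtains P where "primeideal P R" "A \<subseteq> P" "P \<inter> S = {}"
proof -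
  obtain P where P: "ideal P R" "A \<subseteq> P" "P \<inter> S = {}"
    and max: "\<And>B. ideal B R \<Longrightarrow> B \<inter> S = {} \<Longrightarrow> P \<subseteq> B \<Longrightarrow> B = P"
  proof (rule exists_maximal[of "\<lambda>B. ideal B R \<and> A \<subseteq> B \<and> B \<inter> S = {}" A])
    show "ideal A R \<and> A \<subseteq> A \<and> A \<inter> S = {}" using A AS by simp
  qed (auto simp: subset_iff)
  have ext: "\<exists>p\<in>P. \<exists>r\<in>carrier R. p \<oplus> x \<otimes> r \<in> S" if "x \<in> carrier R" "x \<notin> P" for x
  proof -
    have *: "ideal (add_multiples R P x (carrier R)) R" "P \<subseteq> add_multiples R P x (carrier R)"
      "x \<otimes> \<one> \<in> add_multiples R P x (carrier R)"
      using add_multiples_ideal[OF P(1) oneideal that(1)] by auto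
    then have "add_multiples R P x (carrier R) \<inter> S \<noteq> {}" using max[OF *(1) _ *(2)] that by auto
    then show ?thesis unfolding add_multiples_def by blast
  qed
  have "primeideal P R"
  proof (rule primeidealI[OF P(1) is_cring])
    show "carrier R \<noteq> P" using P(3) S by auto
    fix a b assume ab: "a \<in> carrier R" "b \<in> carrier R" "a \<otimes> b \<in> P"
    show "a \<in> P \<or> b \<in> P"
    proof (rule ccontr)
      assume "\<not> ?thesis"
      then obtain p r q s where *: "p \<in> P" "r \<in> carrier R" "p \<oplus> a \<otimes> r \<in> S"
        "q \<in> P" "s \<in> carrier R" "q \<oplus> b \<otimes> s \<in> S" using ext[of a] ext[of b] ab by blast
      have c: "p \<in> carrier R" "q \<in> carrier R" using * idealD(1)[OF P(1)] by auto
      have "(p \<oplus> a \<otimes> r) \<otimes> (q \<oplus> b \<otimes> s) = (q \<oplus> b \<otimes> s) \<otimes> p \<oplus> ((a \<otimes> r) \<otimes> q \<oplus> (r \<otimes> s) \<otimes> (a \<otimes> b))"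
        using c * ab by algebra
      also have "\<dots> \<in> P" using idealD[OF P(1)] * ab c by simp
      finally show False using S(3)[OF *(3,6)] P(3) by blast
    qed
  qed
  with P that show thesis by blast
qed

text \<open>Among the annihilators modulo \<open>A\<close> of the multiples of \<open>v\<close> outside \<open>A\<close>, a maximal one is prime.\<close>
lemma exists_associated_prime:
  assumes A: "ideal A R" and M: "ideal M R" and v: "v \<in> M" "v \<notin> A"
  obtains u where "u \<in> M" "u \<notin> A" "primeideal (annih_mod R A u) R" "annih_mod R A v \<subseteq> annih_mod R A u"
proof -
  have vc: "v \<in> carrier R" using idealD(1)[OF M v(1)] .
  define \<C> where "\<C> = {annih_mod R A (r \<otimes> v) | r. r \<in> carrier R \<and> r \<otimes> v \<notin> A}"
  have "annih_mod R A (\<one> \<otimes> v) \<in> \<C>" unfolding \<C>_def using v vc by fastforce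
  moreover have "\<And>B. B \<in> \<C> \<Longrightarrow> ideal B R" unfolding \<C>_def using ideal_annih_mod[OF A] vc by auto
  ultimately obtain P where "P \<in> \<C>" and max: "\<And>B. B \<in> \<C> \<Longrightarrow> P \<subseteq> B \<Longrightarrow> B = P"
    using exists_maximal[of "\<lambda>B. B \<in> \<C>" "annih_mod R A (\<one> \<otimes> v)"] by metis
  then obtain r where r: "r \<in> carrier R" "r \<otimes> v \<notin> A" and P: "P = annih_mod R A (r \<otimes> v)"
    unfolding \<C>_def by blast
  have "primeideal P R"
  proof (rule primeidealI[OF _ is_cring])
    show "ideal P R" unfolding P using ideal_annih_mod[OF A] r vc by simp
    have "\<one> \<notin> P" unfolding P annih_mod_def using r vc by simp
    then show "carrier R \<noteq> P" using one_closed by metis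
    fix a b assume ab: "a \<in> carrier R" "b \<in> carrier R" "a \<otimes> b \<in> P"
    show "a \<in> P \<or> b \<in> P"
    proof (rule disjCI)
      assume "b \<notin> P"
      then have b: "(b \<otimes> r) \<otimes> v \<notin> A" unfolding P annih_mod_def using ab r vc by (simp add: m_assoc)
      have e: "annih_mod R A ((b \<otimes> r) \<otimes> v) = P"
      proof (rule max)
        show "annih_mod R A ((b \<otimes> r) \<otimes> v) \<in> \<C>" unfolding \<C>_def using b ab r by blast
        show "P \<subseteq> annih_mod R A ((b \<otimes> r) \<otimes> v)"
        proof
          fix s assume s: "s \<in> P"
          then have sc: "s \<in> carrier R" "s \<otimes> (r \<otimes> v) \<in> A" unfolding P annih_mod_def by auto
          have "s \<otimes> ((b \<otimes> r) \<otimes> v) = b \<otimes> (s \<otimes> (r \<otimes> v))" using sc ab r vc by algebra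
          then show "s \<in> annih_mod R A ((b \<otimes> r) \<otimes> v)"
            unfolding annih_mod_def using sc idealD(4)[OF A ab(2) sc(2)] by simp
        qed
      qed
      have "a \<otimes> ((b \<otimes> r) \<otimes> v) = (a \<otimes> b) \<otimes> (r \<otimes> v)" using ab r vc by algebra
      moreover have "(a \<otimes> b) \<otimes> (r \<otimes> v) \<in> A" using ab(3) unfolding P annih_mod_def by simp
      ultimately have "a \<in> annih_mod R A ((b \<otimes> r) \<otimes> v)" using ab(1) unfolding annih_mod_def by simp
      then show "a \<in> P" unfolding e .
    qed
  qed
  moreover have "annih_mod R A v \<subseteq> P"
  proof
    fix s assume "s \<in> annih_mod R A v"
    then have s: "s \<in> carrier R" "s \<otimes> v \<in> A" unfolding annih_mod_def by auto
    have "s \<otimes> (r \<otimes> v) = r \<otimes> (s \<otimes> v)" using s r vc by algebra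
    then show "s \<in> P" unfolding P annih_mod_def using s idealD(4)[OF A r(1) s(2)] by simp
  qed
  ultimately show thesis using that[of "r \<otimes> v"] r P idealD(4)[OF M r(1) v(1)] by blast
qed

text \<open>Let \<open>(A : u)\<close> be prime and \<open>A' = A + Ru\<close>. If \<open>Q = (A : w)\<close> is prime, then either \<open>Rw\<close> meets
  \<open>A' \<setminus> A\<close>, and \<open>Q = (A : u)\<close> because \<open>A'/A\<close> is isomorphic to \<open>R/(A : u)\<close>, or \<open>Q = (A' : w)\<close>.
  So \<open>A\<close> has at most one associated prime more than the strictly larger ideal \<open>A'\<close>, hence
  no ideal is maximal among those with infinitely many.\<close>
lemma finite_associated_primes:
  assumes "ideal A R"
  shows "finite {annih_mod R A w | w. w \<in> carrier R \<and> w \<notin> A \<and> primeideal (annih_mod R A w) R}"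
proof (rule ccontr)
  let ?Ass = "\<lambda>A. {annih_mod R A w | w. w \<in> carrier R \<and> w \<notin> A \<and> primeideal (annih_mod R A w) R}"
  assume inf: "infinite (?Ass A)"
  obtain A where A: "ideal A R" "infinite (?Ass A)"
    and max: "\<And>B. ideal B R \<Longrightarrow> infinite (?Ass B) \<Longrightarrow> A \<subseteq> B \<Longrightarrow> B = A"
  proof (rule exists_maximal[of "\<lambda>A. ideal A R \<and> infinite (?Ass A)" A])
    fix A assume A: "ideal A R \<and> infinite (?Ass A)"
      "\<And>B. ideal B R \<and> infinite (?Ass B) \<Longrightarrow> A \<subseteq> B \<Longrightarrow> B = A"
    show thesis by (rule that[of A]) (use A in \<open>simp_all only: simp_thms\<close>)
  qed (use assms inf in simp_all)
  have "?Ass A \<noteq> {}" using A(2) by (metis finite.emptyI)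
  then obtain u where u: "u \<in> carrier R" "u \<notin> A" and P: "primeideal (annih_mod R A u) R" by blast
  let ?A' = "add_multiples R A u (carrier R)"
  have A': "ideal ?A' R" "A \<subseteq> ?A'" "u \<otimes> \<one> \<in> ?A'"
    using add_multiples_ideal[OF A(1) oneideal u(1)] by auto
  have "?Ass A \<subseteq> insert (annih_mod R A u) (?Ass ?A')"
  proof
    fix Q assume "Q \<in> ?Ass A"
    then obtain w where w: "w \<in> carrier R" "w \<notin> A" and Q: "Q = annih_mod R A w" "primeideal Q R" by auto
    show "Q \<in> insert (annih_mod R A u) (?Ass ?A')"
    proof (cases "\<exists>r\<in>carrier R. r \<otimes> w \<in> ?A' \<and> r \<otimes> w \<notin> A")
      case True
      then obtain r where r: "r \<in> carrier R" "r \<otimes> w \<in> ?A'" "r \<otimes> w \<notin> A" by blast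
      then obtain a s where as: "a \<in> A" "s \<in> carrier R" "r \<otimes> w = a \<oplus> u \<otimes> s"
        unfolding add_multiples_def by blast
      have ac: "a \<in> carrier R" using idealD(1)[OF A(1)] as by blast
      have su: "s \<otimes> u \<notin> A"
      proof
        assume "s \<otimes> u \<in> A"
        then have "u \<otimes> s \<in> A" using u as by (simp add: m_comm)
        then show False using r as idealD(3)[OF A(1)] by simp
      qed
      have "x \<otimes> (r \<otimes> w) \<in> A \<longleftrightarrow> x \<otimes> (s \<otimes> u) \<in> A" if x: "x \<in> carrier R" for x
      proof -
        have xa: "x \<otimes> a \<in> A" using idealD(4)[OF A(1) x as(1)] .
        have "x \<otimes> (r \<otimes> w) = x \<otimes> a \<oplus> x \<otimes> (s \<otimes> u)" unfolding as(3) using x as u ac by algebra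
        moreover have "x \<otimes> (s \<otimes> u) = x \<otimes> (r \<otimes> w) \<ominus> x \<otimes> a" unfolding as(3) using x as(2) u ac by algebra
        ultimately show ?thesis using idealD(3)[OF A(1) xa] idealD(7)[OF A(1) _ xa] by metis
      qed
      then have "annih_mod R A (r \<otimes> w) = annih_mod R A (s \<otimes> u)" unfolding annih_mod_def by blast
      then have "Q = annih_mod R A u"
        using annih_mod_multiple[OF w(1) Q(2)[unfolded Q(1)] r(1,3)] annih_mod_multiple[OF u(1) P as(2) su] Q(1)
        by simp
      then show ?thesis by blast
    next
      case False
      then have "Q = annih_mod R ?A' w" using A'(2) unfolding Q annih_mod_def by blast
      moreover have "w \<notin> ?A'" using False w by (auto dest!: bspec[of _ _ \<one>])
      ultimately show ?thesis using w Q(2) by blast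
    qed
  qed
  then have "infinite (?Ass ?A')" using A(2) by (meson finite_insert finite_subset)
  from max[OF A'(1) this A'(2)] A'(3) u show False by simp
qed

end

lemma (in cring) exists_mem_avoiding_prime:
  assumes "finite \<P>" "primeideal P R" "ideal M R" "\<not> M \<subseteq> P"
    and "\<And>Q. Q \<in> \<P> \<Longrightarrow> ideal Q R \<and> \<not> Q \<subseteq> P"
  shows "\<exists>w\<in>M. w \<notin> P \<and> (\<forall>Q\<in>\<P>. w \<in> Q)"
  using assms(1,5)
proof induction
  case empty then show ?case using assms(4) by blast
next
  case (insert Q \<P>)
  then obtain w where w: "w \<in> M" "w \<notin> P" "\<forall>Q\<in>\<P>. w \<in> Q" by blast
  from insert obtain q where q: "q \<in> Q" "q \<notin> P" by blast
  have c: "w \<in> carrier R" "q \<in> carrier R" using w q idealD(1)[of M] idealD(1)[of Q] assms insert by auto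
  have "w \<otimes> q \<notin> P" using primeideal.I_prime[OF assms(2) c] w q by blast
  moreover have "w \<otimes> q \<in> M" "w \<otimes> q \<in> Q" using c w q insert assms idealD(4,5) by auto
  moreover have "w \<otimes> q \<in> Q'" if "Q' \<in> \<P>" for Q' using that w insert.prems[of Q'] c idealD(5)[of Q'] by auto
  ultimately show ?case by blast
qed

text \<open>Discarding primes contained in others leaves an antichain \<open>\<P>\<close>. If \<open>z\<close> avoids every prime of
  \<open>\<P>\<close> except \<open>P\<close>, it is corrected by an element of \<open>M\<close> that lies in all the others but not in \<open>P\<close>.\<close>
lemma (in cring) prime_avoidance:
  assumes "finite \<P>" "\<And>P. P \<in> \<P> \<Longrightarrow> primeideal P R" "ideal M R" "\<And>P. P \<in> \<P> \<Longrightarrow> \<not> M \<subseteq> P"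
  shows "\<exists>z\<in>M. \<forall>P\<in>\<P>. z \<notin> P"
  using assms(1,2,4)
proof (induction rule: finite_psubset_induct)
  case (psubset \<P>)
  have id: "P \<in> \<P> \<Longrightarrow> ideal P R" for P using psubset.prems(1) by (simp add: primeideal_def)
  consider "\<P> = {}" | Q P where "Q \<in> \<P>" "P \<in> \<P>" "Q \<subset> P"
    | P where "P \<in> \<P>" "\<And>Q P. Q \<in> \<P> \<Longrightarrow> P \<in> \<P> \<Longrightarrow> \<not> Q \<subset> P" by blast
  then show ?case
  proof cases
    case 1 then show ?thesis using idealD(2)[OF assms(3)] by blast
  next
    case 2
    then have "\<P> - {Q} \<subset> \<P>" by blast
    from psubset.IH[OF this] psubset.prems obtain z where "z \<in> M" "\<forall>P\<in>\<P> - {Q}. z \<notin> P" by blast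
    with 2 show ?thesis by blast
  next
    case 3
    then have "\<P> - {P} \<subset> \<P>" by blast
    from psubset.IH[OF this] psubset.prems obtain z where z: "z \<in> M" "\<forall>Q\<in>\<P> - {P}. z \<notin> Q" by blast
    show ?thesis
    proof (cases "z \<in> P")
      case False with z show ?thesis by blast
    next
      case True
      have "\<exists>w\<in>M. w \<notin> P \<and> (\<forall>Q\<in>\<P> - {P}. w \<in> Q)"
        using psubset.hyps psubset.prems 3 assms(3) id by (intro exists_mem_avoiding_prime) auto
      then obtain w where w: "w \<in> M" "w \<notin> P" "\<forall>Q\<in>\<P> - {P}. w \<in> Q" by blast
      have c: "z \<in> carrier R" "w \<in> carrier R" using z w idealD(1)[OF assms(3)] by auto
      have e: "(z \<oplus> w) \<ominus> z = w" "(z \<oplus> w) \<ominus> w = z" using c by algebra+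
      have "z \<oplus> w \<notin> Q" if "Q \<in> \<P>" for Q
      proof
        assume q: "z \<oplus> w \<in> Q"
        show False
        proof (cases "Q = P")
          case True
          then show False using idealD(7)[OF id[OF that] q, of z] \<open>z \<in> P\<close> w e by simp
        next
          case False
          then show False using idealD(7)[OF id[OF that] q, of w] z w e that by simp
        qed
      qed
      then show ?thesis using idealD(3)[OF assms(3)] z w by blast
    qed
  qed
qed


section \<open>Noetherian local rings\<close>

locale noetherian_local_ring = noetherian_cring +
  fixes \<mm> :: "'a set"
  assumes local_ring: "local_ring R \<mm>"
begin

lemma ideal_mm: "ideal \<mm> R" and prime_mm: "primeideal \<mm> R" and one_notin_mm: "\<one> \<notin> \<mm>"
proof -
  have m: "maximalideal \<mm> R" using local_ring unfolding local_ring_def by blast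
  then show "ideal \<mm> R" by (simp add: maximalideal_def)
  show "primeideal \<mm> R" using maximalideal_prime[OF m] .
  show "\<one> \<notin> \<mm>" using ideal.one_imp_carrier[OF \<open>ideal \<mm> R\<close>] maximalideal.I_notcarr[OF m] by blast
qed

lemma proper_ideal_subset_mm:
  assumes "ideal A R" "\<one> \<notin> A" shows "A \<subseteq> \<mm>"
proof -
  obtain B where B: "ideal B R" "\<one> \<notin> B" "A \<subseteq> B"
    and max: "\<And>C. ideal C R \<Longrightarrow> \<one> \<notin> C \<Longrightarrow> A \<subseteq> C \<Longrightarrow> B \<subseteq> C \<Longrightarrow> C = B"
    using exists_maximal[of "\<lambda>B. ideal B R \<and> \<one> \<notin> B \<and> A \<subseteq> B" A] assms by (metis subset_refl)
  have "maximalideal B R"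
  proof (rule maximalidealI[OF B(1)])
    show "carrier R \<noteq> B" using B(2) one_closed by metis
    fix J assume J: "ideal J R" "B \<subseteq> J" "J \<subseteq> carrier R"
    then show "J = B \<or> J = carrier R" using max[OF J(1)] B ideal.one_imp_carrier[OF J(1)] by blast
  qed
  then have "B = \<mm>" using local_ring unfolding local_ring_def by blast
  with B show ?thesis by blast
qed

lemma invertible_outside_mm:
  assumes "x \<in> carrier R" "x \<notin> \<mm>" obtains y where "y \<in> carrier R" "y \<otimes> x = \<one>"
proof -
  have "ideal (PIdl x) R" "x \<in> PIdl x" using cgenideal_ideal cgenideal_self assms by auto
  then have "\<one> \<in> PIdl x" using proper_ideal_subset_mm[of "PIdl x"] assms by blast
  then show thesis using that unfolding cgenideal_def by auto
qed

text \<open>Nakayama's lemma. If \<open>N \<noteq> A\<close>, take an ideal \<open>B\<close> maximal with \<open>A \<subseteq> B \<subset> N\<close>. Then \<open>N/B\<close> is simple,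
  so that \<open>z\<close> annihilates it, and \<open>N = A + zN \<subseteq> B\<close>.\<close>
lemma nakayama:
  assumes A: "ideal A R" and N: "ideal N R" "A \<subseteq> N" and z: "z \<in> \<mm>"
    and NA: "N \<subseteq> add_multiples R A z N"
  shows "N \<subseteq> A"
proof (rule ccontr)
  assume "\<not> N \<subseteq> A"
  then have "A \<subset> N" using N by blast
  then obtain B where B: "ideal B R" "A \<subseteq> B" "B \<subset> N"
    and max: "\<And>C. ideal C R \<Longrightarrow> A \<subseteq> C \<Longrightarrow> C \<subset> N \<Longrightarrow> B \<subseteq> C \<Longrightarrow> C = B"
    using exists_maximal[of "\<lambda>B. ideal B R \<and> A \<subseteq> B \<and> B \<subset> N" A] A by (metis subset_refl)
  have zc: "z \<in> carrier R" using idealD(1)[OF ideal_mm z] .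
  have top: "C = N" if "ideal C R" "B \<subset> C" "C \<subseteq> N" for C using max[OF that(1)] that B by blast
  have "z \<otimes> n \<in> B" if n: "n \<in> N" for n
  proof (rule ccontr)
    assume zn: "z \<otimes> n \<notin> B"
    have nc: "n \<in> carrier R" using idealD(1)[OF N(1) n] .
    let ?C = "add_multiples R B (z \<otimes> n) (carrier R)"
    have C: "ideal ?C R" "B \<subseteq> ?C" "(z \<otimes> n) \<otimes> \<one> \<in> ?C"
      using add_multiples_ideal[OF B(1) oneideal, of "z \<otimes> n"] zc nc one_closed by blast+
    have "?C \<subseteq> N" unfolding add_multiples_def
      using idealD(3)[OF N(1)] idealD(4)[OF N(1)] idealD(5)[OF N(1)] B(3) n zc by auto
    moreover have "B \<subset> ?C" using C(2,3) zn zc nc by auto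
    ultimately have "?C = N" using top C by blast
    with n obtain b r where br: "b \<in> B" "r \<in> carrier R" "n = b \<oplus> (z \<otimes> n) \<otimes> r"
      unfolding add_multiples_def by blast
    have bc: "b \<in> carrier R" using idealD(1)[OF B(1) br(1)] .
    have "\<one> \<ominus> z \<otimes> r \<notin> \<mm>"
    proof
      assume "\<one> \<ominus> z \<otimes> r \<in> \<mm>"
      then have "(\<one> \<ominus> z \<otimes> r) \<oplus> z \<otimes> r \<in> \<mm>" using idealD(3,5)[OF ideal_mm] z br by blast
      moreover have "(\<one> \<ominus> z \<otimes> r) \<oplus> z \<otimes> r = \<one>" using zc br by algebra
      ultimately show False using one_notin_mm by simp
    qed
    then obtain y where y: "y \<in> carrier R" "y \<otimes> (\<one> \<ominus> z \<otimes> r) = \<one>"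
      using invertible_outside_mm[of "\<one> \<ominus> z \<otimes> r"] zc br by auto
    have "b = n \<ominus> (z \<otimes> n) \<otimes> r"
      using arg_cong[OF br(3), of "\<lambda>u. u \<ominus> (z \<otimes> n) \<otimes> r"] bc zc nc br by algebra
    then have "b = (\<one> \<ominus> z \<otimes> r) \<otimes> n" using bc zc nc br(2) by algebra
    then have "y \<otimes> b = (y \<otimes> (\<one> \<ominus> z \<otimes> r)) \<otimes> n" using bc zc nc br(2) y(1) by algebra
    then have "y \<otimes> b = n" using y nc by simp
    then have "n \<in> B" using idealD(4)[OF B(1) y(1) br(1)] by simp
    then show False using zn idealD(4)[OF B(1) zc] by simp
  qed
  then have "add_multiples R A z N \<subseteq> B" unfolding add_multiples_def using B(2) idealD(3)[OF B(1)] by blast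
  with NA B show False by blast
qed

text \<open>The hypothesis says that \<open>\<mm>\<close> is not associated to \<open>M/A\<close>, so by prime avoidance it is not
  covered by the finitely many associated primes, which contain all zerodivisors.\<close>
lemma exists_regular_element:
  assumes A: "ideal A R" and M: "ideal M R"
    and soc: "\<And>u. u \<in> M \<Longrightarrow> (\<And>x. x \<in> \<mm> \<Longrightarrow> x \<otimes> u \<in> A) \<Longrightarrow> u \<in> A"
  obtains z where "z \<in> \<mm>" "\<And>v. v \<in> M \<Longrightarrow> z \<otimes> v \<in> A \<Longrightarrow> v \<in> A"
proof -
  define \<P> where "\<P> = {annih_mod R A w | w. w \<in> M \<and> w \<notin> A \<and> primeideal (annih_mod R A w) R}"
  have "\<P> \<subseteq> {annih_mod R A w | w. w \<in> carrier R \<and> w \<notin> A \<and> primeideal (annih_mod R A w) R}"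
    unfolding \<P>_def using idealD(1)[OF M] by blast
  then have "finite \<P>" using finite_associated_primes[OF A] by (rule finite_subset)
  moreover have "\<And>P. P \<in> \<P> \<Longrightarrow> primeideal P R" unfolding \<P>_def by auto
  moreover have "\<And>P. P \<in> \<P> \<Longrightarrow> \<not> \<mm> \<subseteq> P" unfolding \<P>_def annih_mod_def using soc by blast
  ultimately obtain z where z: "z \<in> \<mm>" "\<forall>P\<in>\<P>. z \<notin> P"
    using prime_avoidance[OF _ _ ideal_mm] by blast
  have "v \<in> A" if v: "v \<in> M" "z \<otimes> v \<in> A" for v
  proof (rule ccontr)
    assume "v \<notin> A"
    from exists_associated_prime[OF A M v(1) this] obtain u where
      u: "u \<in> M" "u \<notin> A" "primeideal (annih_mod R A u) R" "annih_mod R A v \<subseteq> annih_mod R A u" .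
    have "z \<in> annih_mod R A v" using v z idealD(1)[OF ideal_mm] by (simp add: annih_mod_def)
    with u z show False unfolding \<P>_def by blast
  qed
  with z that show thesis by blast
qed

end

text \<open>Since \<open>x\<close> is regular modulo \<open>A\<close>, no product \<open>s x\<^sup>n\<close> with \<open>s \<notin> P\<close> lies in \<open>A\<close>; a prime that
  avoids them all is contained in \<open>P\<close> and misses \<open>x\<close>.\<close>
lemma (in noetherian_cring) exists_smaller_prime:
  assumes A: "ideal A R" and P: "primeideal P R" "A \<subseteq> P" and x: "x \<in> P"
    and reg: "\<And>r. r \<in> carrier R \<Longrightarrow> x \<otimes> r \<in> A \<Longrightarrow> r \<in> A"
  obtains P' where "primeideal P' R" "A \<subseteq> P'" "P' \<subset> P"
proof -
  have idP: "ideal P R" using P by (simp add: primeideal_def)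
  have xc: "x \<in> carrier R" using idealD(1)[OF idP x] .
  define S where "S = {s \<otimes> x [^] n | s (n::nat). s \<in> carrier R \<and> s \<notin> P}"
  have oneP: "\<one> \<notin> P" using ideal.one_imp_carrier[OF idP] primeideal.I_notcarr[OF P(1)] by blast
  have pow: "s \<in> carrier R \<Longrightarrow> s \<otimes> x [^] n \<in> A \<Longrightarrow> s \<in> A" for s and n :: nat
  proof (induction n arbitrary: s)
    case (Suc n)
    have "s \<otimes> x [^] Suc n = x \<otimes> (s \<otimes> x [^] n)"
      using Suc.prems(1) xc by (simp add: m_ac)
    then have "s \<otimes> x [^] n \<in> A" using Suc.prems reg[of "s \<otimes> x [^] n"] xc by simp
    then show ?case using Suc by blast
  qed simp
  obtain P' where P': "primeideal P' R" "A \<subseteq> P'" "P' \<inter> S = {}"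
  proof (rule exists_prime_avoiding[OF A])
    show "S \<subseteq> carrier R" unfolding S_def using xc by auto
    have "\<one> = \<one> \<otimes> x [^] (0::nat)" by simp
    then show "\<one> \<in> S" unfolding S_def using oneP by blast
    show "a \<otimes> b \<in> S" if "a \<in> S" "b \<in> S" for a b
    proof -
      from that obtain s t and n k :: nat where *: "a = s \<otimes> x [^] n" "b = t \<otimes> x [^] k"
        "s \<in> carrier R" "s \<notin> P" "t \<in> carrier R" "t \<notin> P" unfolding S_def by blast
      have "a \<otimes> b = (s \<otimes> t) \<otimes> (x [^] n \<otimes> x [^] k)" unfolding * using *(3,5) xc by (simp add: m_ac)
      then have "a \<otimes> b = (s \<otimes> t) \<otimes> x [^] (n + k)" using xc by (simp add: nat_pow_mult)
      moreover have "s \<otimes> t \<notin> P" using primeideal.I_prime[OF P(1) *(3,5)] * by blast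
      ultimately show ?thesis unfolding S_def using * by blast
    qed
    show "A \<inter> S = {}" unfolding S_def using pow P(2) by blast
  qed
  have "P' \<subseteq> P"
  proof
    fix s assume s: "s \<in> P'"
    have "ideal P' R" using P' by (simp add: primeideal_def)
    then have sc: "s \<in> carrier R" using idealD(1) s by blast
    show "s \<in> P"
    proof (rule ccontr)
      assume "s \<notin> P"
      moreover have "s = s \<otimes> x [^] (0::nat)" using sc by simp
      ultimately have "s \<in> S" unfolding S_def using sc by blast
      with s P' show False by blast
    qed
  qed
  moreover have "x \<notin> P'"
  proof -
    have "x = \<one> \<otimes> x [^] (1::nat)" using xc by simp
    then have "x \<in> S" unfolding S_def using oneP by blast
    with P' show ?thesis by blast
  qed
  ultimately show thesis using that P' x by blast
qed


section \<open>Free modules and resolutions\<close>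

text \<open>This covers both \<open>R\<^bsup>n\<^esup>\<close> and \<open>Hom(M, N)\<close>.\<close>
lemma pointwise_module:
  assumes N: "module R N" and C: "carrier P \<subseteq> D \<rightarrow>\<^sub>E carrier N"
    and ops: "\<zero>\<^bsub>P\<^esub> = (\<lambda>i\<in>D. \<zero>\<^bsub>N\<^esub>)" "\<And>f g. f \<oplus>\<^bsub>P\<^esub> g = (\<lambda>i\<in>D. f i \<oplus>\<^bsub>N\<^esub> g i)"
      "\<And>r f. r \<odot>\<^bsub>P\<^esub> f = (\<lambda>i\<in>D. r \<odot>\<^bsub>N\<^esub> f i)"
    and zero: "\<zero>\<^bsub>P\<^esub> \<in> carrier P"
    and add: "\<And>f g. f \<in> carrier P \<Longrightarrow> g \<in> carrier P \<Longrightarrow> f \<oplus>\<^bsub>P\<^esub> g \<in> carrier P"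
    and smult: "\<And>r f. r \<in> carrier R \<Longrightarrow> f \<in> carrier P \<Longrightarrow> r \<odot>\<^bsub>P\<^esub> f \<in> carrier P"
  shows "module R P"
proof -
  interpret N: module R N by fact
  have v: "f i \<in> carrier N" if "f \<in> carrier P" "i \<in> D" for f i using that C by auto
  have e: "f = g" if "f \<in> carrier P" "g \<in> carrier P" "\<And>i. i \<in> D \<Longrightarrow> f i = g i" for f g
    using that C by (intro PiE_ext[of f D "\<lambda>_. carrier N"]) auto
  have "abelian_group P"
  proof (rule abelian_groupI)
    fix f g h assume f: "f \<in> carrier P" and g: "g \<in> carrier P" and h: "h \<in> carrier P"
    show "f \<oplus>\<^bsub>P\<^esub> g \<oplus>\<^bsub>P\<^esub> h = f \<oplus>\<^bsub>P\<^esub> (g \<oplus>\<^bsub>P\<^esub> h)"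
      using v[OF f] v[OF g] v[OF h] by (intro e add f g h) (simp add: ops N.a_assoc)
    show "f \<oplus>\<^bsub>P\<^esub> g = g \<oplus>\<^bsub>P\<^esub> f"
      using v[OF f] v[OF g] by (intro e add f g) (simp add: ops N.a_comm)
  next
    fix f assume f: "f \<in> carrier P"
    show "\<zero>\<^bsub>P\<^esub> \<oplus>\<^bsub>P\<^esub> f = f"
      using v[OF f] by (intro e add f zero) (simp add: ops)
    have s: "(\<ominus>\<^bsub>R\<^esub> \<one>\<^bsub>R\<^esub>) \<odot>\<^bsub>P\<^esub> f \<in> carrier P" using f by (intro smult) simp_all
    have "(\<ominus>\<^bsub>R\<^esub> \<one>\<^bsub>R\<^esub>) \<odot>\<^bsub>P\<^esub> f \<oplus>\<^bsub>P\<^esub> f = \<zero>\<^bsub>P\<^esub>"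
      using v[OF f] by (intro e add zero s f) (simp add: ops N.smult_l_minus N.l_neg)
    with s show "\<exists>g\<in>carrier P. g \<oplus>\<^bsub>P\<^esub> f = \<zero>\<^bsub>P\<^esub>" by blast
  qed (assumption | intro add zero)+
  then show ?thesis
  proof (intro moduleI N.is_cring)
    fix a b f assume *: "a \<in> carrier R" "b \<in> carrier R" and f: "f \<in> carrier P"
    show "(a \<oplus>\<^bsub>R\<^esub> b) \<odot>\<^bsub>P\<^esub> f = a \<odot>\<^bsub>P\<^esub> f \<oplus>\<^bsub>P\<^esub> b \<odot>\<^bsub>P\<^esub> f"
      using * v[OF f] by (intro e add smult f N.R.a_closed) (simp_all add: ops N.smult_l_distr)
    show "(a \<otimes>\<^bsub>R\<^esub> b) \<odot>\<^bsub>P\<^esub> f = a \<odot>\<^bsub>P\<^esub> (b \<odot>\<^bsub>P\<^esub> f)"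
      using * v[OF f] by (intro e add smult f N.R.m_closed) (simp_all add: ops N.smult_assoc1)
  next
    fix a f g assume *: "a \<in> carrier R" and f: "f \<in> carrier P" and g: "g \<in> carrier P"
    show "a \<odot>\<^bsub>P\<^esub> (f \<oplus>\<^bsub>P\<^esub> g) = a \<odot>\<^bsub>P\<^esub> f \<oplus>\<^bsub>P\<^esub> a \<odot>\<^bsub>P\<^esub> g"
      using * v[OF f] v[OF g] by (intro e add smult f g) (simp_all add: ops N.smult_r_distr)
  next
    fix f assume f: "f \<in> carrier P"
    show "\<one>\<^bsub>R\<^esub> \<odot>\<^bsub>P\<^esub> f = f"
      using v[OF f] by (intro e smult f N.R.one_closed) (simp_all add: ops)
  qed (assumption | rule smult)+
qed

lemma module_hom_restrictI:
  assumes "module R M" "\<And>v. v \<in> carrier M \<Longrightarrow> f v \<in> carrier N"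
    and "\<And>u v. u \<in> carrier M \<Longrightarrow> v \<in> carrier M \<Longrightarrow> f (u \<oplus>\<^bsub>M\<^esub> v) = f u \<oplus>\<^bsub>N\<^esub> f v"
    and "\<And>r v. r \<in> carrier R \<Longrightarrow> v \<in> carrier M \<Longrightarrow> f (r \<odot>\<^bsub>M\<^esub> v) = r \<odot>\<^bsub>N\<^esub> f v"
  shows "(\<lambda>v\<in>carrier M. f v) \<in> module_hom R M N"
proof -
  interpret M: module R M by fact
  show ?thesis unfolding module_hom_def using assms(2-4) by simp
qed

lemma module_hom_ext:
  assumes "f \<in> module_hom R M N" "g \<in> module_hom R M N" "\<And>v. v \<in> carrier M \<Longrightarrow> f v = g v"
  shows "f = g"
  using assms unfolding module_hom_def by (intro PiE_ext[of f "carrier M" "\<lambda>_. carrier N"]) auto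

lemma module_hom_compose:
  assumes "module R L" "s \<in> module_hom R L M" "f \<in> module_hom R M N"
  shows "(\<lambda>v\<in>carrier L. f (s v)) \<in> module_hom R L N"
  using module_homD[OF assms(2)] module_homD[OF assms(3)]
  by (intro module_hom_restrictI[OF assms(1)]) simp_all

lemma hom_module_simps:
  "carrier (hom_module R M N) = module_hom R M N"
  "\<zero>\<^bsub>hom_module R M N\<^esub> = (\<lambda>x\<in>carrier M. \<zero>\<^bsub>N\<^esub>)"
  "f \<oplus>\<^bsub>hom_module R M N\<^esub> g = (\<lambda>x\<in>carrier M. f x \<oplus>\<^bsub>N\<^esub> g x)"
  "r \<odot>\<^bsub>hom_module R M N\<^esub> f = (\<lambda>x\<in>carrier M. r \<odot>\<^bsub>N\<^esub> f x)"
  by (simp_all add: hom_module_def)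

lemma module_hom_module:
  assumes "module R M" "module R N"
  shows "module R (hom_module R M N)"
proof (rule pointwise_module[OF assms(2), of _ "carrier M"])
  interpret M: module R M by fact
  interpret N: module R N by fact
  let ?H = "hom_module R M N"
  show "carrier ?H \<subseteq> carrier M \<rightarrow>\<^sub>E carrier N" by (auto simp: hom_module_simps module_hom_def)
  show "\<zero>\<^bsub>?H\<^esub> \<in> carrier ?H"
    unfolding hom_module_simps by (intro module_hom_restrictI[OF assms(1)]) simp_all
  show "f \<oplus>\<^bsub>?H\<^esub> g \<in> carrier ?H" if "f \<in> carrier ?H" "g \<in> carrier ?H" for f g
    using module_homD[OF that(1)[unfolded hom_module_simps]] module_homD[OF that(2)[unfolded hom_module_simps]]
    unfolding hom_module_simps by (intro module_hom_restrictI[OF assms(1)]) (simp_all add: N.a_ac N.smult_r_distr)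
  show "r \<odot>\<^bsub>?H\<^esub> f \<in> carrier ?H" if "r \<in> carrier R" "f \<in> carrier ?H" for r f
    using module_homD[OF that(2)[unfolded hom_module_simps]] that(1)
    unfolding hom_module_simps
    by (intro module_hom_restrictI[OF assms(1)])
      (simp_all add: N.smult_r_distr N.smult_assoc1[symmetric] M.R.m_comm)
qed (simp_all add: hom_module_simps)

lemma free_module_simps:
  "carrier (free_module R n) = {..<n} \<rightarrow>\<^sub>E carrier R"
  "\<zero>\<^bsub>free_module R n\<^esub> = (\<lambda>i\<in>{..<n}. \<zero>\<^bsub>R\<^esub>)"
  "u \<oplus>\<^bsub>free_module R n\<^esub> v = (\<lambda>i\<in>{..<n}. u i \<oplus>\<^bsub>R\<^esub> v i)"
  "r \<odot>\<^bsub>free_module R n\<^esub> v = (\<lambda>i\<in>{..<n}. r \<otimes>\<^bsub>R\<^esub> v i)"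
  by (simp_all add: free_module_def)

lemma free_module_coord: "v \<in> carrier (free_module R n) \<Longrightarrow> i < n \<Longrightarrow> v i \<in> carrier R"
  by (auto simp: free_module_simps)

lemma free_module_ext:
  assumes "u \<in> carrier (free_module R n)" "v \<in> carrier (free_module R n)" "\<And>i. i < n \<Longrightarrow> u i = v i"
  shows "u = v"
  using assms unfolding free_module_simps by (intro PiE_ext) auto

definition unit_vector :: "('a, 'r) ring_scheme \<Rightarrow> nat \<Rightarrow> nat \<Rightarrow> nat \<Rightarrow> 'a" where
  "unit_vector R n j = (\<lambda>i\<in>{..<n}. if i = j then \<one>\<^bsub>R\<^esub> else \<zero>\<^bsub>R\<^esub>)"

context cring
begin

lemma module_free_module: "module R (free_module R n)"
proof (rule pointwise_module[OF module_self_module, of _ "{..<n}"])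
  note c = free_module_coord[of _ R n]
  show "f \<oplus>\<^bsub>free_module R n\<^esub> g \<in> carrier (free_module R n)"
    if "f \<in> carrier (free_module R n)" "g \<in> carrier (free_module R n)" for f g
    using c[OF that(1)] c[OF that(2)] by (simp add: free_module_simps)
  show "r \<odot>\<^bsub>free_module R n\<^esub> f \<in> carrier (free_module R n)"
    if "r \<in> carrier R" "f \<in> carrier (free_module R n)" for r f
    using c[OF that(2)] that(1) by (simp add: free_module_simps)
qed (simp_all add: free_module_simps self_module_def)

lemma unit_vector_carrier: "unit_vector R n j \<in> carrier (free_module R n)"
  by (auto simp: unit_vector_def free_module_simps)

lemma free_module_induct:
  assumes v: "v \<in> carrier (free_module R n)"
    and zero: "P \<zero>\<^bsub>free_module R n\<^esub>"
    and unit: "\<And>j. j < n \<Longrightarrow> P (unit_vector R n j)"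
    and add: "\<And>u v. u \<in> carrier (free_module R n) \<Longrightarrow> v \<in> carrier (free_module R n) \<Longrightarrow> P u \<Longrightarrow> P v \<Longrightarrow>
      P (u \<oplus>\<^bsub>free_module R n\<^esub> v)"
    and smult: "\<And>r v. r \<in> carrier R \<Longrightarrow> v \<in> carrier (free_module R n) \<Longrightarrow> P v \<Longrightarrow> P (r \<odot>\<^bsub>free_module R n\<^esub> v)"
  shows "P v"
proof -
  interpret F: module R "free_module R n" by (rule module_free_module)
  define t where "t k = (\<lambda>i\<in>{..<n}. if i < k then v i else \<zero>)" for k
  have vc: "i < n \<Longrightarrow> v i \<in> carrier R" for i using v by (auto simp: free_module_simps)
  have tc: "t k \<in> carrier (free_module R n)" for k using vc by (auto simp: t_def free_module_simps)
  have "k \<le> n \<Longrightarrow> P (t k)" for k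
  proof (induction k)
    case 0
    have "t 0 = \<zero>\<^bsub>free_module R n\<^esub>" by (simp add: t_def free_module_simps)
    with zero show ?case by simp
  next
    case (Suc k)
    have "t (Suc k) = t k \<oplus>\<^bsub>free_module R n\<^esub> (v k \<odot>\<^bsub>free_module R n\<^esub> unit_vector R n k)"
      using vc Suc.prems by (auto simp: t_def free_module_simps unit_vector_def less_Suc_eq intro!: restrict_ext)
    moreover have "P (v k \<odot>\<^bsub>free_module R n\<^esub> unit_vector R n k)"
      using Suc.prems by (intro smult unit unit_vector_carrier vc) auto
    ultimately show ?case
      using Suc add[OF tc F.smult_closed[OF vc unit_vector_carrier]] by simp
  qed
  then have "P (t n)" by simp
  moreover have "t n = v"
    using tc v by (rule free_module_ext) (simp add: t_def)
  ultimately show ?thesis by simp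
qed

lemma free_module_hom_exists:
  assumes "module R M" and w: "\<And>j. j < n \<Longrightarrow> w j \<in> carrier M"
  obtains h where "h \<in> module_hom R (free_module R n) M" "\<And>j. j < n \<Longrightarrow> h (unit_vector R n j) = w j"
proof -
  interpret M: module R M by fact
  define h where "h = (\<lambda>v\<in>carrier (free_module R n). \<Oplus>\<^bsub>M\<^esub>j\<in>{..<n}. v j \<odot>\<^bsub>M\<^esub> w j)"
  have vc: "v j \<in> carrier R" if "v \<in> carrier (free_module R n)" "j < n" for v j
    using that by (auto simp: free_module_simps)
  have "h \<in> module_hom R (free_module R n) M"
    unfolding module_hom_def
  proof (intro CollectI conjI ballI)
    show "h \<in> carrier (free_module R n) \<rightarrow>\<^sub>E carrier M"
      unfolding h_def using vc w by (auto intro!: M.finsum_closed)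
  next
    fix u v assume uv: "u \<in> carrier (free_module R n)" "v \<in> carrier (free_module R n)"
    have "u \<oplus>\<^bsub>free_module R n\<^esub> v \<in> carrier (free_module R n)"
      using uv module.axioms(2)[OF module_free_module, of n] by (simp add: abelian_group_def abelian_monoid.a_closed)
    then have "h (u \<oplus>\<^bsub>free_module R n\<^esub> v) = (\<Oplus>\<^bsub>M\<^esub>j\<in>{..<n}. (u \<oplus>\<^bsub>free_module R n\<^esub> v) j \<odot>\<^bsub>M\<^esub> w j)"
      by (simp add: h_def)
    also have "\<dots> = (\<Oplus>\<^bsub>M\<^esub>j\<in>{..<n}. u j \<odot>\<^bsub>M\<^esub> w j \<oplus>\<^bsub>M\<^esub> v j \<odot>\<^bsub>M\<^esub> w j)"
      using vc w uv by (intro M.finsum_cong') (auto simp: free_module_simps(3) M.smult_l_distr)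
    also have "\<dots> = h u \<oplus>\<^bsub>M\<^esub> h v"
      using uv vc w by (simp add: h_def M.finsum_addf Pi_def)
    finally show "h (u \<oplus>\<^bsub>free_module R n\<^esub> v) = h u \<oplus>\<^bsub>M\<^esub> h v" .
  next
    fix r v assume rv: "r \<in> carrier R" "v \<in> carrier (free_module R n)"
    have "r \<odot>\<^bsub>free_module R n\<^esub> v \<in> carrier (free_module R n)"
      using rv by (rule module.smult_closed[OF module_free_module])
    then have "h (r \<odot>\<^bsub>free_module R n\<^esub> v) = (\<Oplus>\<^bsub>M\<^esub>j\<in>{..<n}. (r \<odot>\<^bsub>free_module R n\<^esub> v) j \<odot>\<^bsub>M\<^esub> w j)"
      by (simp add: h_def)
    also have "\<dots> = (\<Oplus>\<^bsub>M\<^esub>j\<in>{..<n}. r \<odot>\<^bsub>M\<^esub> (v j \<odot>\<^bsub>M\<^esub> w j))"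
      using vc w rv by (intro M.finsum_cong') (auto simp: free_module_simps(4) M.smult_assoc1)
    also have "\<dots> = r \<odot>\<^bsub>M\<^esub> h v"
      using rv vc w by (simp add: h_def M.finsum_smult_ldistr Pi_def)
    finally show "h (r \<odot>\<^bsub>free_module R n\<^esub> v) = r \<odot>\<^bsub>M\<^esub> h v" .
  qed
  moreover have "h (unit_vector R n j) = w j" if "j < n" for j
  proof -
    have "h (unit_vector R n j) = (\<Oplus>\<^bsub>M\<^esub>i\<in>{..<n}. unit_vector R n j i \<odot>\<^bsub>M\<^esub> w i)"
      using unit_vector_carrier by (simp add: h_def)
    also have "\<dots> = (\<Oplus>\<^bsub>M\<^esub>i\<in>{..<n}. if j = i then w i else \<zero>\<^bsub>M\<^esub>)"
      using w by (intro M.finsum_cong') (auto simp: unit_vector_def)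
    also have "\<dots> = w j" using that w by (intro M.add.finprod_singleton) auto
    finally show ?thesis .
  qed
  ultimately show thesis using that by blast
qed

lemma free_module_hom_eq:
  assumes N: "module R N" and f: "f \<in> module_hom R (free_module R n) N" and g: "g \<in> module_hom R (free_module R n) N"
    and unit: "\<And>j. j < n \<Longrightarrow> f (unit_vector R n j) = g (unit_vector R n j)"
    and v: "v \<in> carrier (free_module R n)"
  shows "f v = g v"
  using v
  by (rule free_module_induct)
    (simp_all add: module_hom_zero[OF module_free_module N] f g module_homD[OF f] module_homD[OF g] unit)

lemma free_module_lift:
  assumes L: "module R L" and N: "module R N" and \<phi>: "\<phi> \<in> module_hom R (free_module R n) N"
    and \<psi>: "\<psi> \<in> module_hom R L N"
    and img: "\<And>j. \<phi> (unit_vector R n j) \<in> \<psi> ` carrier L"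
  obtains s where "s \<in> module_hom R (free_module R n) L"
    "\<And>v. v \<in> carrier (free_module R n) \<Longrightarrow> \<psi> (s v) = \<phi> v"
proof -
  have "\<exists>w. w \<in> carrier L \<and> \<psi> w = \<phi> (unit_vector R n j)" for j using img[of j] by auto
  then obtain w where w: "\<And>j. w j \<in> carrier L" "\<And>j. \<psi> (w j) = \<phi> (unit_vector R n j)" by metis
  obtain s where s: "s \<in> module_hom R (free_module R n) L" "\<And>j. j < n \<Longrightarrow> s (unit_vector R n j) = w j"
    using free_module_hom_exists[OF L, of n w] w(1) by blast
  have "(\<lambda>v\<in>carrier (free_module R n). \<psi> (s v)) v = \<phi> v" if "v \<in> carrier (free_module R n)" for v
    using module_hom_compose[OF module_free_module s(1) \<psi>] \<phi> _ that
    by (rule free_module_hom_eq[OF N]) (simp add: s(2) w(2) unit_vector_carrier)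
  with s(1) show thesis by (intro that[of s]) simp_all
qed

end

text \<open>Induction on the number \<open>k\<close> of coordinates that are allowed to be nonzero. The last of these
  coordinates form an ideal; lifts of its generators, together with generators of the part where
  that coordinate vanishes, generate.\<close>
lemma (in noetherian_cring) free_submodule_finitely_generated:
  assumes "submodule N R (free_module R n)"
  obtains W where "finite W" "W \<subseteq> N"
    "\<And>N'. submodule N' R (free_module R n) \<Longrightarrow> W \<subseteq> N' \<Longrightarrow> N \<subseteq> N'"
proof -
  interpret F: module R "free_module R n" by (rule module_free_module)
  let ?fg = "\<lambda>N. \<exists>W. finite W \<and> W \<subseteq> N \<and> (\<forall>N'. submodule N' R (free_module R n) \<longrightarrow> W \<subseteq> N' \<longrightarrow> N \<subseteq> N')"
  have "k \<le> n \<Longrightarrow> submodule N R (free_module R n) \<Longrightarrow> \<forall>v\<in>N. \<forall>i<n. k \<le> i \<longrightarrow> v i = \<zero> \<Longrightarrow> ?fg N" for k N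
  proof (induction k arbitrary: N)
    case (0 N)
    have "v = \<zero>\<^bsub>free_module R n\<^esub>" if "v \<in> N" for v
    proof (rule free_module_ext)
      show "v \<in> carrier (free_module R n)" using that F.submoduleE(1)[OF 0(2)] by blast
      show "v i = \<zero>\<^bsub>free_module R n\<^esub> i" if "i < n" for i
        using that \<open>v \<in> N\<close> 0(3) by (simp add: free_module_simps)
    qed simp
    then have "N \<subseteq> N'" if "submodule N' R (free_module R n)" for N'
      using that F.submodule_iff[of N'] by auto
    then show ?case by (intro exI[of _ "{}"]) simp
  next
    case (Suc k N)
    have k: "k < n" using Suc.prems(1) by simp
    have N: "N \<subseteq> carrier (free_module R n)" "\<zero>\<^bsub>free_module R n\<^esub> \<in> N"
      "\<And>x y. x \<in> N \<Longrightarrow> y \<in> N \<Longrightarrow> x \<oplus>\<^bsub>free_module R n\<^esub> y \<in> N"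
      "\<And>r x. r \<in> carrier R \<Longrightarrow> x \<in> N \<Longrightarrow> r \<odot>\<^bsub>free_module R n\<^esub> x \<in> N"
      using Suc.prems(2) unfolding F.submodule_iff by simp_all
    have last: "ideal ((\<lambda>v. v k) ` N') R" if "submodule N' R (free_module R n)" for N'
    proof -
      have N': "N' \<subseteq> carrier (free_module R n)" "\<zero>\<^bsub>free_module R n\<^esub> \<in> N'"
        "\<And>x y. x \<in> N' \<Longrightarrow> y \<in> N' \<Longrightarrow> x \<oplus>\<^bsub>free_module R n\<^esub> y \<in> N'"
        "\<And>r x. r \<in> carrier R \<Longrightarrow> x \<in> N' \<Longrightarrow> r \<odot>\<^bsub>free_module R n\<^esub> x \<in> N'"
        using that unfolding F.submodule_iff by simp_all
      show ?thesis unfolding ideal_iff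
      proof (intro conjI ballI; clarify?)
        show "v k \<in> carrier R" if "v \<in> N'" for v
          using that N'(1) k by (auto simp: free_module_simps)
        show "\<zero> \<in> (\<lambda>v. v k) ` N'" by (rule image_eqI[OF _ N'(2)]) (simp add: free_module_simps k)
        show "x k \<oplus> y k \<in> (\<lambda>v. v k) ` N'" if "x \<in> N'" "y \<in> N'" for x y
          by (rule image_eqI[OF _ N'(3)[OF that]]) (simp add: free_module_simps k)
        show "r \<otimes> x k \<in> (\<lambda>v. v k) ` N'" if "r \<in> carrier R" "x \<in> N'" for r x
          by (rule image_eqI[OF _ N'(4)[OF that]]) (simp add: free_module_simps k)
      qed
    qed
    obtain S where S: "finite S" "S \<subseteq> carrier R" "(\<lambda>v. v k) ` N = Idl S"
      using finetely_gen[OF last[OF Suc.prems(2)]] by blast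
    then have "S \<subseteq> (\<lambda>v. v k) ` N" using genideal_self by simp
    then obtain W1 where W1: "W1 \<subseteq> N" "finite W1" "S = (\<lambda>v. v k) ` W1"
      using finite_subset_image[OF S(1)] by metis
    let ?N0 = "{v \<in> N. v k = \<zero>}"
    have N0: "submodule ?N0 R (free_module R n)"
      unfolding F.submodule_iff using N by (auto simp: free_module_simps k)
    have "?fg ?N0"
    proof (rule Suc.IH[OF _ N0])
      show "k \<le> n" using k by simp
      show "\<forall>v\<in>?N0. \<forall>i<n. k \<le> i \<longrightarrow> v i = \<zero>"
      proof (intro ballI allI impI)
        fix v i assume "v \<in> ?N0" "i < n" "k \<le> i"
        then show "v i = \<zero>" using Suc.prems(3) by (cases "i = k") auto
      qed
    qed
    then obtain W0 where W0: "finite W0" "W0 \<subseteq> ?N0"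
      "\<And>N'. submodule N' R (free_module R n) \<Longrightarrow> W0 \<subseteq> N' \<Longrightarrow> ?N0 \<subseteq> N'" by blast
    show ?case
    proof (intro exI conjI allI impI)
      show "finite (W0 \<union> W1)" "W0 \<union> W1 \<subseteq> N" using W0 W1 by auto
      fix N' assume N': "submodule N' R (free_module R n)" "W0 \<union> W1 \<subseteq> N'"
      have N'': "N' \<subseteq> carrier (free_module R n)" "\<zero>\<^bsub>free_module R n\<^esub> \<in> N'"
        "\<And>x y. x \<in> N' \<Longrightarrow> y \<in> N' \<Longrightarrow> x \<oplus>\<^bsub>free_module R n\<^esub> y \<in> N'"
        "\<And>r x. r \<in> carrier R \<Longrightarrow> x \<in> N' \<Longrightarrow> r \<odot>\<^bsub>free_module R n\<^esub> x \<in> N'"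
        using N'(1) unfolding F.submodule_iff by simp_all
      have sub: "submodule (N \<inter> N') R (free_module R n)"
        unfolding F.submodule_iff using N N'' by auto
      have "Idl S \<subseteq> (\<lambda>v. v k) ` (N \<inter> N')"
        using W1 N'(2) by (intro genideal_minimal[OF last[OF sub]]) auto
      then have ex: "\<exists>w\<in>N \<inter> N'. w k = v k" if "v \<in> N" for v using that S(3) by (metis (no_types, lifting) image_iff subsetD)
      show "N \<subseteq> N'"
      proof
        fix v assume v: "v \<in> N"
        then obtain w where w: "w \<in> N" "w \<in> N'" "w k = v k" using ex by blast
        have c: "v \<in> carrier (free_module R n)" "w \<in> carrier (free_module R n)" using v w N(1) by auto
        then have ck: "v k \<in> carrier R" using k by (auto simp: free_module_simps)
        let ?d = "v \<oplus>\<^bsub>free_module R n\<^esub> ((\<ominus> \<one>) \<odot>\<^bsub>free_module R n\<^esub> w)"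
        have "?d \<in> N" using v w N(3,4) by simp
        moreover have "?d k = \<zero>" using ck w(3) k by (simp add: free_module_simps l_minus r_neg)
        ultimately have "?d \<in> N'" using W0(3)[OF N'(1)] N'(2) by blast
        then have "?d \<oplus>\<^bsub>free_module R n\<^esub> w \<in> N'" using w N''(3) by blast
        moreover have "?d \<oplus>\<^bsub>free_module R n\<^esub> w = v" using c
          by (simp add: F.smult_l_minus F.a_assoc F.l_neg)
        ultimately show "v \<in> N'" by simp
      qed
    qed
  qed
  from this[of n N] assms have "?fg N" by simp
  then show thesis using that by blast
qed

lemma (in noetherian_cring) submodule_is_image_of_free:
  assumes "submodule N R (free_module R n)"
  obtains k h where "h \<in> module_hom R (free_module R k) (free_module R n)"
    "h ` carrier (free_module R k) = N"
proof -
  interpret F: module R "free_module R n" by (rule module_free_module)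
  obtain W where W: "finite W" "W \<subseteq> N"
    "\<And>N'. submodule N' R (free_module R n) \<Longrightarrow> W \<subseteq> N' \<Longrightarrow> N \<subseteq> N'"
    using free_submodule_finitely_generated[OF assms] by blast
  obtain k w where w: "W = w ` {i::nat. i < k}"
    using finite_imp_nat_seg_image_inj_on[OF W(1)] by blast
  have wc: "w j \<in> N" if "j < k" for j using that w W(2) by auto
  have N: "N \<subseteq> carrier (free_module R n)" "\<zero>\<^bsub>free_module R n\<^esub> \<in> N"
    "\<And>x y. x \<in> N \<Longrightarrow> y \<in> N \<Longrightarrow> x \<oplus>\<^bsub>free_module R n\<^esub> y \<in> N"
    "\<And>r x. r \<in> carrier R \<Longrightarrow> x \<in> N \<Longrightarrow> r \<odot>\<^bsub>free_module R n\<^esub> x \<in> N"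
    using assms unfolding F.submodule_iff by simp_all
  obtain h where h: "h \<in> module_hom R (free_module R k) (free_module R n)"
    "\<And>j. j < k \<Longrightarrow> h (unit_vector R k j) = w j"
    using free_module_hom_exists[OF module_free_module, of k w n] wc N(1) by blast
  have "h v \<in> N" if "v \<in> carrier (free_module R k)" for v
    using that
  proof (rule free_module_induct)
    show "h \<zero>\<^bsub>free_module R k\<^esub> \<in> N"
      using module_hom_zero[OF module_free_module module_free_module h(1)] N(2) by simp
  qed (use h(2) wc module_homD[OF h(1)] N in auto)
  moreover have "N \<subseteq> h ` carrier (free_module R k)"
  proof (rule W(3))
    show "submodule (h ` carrier (free_module R k)) R (free_module R n)"
      by (rule module_hom_image_submodule[OF module_free_module module_free_module h(1)
          module.carrier_is_submodule[OF module_free_module]])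
    show "W \<subseteq> h ` carrier (free_module R k)"
      using h(2)[symmetric] unit_vector_carrier w by auto
  qed
  ultimately show thesis using that h(1) by blast
qed

text \<open>Each kernel is the image of a further free module of finite rank.\<close>
lemma (in noetherian_cring) free_resolution_exists:
  assumes "module R M" and \<epsilon>: "\<epsilon> \<in> module_hom R (free_module R n) M"
    and surj: "\<epsilon> ` carrier (free_module R n) = carrier M"
  obtains rk \<delta> where "free_resolution R M rk \<delta> \<epsilon>"
proof -
  let ?F = "free_module R"
  let ?P = "\<lambda>i (a, b, d). d \<in> module_hom R (?F a) (?F b) \<and>
     (i = (0::nat) \<longrightarrow> b = n \<and> d ` carrier (?F a) = {v \<in> carrier (?F n). \<epsilon> v = \<zero>\<^bsub>M\<^esub>})"
  let ?Q = "\<lambda>(a, b, d) (a', b', d'). b' = a \<and> d' ` carrier (?F a') = {v \<in> carrier (?F a). d v = \<zero>\<^bsub>?F b\<^esub>}"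
  have "\<exists>f. \<forall>i. ?P i (f i) \<and> ?Q (f i) (f (Suc i))"
  proof (rule dependent_nat_choice)
    obtain k h where "h \<in> module_hom R (?F k) (?F n)"
      "h ` carrier (?F k) = {v \<in> carrier (?F n). \<epsilon> v = \<zero>\<^bsub>M\<^esub>}"
      using submodule_is_image_of_free[OF module_hom_kernel_submodule[OF module_free_module assms(1) \<epsilon>]] .
    then show "\<exists>x. ?P 0 x" by (intro exI[of _ "(k, n, h)"]) simp
  next
    fix x :: "nat \<times> nat \<times> ((nat \<Rightarrow> 'a) \<Rightarrow> (nat \<Rightarrow> 'a))" and i :: nat
    assume "?P i x"
    then obtain a b d where x: "x = (a, b, d)" "d \<in> module_hom R (?F a) (?F b)" by (cases x) auto
    obtain k h where "h \<in> module_hom R (?F k) (?F a)"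
      "h ` carrier (?F k) = {v \<in> carrier (?F a). d v = \<zero>\<^bsub>?F b\<^esub>}"
      using submodule_is_image_of_free[OF module_hom_kernel_submodule[OF module_free_module module_free_module x(2)]] .
    then show "\<exists>y. ?P (Suc i) y \<and> ?Q x y" using x by (intro exI[of _ "(k, a, h)"]) simp
  qed
  then obtain f where "\<forall>i. ?P i (f i) \<and> ?Q (f i) (f (Suc i))" ..
  then have f: "?P i (f i)" "?Q (f i) (f (Suc i))" for i by simp_all
  define rk where "rk i = (case i of 0 \<Rightarrow> n | Suc j \<Rightarrow> fst (f j))" for i
  define \<delta> where "\<delta> i = snd (snd (f i))" for i
  have b: "fst (snd (f i)) = rk i" for i
    using f(1)[of 0] f(2)[of "i - 1"] by (cases i) (auto simp: rk_def split: prod.splits)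
  have "free_resolution R M rk \<delta> \<epsilon>"
    unfolding free_resolution_def
  proof (intro conjI allI)
    show "\<epsilon> \<in> module_hom R (?F (rk 0)) M" "\<epsilon> ` carrier (?F (rk 0)) = carrier M"
      using \<epsilon> surj by (simp_all add: rk_def)
    show "\<delta> i \<in> module_hom R (?F (rk (Suc i))) (?F (rk i))" for i
      using f(1)[of i] b[of i] by (simp add: rk_def \<delta>_def split: prod.splits)
    show "\<delta> 0 ` carrier (?F (rk 1)) = {v \<in> carrier (?F (rk 0)). \<epsilon> v = \<zero>\<^bsub>M\<^esub>}"
      using f(1)[of 0] by (simp add: rk_def \<delta>_def split: prod.splits)
    show "\<delta> (Suc i) ` carrier (?F (rk (Suc (Suc i)))) =
        {v \<in> carrier (?F (rk (Suc i))). \<delta> i v = \<zero>\<^bsub>?F (rk i)\<^esub>}" for i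
      using f(2)[of i] b[of i] by (simp add: rk_def \<delta>_def split: prod.splits)
  qed
  then show thesis using that by blast
qed

lemma (in noetherian_cring) free_resolution_cyclic_exists:
  assumes "ideal A R"
  obtains rk \<delta> \<epsilon> where "free_resolution R (quot_module (self_module R) A) rk \<delta> \<epsilon>"
proof -
  interpret S: module R "self_module R" by (rule module_self_module)
  have A: "submodule A R (self_module R)" using assms submodule_self_module_iff by simp
  let ?Q = "quot_module (self_module R) A"
  have Q: "module R ?Q" by (rule module_quot_module[OF module_self_module A])
  interpret Q: module R ?Q by (rule Q)
  have c: "carrier ?Q = (\<lambda>x. A +>\<^bsub>self_module R\<^esub> x) ` carrier R"
    by (auto simp: quot_module_def A_RCOSETS_def' self_module_def)
  have "A +>\<^bsub>self_module R\<^esub> \<one> \<in> carrier ?Q" unfolding c by simp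
  then obtain \<epsilon> where \<epsilon>: "\<epsilon> \<in> module_hom R (free_module R 1) ?Q"
    "\<And>j. j < (1::nat) \<Longrightarrow> \<epsilon> (unit_vector R 1 j) = A +>\<^bsub>self_module R\<^esub> \<one>"
    using free_module_hom_exists[OF Q, of 1 "\<lambda>_. A +>\<^bsub>self_module R\<^esub> \<one>"] by blast
  have "\<epsilon> ` carrier (free_module R 1) = carrier ?Q"
  proof
    show "\<epsilon> ` carrier (free_module R 1) \<subseteq> carrier ?Q" using module_homD(1)[OF \<epsilon>(1)] by auto
    show "carrier ?Q \<subseteq> \<epsilon> ` carrier (free_module R 1)"
    proof
      fix X assume "X \<in> carrier ?Q"
      then obtain r where r: "r \<in> carrier R" "X = A +>\<^bsub>self_module R\<^esub> r" unfolding c by blast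
      have "\<epsilon> (r \<odot>\<^bsub>free_module R 1\<^esub> unit_vector R 1 0) = r \<odot>\<^bsub>?Q\<^esub> (A +>\<^bsub>self_module R\<^esub> \<one>)"
        using module_homD(3)[OF \<epsilon>(1) r(1) unit_vector_carrier] \<epsilon>(2)[of 0] by simp
      also have "\<dots> = A +>\<^bsub>self_module R\<^esub> (r \<odot>\<^bsub>self_module R\<^esub> \<one>)"
        using quot_module_cosets(3)[OF module_self_module A r(1), of \<one>] by (simp add: self_module_def)
      also have "\<dots> = X" using r by (simp add: self_module_def)
      finally show "X \<in> \<epsilon> ` carrier (free_module R 1)"
        using module.smult_closed[OF module_free_module r(1) unit_vector_carrier] by blast
    qed
  qed
  from free_resolution_exists[OF Q \<epsilon>(1) this] that show thesis by blast
qed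


section \<open>Cohomology of the residue field\<close>

text \<open>A free resolution \<open>\<dots> \<rightarrow> R\<^bsup>rk 1\<^esup> \<rightarrow> R\<^bsup>rk 0\<^esup>\<close> of the residue field whose augmentation is lifted
  to a map \<open>\<gamma>\<close> into \<open>R\<close> itself. Only the class of \<open>\<gamma> v\<close> modulo \<open>\<mm>\<close> matters, but with \<open>\<gamma>\<close> no
  cosets appear in what follows. The vector \<open>e\<close> is a preimage of \<open>1\<close>.\<close>
locale resolved_residue_field = noetherian_local_ring +
  fixes rk :: "nat \<Rightarrow> nat" and \<delta> :: "nat \<Rightarrow> (nat \<Rightarrow> 'a) \<Rightarrow> (nat \<Rightarrow> 'a)"
    and \<gamma> :: "(nat \<Rightarrow> 'a) \<Rightarrow> 'a" and e :: "nat \<Rightarrow> 'a"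
  assumes delta_hom: "\<delta> n \<in> module_hom R (free_module R (rk (Suc n))) (free_module R (rk n))"
    and delta_image: "\<delta> (Suc n) ` carrier (free_module R (rk (Suc (Suc n)))) =
      {v \<in> carrier (free_module R (rk (Suc n))). \<delta> n v = \<zero>\<^bsub>free_module R (rk n)\<^esub>}"
    and gamma_hom: "\<gamma> \<in> module_hom R (free_module R (rk 0)) (self_module R)"
    and delta_image_0: "\<delta> 0 ` carrier (free_module R (rk (Suc 0))) =
      {v \<in> carrier (free_module R (rk 0)). \<gamma> v \<in> \<mm>}"
    and e: "e \<in> carrier (free_module R (rk 0))" "\<gamma> e \<ominus> \<one> \<in> \<mm>"

lemma (in noetherian_local_ring) resolved_residue_field_of_resolution:
  assumes res: "free_resolution R (quot_module (self_module R) \<mm>) rk \<delta> \<epsilon>"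
  obtains \<gamma> e where "resolved_residue_field R \<mm> rk \<delta> \<gamma> e"
proof -
  let ?S = "self_module R" and ?F = "free_module R (rk 0)"
  have mm: "submodule \<mm> R ?S" using ideal_mm submodule_self_module_iff by simp
  note S = module_self_module and Q = module_quot_module[OF module_self_module mm]
    and F = module_free_module[of "rk 0"] and k = coset_hom[OF module_self_module mm]
  note q = quot_module_cosets[OF S mm]
  interpret F: module R ?F by (rule F)
  let ?k = "\<lambda>c\<in>carrier ?S. \<mm> +>\<^bsub>?S\<^esub> c"
  have eps: "\<epsilon> \<in> module_hom R ?F (quot_module ?S \<mm>)" "\<epsilon> ` carrier ?F = carrier (quot_module ?S \<mm>)"
    using res unfolding free_resolution_def by blast+
  have surj: "?k ` carrier ?S = carrier (quot_module ?S \<mm>)" unfolding q(1) by auto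
  obtain \<gamma> where \<gamma>: "\<gamma> \<in> module_hom R ?F ?S" "\<And>v. v \<in> carrier ?F \<Longrightarrow> ?k (\<gamma> v) = \<epsilon> v"
    using free_module_lift[OF S Q eps(1) k] module_homD(1)[OF eps(1) unit_vector_carrier] surj by auto
  have kz: "\<epsilon> v = \<zero>\<^bsub>quot_module ?S \<mm>\<^esub> \<longleftrightarrow> \<gamma> v \<in> \<mm>" if "v \<in> carrier ?F" for v
    using \<gamma>(2)[OF that] module_homD(1)[OF \<gamma>(1) that] q(5)[of "\<gamma> v"] by simp
  have one: "\<one> \<in> carrier ?S" by (simp add: self_module_def)
  then have "?k \<one> \<in> \<epsilon> ` carrier ?F" unfolding eps(2) surj[symmetric] by (rule imageI)
  then obtain e where e: "e \<in> carrier ?F" "?k (\<gamma> e) = ?k \<one>" using \<gamma>(2) by auto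
  have "?k (\<gamma> e \<ominus>\<^bsub>?S\<^esub> \<one>) = \<zero>\<^bsub>quot_module ?S \<mm>\<^esub>"
    using module_hom_diff[OF S Q k module_homD(1)[OF \<gamma>(1) e(1)] one e(2)] .
  moreover have "\<gamma> e \<ominus>\<^bsub>?S\<^esub> \<one> = \<gamma> e \<ominus> \<one>"
    by (simp add: a_minus_def a_inv_def m_inv_def self_module_def)
  moreover have "\<gamma> e \<in> carrier R" using module_homD(1)[OF \<gamma>(1) e(1)] by (simp add: self_module_def)
  ultimately have "\<gamma> e \<ominus> \<one> \<in> \<mm>" using q(5)[of "\<gamma> e \<ominus> \<one>"] by (simp add: self_module_def)
  then have "resolved_residue_field R \<mm> rk \<delta> \<gamma> e"
    using res \<gamma>(1) kz e(1) unfolding free_resolution_def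
    by (intro resolved_residue_field.intro resolved_residue_field_axioms.intro noetherian_local_ring_axioms) auto
  then show thesis by (rule that)
qed

text \<open>Cohomology with values in \<open>M/A\<close> for ideals \<open>A \<subseteq> M\<close>. Since the resolution is free,
  homomorphisms into \<open>M/A\<close> are represented by homomorphisms into \<open>M\<close>.\<close>
context resolved_residue_field
begin

abbreviation F :: "nat \<Rightarrow> ('a, nat \<Rightarrow> 'a) module" where
  "F n \<equiv> free_module R (rk n)"

definition cochains :: "'a set \<Rightarrow> nat \<Rightarrow> ((nat \<Rightarrow> 'a) \<Rightarrow> 'a) set" where
  "cochains M n = module_hom R (F n) (self_module R\<lparr>carrier := M\<rparr>)"

definition cocycles :: "'a set \<Rightarrow> 'a set \<Rightarrow> nat \<Rightarrow> ((nat \<Rightarrow> 'a) \<Rightarrow> 'a) set" where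
  "cocycles M A n = {f \<in> cochains M n. \<forall>v\<in>carrier (F (Suc n)). f (\<delta> n v) \<in> A}"

text \<open>The coboundaries of the complex \<open>Hom(F, M)\<close> itself, that is, for \<open>A = 0\<close>.\<close>
definition differentials :: "'a set \<Rightarrow> nat \<Rightarrow> ((nat \<Rightarrow> 'a) \<Rightarrow> 'a) set" where
  "differentials M n = (case n of 0 \<Rightarrow> {\<lambda>v\<in>carrier (F 0). \<zero>}
     | Suc k \<Rightarrow> (\<lambda>g. compose (carrier (F (Suc k))) g (\<delta> k)) ` cochains M k)"

definition coboundaries :: "'a set \<Rightarrow> 'a set \<Rightarrow> nat \<Rightarrow> ((nat \<Rightarrow> 'a) \<Rightarrow> 'a) set" where
  "coboundaries M A n = {f \<in> cochains M n. \<exists>d\<in>differentials M n. \<forall>v\<in>carrier (F n). f v \<ominus> d v \<in> A}"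

lemmas deltaD = module_homD[OF delta_hom]

lemma delta_delta: "v \<in> carrier (F (Suc (Suc n))) \<Longrightarrow> \<delta> n (\<delta> (Suc n) v) = \<zero>\<^bsub>F n\<^esub>"
  using delta_image[of n] by blast

lemma cochainsD:
  assumes "f \<in> cochains M n"
  shows "v \<in> carrier (F n) \<Longrightarrow> f v \<in> M"
    "u \<in> carrier (F n) \<Longrightarrow> v \<in> carrier (F n) \<Longrightarrow> f (u \<oplus>\<^bsub>F n\<^esub> v) = f u \<oplus> f v"
    "r \<in> carrier R \<Longrightarrow> v \<in> carrier (F n) \<Longrightarrow> f (r \<odot>\<^bsub>F n\<^esub> v) = r \<otimes> f v"
  using module_homD[OF assms[unfolded cochains_def]] by (simp_all add: self_module_def)

lemma cochains_carrier:
  assumes "ideal M R" "f \<in> cochains M n" "v \<in> carrier (F n)"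
  shows "f v \<in> carrier R"
  using cochainsD(1)[OF assms(2,3)] idealD(1)[OF assms(1)] by blast

lemma gamma_cochain: "\<gamma> \<in> cochains (carrier R) 0"
  using gamma_hom by (simp add: cochains_def self_module_def)

lemmas gammaD = cochainsD[OF gamma_cochain]

abbreviation cochain_module :: "'a set \<Rightarrow> nat \<Rightarrow> ('a, (nat \<Rightarrow> 'a) \<Rightarrow> 'a) module" where
  "cochain_module M n \<equiv> hom_module R (F n) (self_module R\<lparr>carrier := M\<rparr>)"

lemma module_cochain_module: "ideal M R \<Longrightarrow> module R (cochain_module M n)"
  by (intro module_hom_module module_free_module module_self_module_ideal)

lemma cochain_module_simps:
  "carrier (cochain_module M n) = cochains M n"
  "\<zero>\<^bsub>cochain_module M n\<^esub> = (\<lambda>v\<in>carrier (F n). \<zero>)"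
  "f \<oplus>\<^bsub>cochain_module M n\<^esub> g = (\<lambda>v\<in>carrier (F n). f v \<oplus> g v)"
  "r \<odot>\<^bsub>cochain_module M n\<^esub> f = (\<lambda>v\<in>carrier (F n). r \<otimes> f v)"
  by (simp_all add: hom_module_simps cochains_def self_module_def)

lemma cochains_compose:
  assumes "s \<in> module_hom R (F k) (F n)" "f \<in> cochains M n"
  shows "(\<lambda>v\<in>carrier (F k). f (s v)) \<in> cochains M k"
  using assms unfolding cochains_def by (rule module_hom_compose[OF module_free_module])

lemma cochains_minus_multiple:
  assumes M: "ideal M R" and f: "f \<in> cochains M n" and g: "g \<in> cochains M n" and x: "x \<in> carrier R"
  shows "(\<lambda>v\<in>carrier (F n). f v \<ominus> x \<otimes> g v) \<in> cochains M n"
proof -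
  interpret C: module R "cochain_module M n" by (rule module_cochain_module[OF M])
  have "f \<oplus>\<^bsub>cochain_module M n\<^esub> (\<ominus> x) \<odot>\<^bsub>cochain_module M n\<^esub> g \<in> cochains M n"
    using C.M.a_closed[of f "(\<ominus> x) \<odot>\<^bsub>cochain_module M n\<^esub> g"] C.smult_closed[of "\<ominus> x" g] f g x
    unfolding cochain_module_simps(1) by simp
  moreover have "f \<oplus>\<^bsub>cochain_module M n\<^esub> (\<ominus> x) \<odot>\<^bsub>cochain_module M n\<^esub> g = (\<lambda>v\<in>carrier (F n). f v \<ominus> x \<otimes> g v)"
    unfolding cochain_module_simps using cochains_carrier[OF M g] x
    by (intro restrict_ext) (simp add: minus_eq l_minus)
  ultimately show ?thesis by simp
qed

lemma cochain_exists:
  assumes "ideal M R" "\<And>j. j < rk n \<Longrightarrow> c j \<in> M"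
  obtains f where "f \<in> cochains M n" "\<And>j. j < rk n \<Longrightarrow> f (unit_vector R (rk n) j) = c j"
  using free_module_hom_exists[OF module_self_module_ideal[OF assms(1)], of "rk n" c] assms(2)
  unfolding cochains_def by (auto simp: self_module_def)

text \<open>The quotients are chosen on a basis; the remainder then has values in \<open>A\<close> there, hence
  everywhere.\<close>
lemma cochain_divide:
  assumes A: "ideal A R" and M: "ideal M R" and x: "x \<in> carrier R"
    and h: "h \<in> cochains M n" and hA: "\<And>v. v \<in> carrier (F n) \<Longrightarrow> h v \<in> add_multiples R A x M"
  obtains g where "g \<in> cochains M n" "\<And>v. v \<in> carrier (F n) \<Longrightarrow> h v \<ominus> x \<otimes> g v \<in> A"
proof -
  interpret F: module R "F n" by (rule module_free_module)
  have "\<exists>c. c \<in> M \<and> h (unit_vector R (rk n) j) \<ominus> x \<otimes> c \<in> A" for j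
  proof -
    obtain b c where bc: "b \<in> A" "c \<in> M" "h (unit_vector R (rk n) j) = b \<oplus> x \<otimes> c"
      using hA[OF unit_vector_carrier] unfolding add_multiples_def by blast
    have "(b \<oplus> x \<otimes> c) \<ominus> x \<otimes> c = b" using x idealD(1)[OF A bc(1)] idealD(1)[OF M bc(2)] by algebra
    then show ?thesis using bc by auto
  qed
  then obtain c where c: "\<And>j. c j \<in> M" "\<And>j. h (unit_vector R (rk n) j) \<ominus> x \<otimes> c j \<in> A" by metis
  obtain g where g: "g \<in> cochains M n" "\<And>j. j < rk n \<Longrightarrow> g (unit_vector R (rk n) j) = c j"
    using cochain_exists[OF M, of n c] c(1) by blast
  define l where "l = (\<lambda>v\<in>carrier (F n). h v \<ominus> x \<otimes> g v)"
  have l: "l \<in> cochains M n" unfolding l_def by (rule cochains_minus_multiple[OF M h g(1) x])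
  have "l v \<in> A" if "v \<in> carrier (F n)" for v
    using that
  proof (rule free_module_induct)
    show "l \<zero>\<^bsub>F n\<^esub> \<in> A"
      using cochainsD(3)[OF l zero_closed F.M.zero_closed] cochains_carrier[OF M l] idealD(2)[OF A] by simp
    show "l (unit_vector R (rk n) j) \<in> A" if "j < rk n" for j
      using c(2) g(2)[OF that] by (simp add: l_def unit_vector_carrier)
  qed (simp_all add: cochainsD[OF l] idealD(3,4)[OF A])
  with g(1) show thesis by (intro that[of g]) (auto simp: l_def)
qed

subsection \<open>Multiplication by an element of the maximal ideal is null-homotopic\<close>

text \<open>A null-homotopy \<open>s\<close> of multiplication by \<open>x\<close> satisfies \<open>\<delta> s + s \<delta> = x\<close>. To continue it by one
  degree, the identity \<open>\<delta> s \<delta> = x \<delta>\<close> suffices: it places \<open>x - s \<delta>\<close> in the kernel of \<open>\<delta>\<close>.\<close>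
lemma homotopy_step:
  assumes x: "x \<in> carrier R" and s: "s \<in> module_hom R (F n) (F (Suc n))"
    and sx: "\<And>v. v \<in> carrier (F (Suc n)) \<Longrightarrow> \<delta> n (s (\<delta> n v)) = x \<odot>\<^bsub>F n\<^esub> \<delta> n v"
  obtains s' where "s' \<in> module_hom R (F (Suc n)) (F (Suc (Suc n)))"
    "\<And>v. v \<in> carrier (F (Suc n)) \<Longrightarrow> \<delta> (Suc n) (s' v) \<oplus>\<^bsub>F (Suc n)\<^esub> s (\<delta> n v) = x \<odot>\<^bsub>F (Suc n)\<^esub> v"
proof -
  let ?G = "F (Suc n)"
  interpret F: module R "F n" by (rule module_free_module)
  interpret G: module R ?G by (rule module_free_module)
  define \<phi> where "\<phi> = (\<lambda>v\<in>carrier ?G. x \<odot>\<^bsub>?G\<^esub> v \<oplus>\<^bsub>?G\<^esub> (\<ominus> \<one>) \<odot>\<^bsub>?G\<^esub> s (\<delta> n v))"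
  note sD = module_homD[OF s] and dD = deltaD[where n = n]
  have c: "s (\<delta> n v) \<in> carrier ?G" if "v \<in> carrier ?G" for v using sD(1) dD(1) that by simp
  have "\<phi> \<in> module_hom R ?G ?G"
    unfolding \<phi>_def
    by (rule module_hom_restrictI[OF module_free_module])
      (simp_all add: x c sD dD G.smult_r_distr G.a_ac G.smult_assoc1[symmetric] m_comm)
  moreover have "\<phi> v \<in> \<delta> (Suc n) ` carrier (F (Suc (Suc n)))" if v: "v \<in> carrier ?G" for v
  proof -
    have "\<delta> n (\<phi> v) = x \<odot>\<^bsub>F n\<^esub> \<delta> n v \<oplus>\<^bsub>F n\<^esub> (\<ominus> \<one>) \<odot>\<^bsub>F n\<^esub> (x \<odot>\<^bsub>F n\<^esub> \<delta> n v)"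
      using v x c[OF v] sx[OF v] by (simp add: \<phi>_def dD)
    then have "\<delta> n (\<phi> v) = \<zero>\<^bsub>F n\<^esub>" using dD(1)[OF v] x by (simp add: F.smult_l_minus F.r_neg)
    then show ?thesis unfolding delta_image using v x c[OF v] by (simp add: \<phi>_def)
  qed
  ultimately obtain s' where s': "s' \<in> module_hom R ?G (F (Suc (Suc n)))"
    "\<And>v. v \<in> carrier ?G \<Longrightarrow> \<delta> (Suc n) (s' v) = \<phi> v"
    using free_module_lift[OF module_free_module module_free_module _ delta_hom] unit_vector_carrier by metis
  have "\<phi> v \<oplus>\<^bsub>?G\<^esub> s (\<delta> n v) = x \<odot>\<^bsub>?G\<^esub> v" if "v \<in> carrier ?G" for v
    using that c[OF that] x by (simp add: \<phi>_def G.smult_l_minus G.a_assoc G.l_neg)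
  with s' that show thesis by simp
qed

lemma homotopy_exists:
  assumes x: "x \<in> \<mm>"
  shows "\<exists>s\<in>module_hom R (F n) (F (Suc n)). \<forall>v\<in>carrier (F (Suc n)). \<delta> n (s (\<delta> n v)) = x \<odot>\<^bsub>F n\<^esub> \<delta> n v"
proof (induction n)
  have xc: "x \<in> carrier R" using idealD(1)[OF ideal_mm x] .
  case 0
  interpret F: module R "F 0" by (rule module_free_module)
  let ?\<phi> = "\<lambda>v\<in>carrier (F 0). x \<odot>\<^bsub>F 0\<^esub> v"
  have "?\<phi> \<in> module_hom R (F 0) (F 0)"
    by (rule module_hom_restrictI[OF module_free_module])
      (simp_all add: xc F.smult_r_distr F.smult_assoc1[symmetric] m_comm)
  moreover have "?\<phi> v \<in> \<delta> 0 ` carrier (F (Suc 0))" if "v \<in> carrier (F 0)" for v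
    unfolding delta_image_0 using that xc gammaD(1,3) idealD(5)[OF ideal_mm _ x] by simp
  ultimately obtain s where "s \<in> module_hom R (F 0) (F (Suc 0))"
    "\<And>v. v \<in> carrier (F 0) \<Longrightarrow> \<delta> 0 (s v) = ?\<phi> v"
    using free_module_lift[OF module_free_module module_free_module _ delta_hom] unit_vector_carrier by metis
  then show ?case using deltaD(1)[of _ 0] by (intro bexI[of _ s]) simp_all
next
  have xc: "x \<in> carrier R" using idealD(1)[OF ideal_mm x] .
  case (Suc n)
  then obtain s where s: "s \<in> module_hom R (F n) (F (Suc n))"
    "\<And>v. v \<in> carrier (F (Suc n)) \<Longrightarrow> \<delta> n (s (\<delta> n v)) = x \<odot>\<^bsub>F n\<^esub> \<delta> n v" by blast
  obtain s' where s': "s' \<in> module_hom R (F (Suc n)) (F (Suc (Suc n)))"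
    "\<And>v. v \<in> carrier (F (Suc n)) \<Longrightarrow> \<delta> (Suc n) (s' v) \<oplus>\<^bsub>F (Suc n)\<^esub> s (\<delta> n v) = x \<odot>\<^bsub>F (Suc n)\<^esub> v"
    by (rule homotopy_step[OF xc s]) simp_all
  interpret G: module R "F (Suc n)" by (rule module_free_module)
  have "\<delta> (Suc n) (s' (\<delta> (Suc n) v)) = x \<odot>\<^bsub>F (Suc n)\<^esub> \<delta> (Suc n) v" if v: "v \<in> carrier (F (Suc (Suc n)))" for v
    using s'(2)[OF deltaD(1)[OF v]] delta_delta[OF v] module_hom_zero[OF module_free_module module_free_module s(1)]
      deltaD(1)[OF module_homD(1)[OF s'(1) deltaD(1)[OF v]]] by simp
  with s'(1) show ?case by blast
qed

lemma smult_cocycle_0: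
  assumes x: "x \<in> \<mm>" and f: "f \<in> cocycles M A 0" and v: "v \<in> carrier (F 0)"
  shows "x \<otimes> f v \<in> A"
proof -
  interpret F: module R "F 0" by (rule module_free_module)
  have xc: "x \<in> carrier R" using idealD(1)[OF ideal_mm x] .
  have "x \<odot>\<^bsub>F 0\<^esub> v \<in> \<delta> 0 ` carrier (F (Suc 0))"
    unfolding delta_image_0 using v xc gammaD(1,3) idealD(5)[OF ideal_mm _ x] by simp
  then have "f (x \<odot>\<^bsub>F 0\<^esub> v) \<in> A" using f unfolding cocycles_def by auto
  then show ?thesis using f cochainsD(3)[of f M 0 x v] xc v by (simp add: cocycles_def)
qed

lemma smult_cocycle_Suc:
  assumes A: "ideal A R" and M: "ideal M R" and x: "x \<in> \<mm>" and f: "f \<in> cocycles M A (Suc n)"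
  obtains g where "g \<in> cochains M n" "\<And>v. v \<in> carrier (F (Suc n)) \<Longrightarrow> g (\<delta> n v) \<ominus> x \<otimes> f v \<in> A"
proof -
  have xc: "x \<in> carrier R" using idealD(1)[OF ideal_mm x] .
  have fC: "f \<in> cochains M (Suc n)" using f unfolding cocycles_def by blast
  obtain t where t: "t \<in> module_hom R (F n) (F (Suc n))"
    "\<And>v. v \<in> carrier (F (Suc n)) \<Longrightarrow> \<delta> n (t (\<delta> n v)) = x \<odot>\<^bsub>F n\<^esub> \<delta> n v"
    using homotopy_exists[OF x, of n] by blast
  obtain s where s: "s \<in> module_hom R (F (Suc n)) (F (Suc (Suc n)))"
    "\<And>v. v \<in> carrier (F (Suc n)) \<Longrightarrow> \<delta> (Suc n) (s v) \<oplus>\<^bsub>F (Suc n)\<^esub> t (\<delta> n v) = x \<odot>\<^bsub>F (Suc n)\<^esub> v"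
    by (rule homotopy_step[OF xc t]) simp_all
  have "(\<lambda>v\<in>carrier (F n). f (t v)) \<in> cochains M n" by (rule cochains_compose[OF t(1) fC])
  moreover have "f (t (\<delta> n v)) \<ominus> x \<otimes> f v \<in> A" if v: "v \<in> carrier (F (Suc n))" for v
  proof -
    have c: "\<delta> (Suc n) (s v) \<in> carrier (F (Suc n))" "t (\<delta> n v) \<in> carrier (F (Suc n))"
      using v module_homD(1)[OF s(1)] module_homD(1)[OF t(1)] deltaD(1) by simp_all
    have fs: "f (\<delta> (Suc n) (s v)) \<in> A" using f module_homD(1)[OF s(1) v] unfolding cocycles_def by blast
    have "x \<otimes> f v = f (\<delta> (Suc n) (s v)) \<oplus> f (t (\<delta> n v))"
      using cochainsD(3)[OF fC xc v] cochainsD(2)[OF fC c] s(2)[OF v] by simp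
    then have "f (t (\<delta> n v)) \<ominus> x \<otimes> f v = \<ominus> f (\<delta> (Suc n) (s v))"
      using cochains_carrier[OF M fC c(1)] cochains_carrier[OF M fC c(2)] by (simp only:) algebra
    then show ?thesis using idealD(6)[OF A fs] by simp
  qed
  ultimately show thesis using deltaD(1)[of _ n] by (intro that[of "\<lambda>v\<in>carrier (F n). f (t v)"]) simp_all
qed
lemma differentials_Suc:
  "g \<in> cochains M n \<Longrightarrow> (\<lambda>v\<in>carrier (F (Suc n)). g (\<delta> n v)) \<in> differentials M (Suc n)"
  by (auto simp: differentials_def compose_def)

lemma coboundaries_SucI:
  assumes "f \<in> cochains M (Suc n)" "g \<in> cochains M n"
    and "\<And>v. v \<in> carrier (F (Suc n)) \<Longrightarrow> f v \<ominus> g (\<delta> n v) \<in> A"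
  shows "f \<in> coboundaries M A (Suc n)"
  unfolding coboundaries_def using assms differentials_Suc[OF assms(2)]
  by (intro CollectI conjI bexI[of _ "\<lambda>v\<in>carrier (F (Suc n)). g (\<delta> n v)"]) simp_all

lemma differentials_SucE:
  assumes "d \<in> differentials M (Suc n)"
  obtains g where "g \<in> cochains M n" "\<And>v. v \<in> carrier (F (Suc n)) \<Longrightarrow> d v = g (\<delta> n v)"
  using assms by (auto simp: differentials_def compose_def)

lemma differentials_submodule:
  assumes M: "ideal M R" shows "submodule (differentials M n) R (cochain_module M n)"
proof (cases n)
  case 0
  interpret C: module R "cochain_module M n" by (rule module_cochain_module[OF M])
  have "differentials M n = {\<zero>\<^bsub>cochain_module M n\<^esub>}"
    unfolding differentials_def cochain_module_simps 0 by simp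
  then show ?thesis by (simp add: C.submodule_iff)
next
  case (Suc k)
  note C = module_cochain_module[OF M]
  let ?h = "\<lambda>g\<in>carrier (cochain_module M k). compose (carrier (F (Suc k))) g (\<delta> k)"
  have "?h \<in> module_hom R (cochain_module M k) (cochain_module M (Suc k))"
    by (rule module_hom_restrictI[OF C])
      (auto simp: cochain_module_simps compose_def deltaD(1) intro!: cochains_compose[OF delta_hom] restrict_ext)
  from module_hom_image_submodule[OF C C this module.carrier_is_submodule[OF C]] show ?thesis
    by (simp add: Suc differentials_def cochain_module_simps)
qed

lemma differentialsD:
  assumes M: "ideal M R" and d: "d \<in> differentials M n"
  shows "d \<in> cochains M n" "v \<in> carrier (F (Suc n)) \<Longrightarrow> d (\<delta> n v) = \<zero>"
proof -
  show "d \<in> cochains M n"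
    using module.submoduleE(1)[OF module_cochain_module[OF M] differentials_submodule[OF M]] d
    unfolding cochain_module_simps by blast
  assume v: "v \<in> carrier (F (Suc n))"
  show "d (\<delta> n v) = \<zero>"
  proof (cases n)
    case 0 then show ?thesis using d v deltaD(1) by (auto simp: differentials_def)
  next
    case (Suc k)
    then obtain g where g: "g \<in> cochains M k" "d (\<delta> n v) = g (\<delta> k (\<delta> n v))"
      using d deltaD(1)[OF v] differentials_SucE by metis
    have "g \<zero>\<^bsub>F k\<^esub> = \<zero>"
      using module_hom_zero[OF module_free_module module_self_module_ideal[OF M] g(1)[unfolded cochains_def]]
      by (simp add: self_module_def)
    then show ?thesis using g(2) delta_delta[of v k] v Suc by simp
  qed
qed

text \<open>Subtracting the exact part leaves a cochain with values in \<open>A\<close> and the same differential.\<close>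
lemma coboundary_normal_form:
  assumes M: "ideal M R" and f: "f \<in> coboundaries M A n"
  obtains k where "k \<in> cochains M n" "\<And>v. v \<in> carrier (F n) \<Longrightarrow> k v \<in> A"
    "\<And>v. v \<in> carrier (F (Suc n)) \<Longrightarrow> k (\<delta> n v) = f (\<delta> n v)"
proof -
  obtain d where d: "d \<in> differentials M n" "\<And>v. v \<in> carrier (F n) \<Longrightarrow> f v \<ominus> d v \<in> A"
    and fC: "f \<in> cochains M n" using f by (auto simp: coboundaries_def)
  note dD = differentialsD[OF M d(1)]
  show thesis
    using d(2) dD(2) cochains_carrier[OF M dD(1)] cochains_carrier[OF M fC] deltaD(1)[of _ n]
    by (intro that[OF cochains_minus_multiple[OF M fC dD(1) one_closed]]) (simp_all add: minus_eq)
qed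

subsection \<open>The connecting homomorphism of a regular element\<close>

context
  fixes M A :: "'a set" and x :: 'a
  assumes M: "ideal M R" and A: "ideal A R" and x: "x \<in> \<mm>"
    and regular: "\<And>v. v \<in> M \<Longrightarrow> x \<otimes> v \<in> A \<Longrightarrow> v \<in> A"
begin

private abbreviation A' :: "'a set" where "A' \<equiv> add_multiples R A x M"

private lemma xc: "x \<in> carrier R" using idealD(1)[OF ideal_mm x] .

private lemma A': "ideal A' R" by (rule add_multiples_ideal(1)[OF A M xc])

text \<open>Put \<open>A' = A + xM\<close>. The sequence \<open>0 \<rightarrow> M/A \<rightarrow> M/A \<rightarrow> M/A' \<rightarrow> 0\<close>, given by multiplication by \<open>x\<close>,
  yields a connecting homomorphism \<open>H\<^sup>n(M/A') \<rightarrow> H\<^bsup>n+1\<^esup>(M/A)\<close>. It sends \<open>f\<close> to \<open>g\<close> when \<open>f \<delta> - x g\<close>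
  has values in \<open>A\<close>. It is surjective because \<open>x\<close> annihilates cohomology, and injective if
  \<open>H\<^sup>n(M/A) = 0\<close>.\<close>
lemma connecting_exists:
  assumes f: "f \<in> cocycles M A' n"
  obtains g where "g \<in> cocycles M A (Suc n)" "\<And>v. v \<in> carrier (F (Suc n)) \<Longrightarrow> f (\<delta> n v) \<ominus> x \<otimes> g v \<in> A"
proof -
  have fC: "f \<in> cochains M n" using f by (simp add: cocycles_def)
  have "(\<lambda>v\<in>carrier (F (Suc n)). f (\<delta> n v)) v \<in> A'" if "v \<in> carrier (F (Suc n))" for v
    using f that by (simp add: cocycles_def)
  from cochain_divide[OF A M xc cochains_compose[OF delta_hom fC] this] obtain g
    where g: "g \<in> cochains M (Suc n)" "\<And>v. v \<in> carrier (F (Suc n)) \<Longrightarrow> f (\<delta> n v) \<ominus> x \<otimes> g v \<in> A" by auto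
  have "g (\<delta> (Suc n) v) \<in> A" if v: "v \<in> carrier (F (Suc (Suc n)))" for v
  proof (rule regular)
    have d: "\<delta> (Suc n) v \<in> carrier (F (Suc n))" using deltaD(1)[OF v] .
    show gM: "g (\<delta> (Suc n) v) \<in> M" using cochainsD(1)[OF g(1) d] .
    have "f \<zero>\<^bsub>F n\<^esub> = \<zero>"
      using module_hom_zero[OF module_free_module module_self_module_ideal[OF M] fC[unfolded cochains_def]]
      by (simp add: self_module_def)
    then have "\<ominus> (\<zero> \<ominus> x \<otimes> g (\<delta> (Suc n) v)) \<in> A"
      using g(2)[OF d] delta_delta[OF v] idealD(6)[OF A] by simp
    moreover have "\<ominus> (\<zero> \<ominus> x \<otimes> g (\<delta> (Suc n) v)) = x \<otimes> g (\<delta> (Suc n) v)"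
      using xc idealD(1)[OF M gM] by algebra
    ultimately show "x \<otimes> g (\<delta> (Suc n) v) \<in> A" by simp
  qed
  with g show thesis by (intro that[of g]) (simp_all add: cocycles_def)
qed

lemma connecting_reflects_coboundary:
  assumes f: "f \<in> cochains M n" and g: "g \<in> coboundaries M A (Suc n)"
    and fg: "\<And>v. v \<in> carrier (F (Suc n)) \<Longrightarrow> f (\<delta> n v) \<ominus> x \<otimes> g v \<in> A"
    and van: "cocycles M A n \<subseteq> coboundaries M A n"
  shows "f \<in> coboundaries M A' n"
proof -
  from g obtain d where "d \<in> differentials M (Suc n)" "\<And>v. v \<in> carrier (F (Suc n)) \<Longrightarrow> g v \<ominus> d v \<in> A"
    by (auto simp: coboundaries_def)
  then obtain g' where g': "g' \<in> cochains M n"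
    and gg': "\<And>v. v \<in> carrier (F (Suc n)) \<Longrightarrow> g v \<ominus> g' (\<delta> n v) \<in> A" using differentials_SucE by metis
  have gC: "g \<in> cochains M (Suc n)" using g by (simp add: coboundaries_def)
  define k where "k = (\<lambda>v\<in>carrier (F n). f v \<ominus> x \<otimes> g' v)"
  have kC: "k \<in> cochains M n" unfolding k_def by (rule cochains_minus_multiple[OF M f g' xc])
  have kv: "k v = f v \<ominus> x \<otimes> g' v" if "v \<in> carrier (F n)" for v using that by (simp add: k_def)
  have "k (\<delta> n v) \<in> A" if v: "v \<in> carrier (F (Suc n))" for v
  proof -
    note d = deltaD(1)[OF v]
    have "k (\<delta> n v) = (f (\<delta> n v) \<ominus> x \<otimes> g v) \<oplus> x \<otimes> (g v \<ominus> g' (\<delta> n v))"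
      unfolding kv[OF d] using cochains_carrier[OF M f d] cochains_carrier[OF M gC v]
        cochains_carrier[OF M g' d] xc by algebra
    then show ?thesis using idealD(3)[OF A fg[OF v] idealD(4)[OF A xc gg'[OF v]]] by simp
  qed
  with kC van have "k \<in> coboundaries M A n" by (auto simp: cocycles_def)
  then obtain d where d: "d \<in> differentials M n" "\<And>v. v \<in> carrier (F n) \<Longrightarrow> k v \<ominus> d v \<in> A"
    by (auto simp: coboundaries_def)
  have "f v \<ominus> d v \<in> A'" if v: "v \<in> carrier (F n)" for v
  proof -
    have "f v \<ominus> d v = (k v \<ominus> d v) \<oplus> x \<otimes> g' v"
      unfolding kv[OF v] using cochains_carrier[OF M f v] cochains_carrier[OF M g' v] xc
        cochains_carrier[OF M differentialsD(1)[OF M d(1)] v] by algebra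
    then show ?thesis unfolding add_multiples_def using d(2)[OF v] cochainsD(1)[OF g' v] by blast
  qed
  with f d(1) show ?thesis by (auto simp: coboundaries_def)
qed

lemma connecting_preserves_coboundary:
  assumes f: "f \<in> coboundaries M A' n" and g: "g \<in> cochains M (Suc n)"
    and fg: "\<And>v. v \<in> carrier (F (Suc n)) \<Longrightarrow> f (\<delta> n v) \<ominus> x \<otimes> g v \<in> A"
  shows "g \<in> coboundaries M A (Suc n)"
proof -
  obtain k where kC: "k \<in> cochains M n" and kA: "\<And>v. v \<in> carrier (F n) \<Longrightarrow> k v \<in> A'"
    and kf: "\<And>v. v \<in> carrier (F (Suc n)) \<Longrightarrow> k (\<delta> n v) = f (\<delta> n v)"
    using coboundary_normal_form[OF M f] by blast
  from cochain_divide[OF A M xc kC kA] obtain m where m: "m \<in> cochains M n"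
    and e: "\<And>v. v \<in> carrier (F n) \<Longrightarrow> k v \<ominus> x \<otimes> m v \<in> A" by blast
  have "g v \<ominus> m (\<delta> n v) \<in> A" if v: "v \<in> carrier (F (Suc n))" for v
  proof (rule regular)
    note d = deltaD(1)[OF v]
    show "g v \<ominus> m (\<delta> n v) \<in> M" using idealD(7)[OF M cochainsD(1)[OF g v] cochainsD(1)[OF m d]] .
    have "x \<otimes> (g v \<ominus> m (\<delta> n v)) = (k (\<delta> n v) \<ominus> x \<otimes> m (\<delta> n v)) \<ominus> (f (\<delta> n v) \<ominus> x \<otimes> g v)"
      unfolding kf[OF v, symmetric] using xc cochains_carrier[OF M m d] cochains_carrier[OF M g v]
        cochains_carrier[OF M kC d] by algebra
    then show "x \<otimes> (g v \<ominus> m (\<delta> n v)) \<in> A" using idealD(7)[OF A e[OF d] fg[OF v]] by simp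
  qed
  then show ?thesis by (rule coboundaries_SucI[OF g m])
qed

lemma connecting_surjective:
  assumes g: "g \<in> cocycles M A (Suc n)"
  obtains f where "f \<in> cocycles M A' n" "\<And>v. v \<in> carrier (F (Suc n)) \<Longrightarrow> f (\<delta> n v) \<ominus> x \<otimes> g v \<in> A"
proof -
  obtain f where f: "f \<in> cochains M n" "\<And>v. v \<in> carrier (F (Suc n)) \<Longrightarrow> f (\<delta> n v) \<ominus> x \<otimes> g v \<in> A"
    using smult_cocycle_Suc[OF A M x g] by blast
  have gC: "g \<in> cochains M (Suc n)" using g by (simp add: cocycles_def)
  have "f (\<delta> n v) \<in> A'" if v: "v \<in> carrier (F (Suc n))" for v
  proof -
    have "f (\<delta> n v) = (f (\<delta> n v) \<ominus> x \<otimes> g v) \<oplus> x \<otimes> g v"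
      using cochains_carrier[OF M f(1) deltaD(1)[OF v]] cochains_carrier[OF M gC v] xc by algebra
    then show ?thesis unfolding add_multiples_def using f(2)[OF v] cochainsD(1)[OF gC v] by blast
  qed
  then have "f \<in> cocycles M A' n" using f(1) by (simp add: cocycles_def)
  with f(2) that show thesis by blast
qed

lemma vanishing_up:
  assumes "\<And>i. i < k \<Longrightarrow> cocycles M A' i \<subseteq> coboundaries M A' i" and "i < Suc k"
  shows "cocycles M A i \<subseteq> coboundaries M A i"
proof
  fix f assume f: "f \<in> cocycles M A i"
  have fC: "f \<in> cochains M i" using f by (simp add: cocycles_def)
  show "f \<in> coboundaries M A i"
  proof (cases i)
    case 0
    have "f v \<in> A" if "v \<in> carrier (F 0)" for v
      using that f fC 0 regular[OF cochainsD(1)[OF fC], of v] smult_cocycle_0[OF x, of f M A v] cochains_carrier[OF M fC] by (simp add: minus_eq)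
    then show ?thesis using fC 0 cochains_carrier[OF M fC] by (simp add: coboundaries_def differentials_def minus_eq)
  next
    case (Suc j)
    obtain g where g: "g \<in> cocycles M A' j" "\<And>v. v \<in> carrier (F (Suc j)) \<Longrightarrow> g (\<delta> j v) \<ominus> x \<otimes> f v \<in> A"
      using connecting_surjective f Suc by blast
    have "g \<in> coboundaries M A' j" using assms g(1) Suc by auto
    from connecting_preserves_coboundary[OF this _ g(2)] fC Suc show ?thesis by simp
  qed
qed

lemma vanishing_down:
  assumes "\<And>i. i < Suc k \<Longrightarrow> cocycles M A i \<subseteq> coboundaries M A i" and "i < k"
  shows "cocycles M A' i \<subseteq> coboundaries M A' i"
proof
  fix f assume f: "f \<in> cocycles M A' i"
  then have fC: "f \<in> cochains M i" by (simp add: cocycles_def)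
  obtain g where g: "g \<in> cocycles M A (Suc i)" "\<And>v. v \<in> carrier (F (Suc i)) \<Longrightarrow> f (\<delta> i v) \<ominus> x \<otimes> g v \<in> A"
    using connecting_exists[OF f] by blast
  have "g \<in> coboundaries M A (Suc i)" using assms(1)[of "Suc i"] assms(2) g(1) by auto
  then show "f \<in> coboundaries M A' i"
    using connecting_reflects_coboundary[OF fC _ g(2)] assms(1)[of i] assms(2) by simp
qed

end

subsection \<open>Lengths of cohomology modules\<close>

definition cohomology_length :: "'a set \<Rightarrow> 'a set \<Rightarrow> nat \<Rightarrow> enat" where
  "cohomology_length M A n = chain_length {N. submodule N R (cochain_module M n) \<and>
     coboundaries M A n \<subseteq> N \<and> N \<subseteq> cocycles M A n}"

lemma cocycles_submodule:
  assumes M: "ideal M R" and A: "ideal A R"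
  shows "submodule (cocycles M A n) R (cochain_module M n)"
proof -
  interpret C: module R "cochain_module M n" by (rule module_cochain_module[OF M])
  note cl = C.M.zero_closed C.M.a_closed C.smult_closed
  show ?thesis
    unfolding C.submodule_iff using cl[unfolded cochain_module_simps] idealD(2-4)[OF A] deltaD(1)[of _ n]
    by (auto simp: cocycles_def cochain_module_simps)
qed

lemma coboundaries_submodule:
  assumes M: "ideal M R" and A: "ideal A R"
  shows "submodule (coboundaries M A n) R (cochain_module M n)"
proof -
  let ?C = "cochain_module M n"
  interpret C: module R ?C by (rule module_cochain_module[OF M])
  have D: "\<zero>\<^bsub>?C\<^esub> \<in> differentials M n" "\<And>d d'. d \<in> differentials M n \<Longrightarrow> d' \<in> differentials M n \<Longrightarrow> d \<oplus>\<^bsub>?C\<^esub> d' \<in> differentials M n"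
    "\<And>r d. r \<in> carrier R \<Longrightarrow> d \<in> differentials M n \<Longrightarrow> r \<odot>\<^bsub>?C\<^esub> d \<in> differentials M n"
    using differentials_submodule[OF M, of n] unfolding C.submodule_iff by simp_all
  have cob: "f \<in> coboundaries M A n"
    if "f \<in> carrier ?C" "d \<in> differentials M n" "\<And>v. v \<in> carrier (F n) \<Longrightarrow> f v \<ominus> d v \<in> A" for f d
    using that by (auto simp: coboundaries_def cochain_module_simps)
  note fc = cochains_carrier[OF M] and dc = cochains_carrier[OF M differentialsD(1)[OF M]]
  show ?thesis
    unfolding C.submodule_iff
  proof (intro conjI ballI)
    show "coboundaries M A n \<subseteq> carrier ?C" by (auto simp: coboundaries_def cochain_module_simps)
    show "\<zero>\<^bsub>?C\<^esub> \<in> coboundaries M A n"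
      using idealD(2)[OF A] by (intro cob[OF C.M.zero_closed D(1)]) (simp add: cochain_module_simps minus_eq)
  next
    fix f g assume "f \<in> coboundaries M A n" "g \<in> coboundaries M A n"
    then obtain d d' where f: "f \<in> cochains M n" "d \<in> differentials M n" "\<And>v. v \<in> carrier (F n) \<Longrightarrow> f v \<ominus> d v \<in> A"
      and g: "g \<in> cochains M n" "d' \<in> differentials M n" "\<And>v. v \<in> carrier (F n) \<Longrightarrow> g v \<ominus> d' v \<in> A"
      by (auto simp: coboundaries_def)
    have "f v \<oplus> g v \<ominus> (d v \<oplus> d' v) \<in> A" if v: "v \<in> carrier (F n)" for v
    proof -
      have "f v \<oplus> g v \<ominus> (d v \<oplus> d' v) = (f v \<ominus> d v) \<oplus> (g v \<ominus> d' v)"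
        using fc[OF f(1) v] fc[OF g(1) v] dc[OF f(2) v] dc[OF g(2) v] by algebra
      then show ?thesis using idealD(3)[OF A f(3)[OF v] g(3)[OF v]] by simp
    qed
    then show "f \<oplus>\<^bsub>?C\<^esub> g \<in> coboundaries M A n"
      using f(1) g(1) by (intro cob[OF _ D(2)[OF f(2) g(2)]] C.M.a_closed) (simp_all add: cochain_module_simps)
  next
    fix r f assume r: "r \<in> carrier R" and "f \<in> coboundaries M A n"
    then obtain d where f: "f \<in> cochains M n" "d \<in> differentials M n" "\<And>v. v \<in> carrier (F n) \<Longrightarrow> f v \<ominus> d v \<in> A"
      by (auto simp: coboundaries_def)
    have "r \<otimes> f v \<ominus> r \<otimes> d v \<in> A" if v: "v \<in> carrier (F n)" for v
    proof -
      have "r \<otimes> f v \<ominus> r \<otimes> d v = r \<otimes> (f v \<ominus> d v)" using fc[OF f(1) v] dc[OF f(2) v] r by algebra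
      then show ?thesis using idealD(4)[OF A r f(3)[OF v]] by simp
    qed
    then show "r \<odot>\<^bsub>?C\<^esub> f \<in> coboundaries M A n"
      using f(1) r by (intro cob[OF _ D(3)[OF r f(2)]] C.smult_closed) (simp_all add: cochain_module_simps)
  qed
qed

lemma coboundaries_subset_cocycles:
  assumes M: "ideal M R"
  shows "coboundaries M A n \<subseteq> cocycles M A n"
proof
  fix f assume f: "f \<in> coboundaries M A n"
  obtain k where "k \<in> cochains M n" "\<And>v. v \<in> carrier (F n) \<Longrightarrow> k v \<in> A"
    "\<And>v. v \<in> carrier (F (Suc n)) \<Longrightarrow> k (\<delta> n v) = f (\<delta> n v)"
    using coboundary_normal_form[OF M f] by blast
  then have "\<forall>v\<in>carrier (F (Suc n)). f (\<delta> n v) \<in> A" using deltaD(1) by metis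
  with f show "f \<in> cocycles M A n" by (simp add: cocycles_def coboundaries_def)
qed

text \<open>The relation \<open>T\<close> below is the graph of the connecting homomorphism.\<close>
lemma cohomology_length_shift:
  assumes M: "ideal M R" and A: "ideal A R" and x: "x \<in> \<mm>"
    and regular: "\<And>v. v \<in> M \<Longrightarrow> x \<otimes> v \<in> A \<Longrightarrow> v \<in> A"
    and van: "cocycles M A n \<subseteq> coboundaries M A n"
  shows "cohomology_length M (add_multiples R A x M) n = cohomology_length M A (Suc n)"
proof -
  let ?A' = "add_multiples R A x M"
  have xc: "x \<in> carrier R" using idealD(1)[OF ideal_mm x] .
  have A': "ideal ?A' R" by (rule add_multiples_ideal(1)[OF A M xc])
  note sub = cocycles_submodule[OF M] coboundaries_submodule[OF M] coboundaries_subset_cocycles[OF M]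
  define T where "T = {(f, g). f \<in> cocycles M ?A' n \<and> g \<in> cocycles M A (Suc n) \<and>
    (\<forall>v\<in>carrier (F (Suc n)). f (\<delta> n v) \<ominus> x \<otimes> g v \<in> A)}"
  have TD: "f \<in> cochains M n" "g \<in> cochains M (Suc n)" "f \<in> cocycles M ?A' n" "g \<in> cocycles M A (Suc n)"
    "\<And>v. v \<in> carrier (F (Suc n)) \<Longrightarrow> f (\<delta> n v) \<ominus> x \<otimes> g v \<in> A" if "(f, g) \<in> T" for f g
    using that by (auto simp: T_def cocycles_def)
  have Tc: "f (\<delta> n v) \<in> carrier R" "g v \<in> carrier R" if "(f, g) \<in> T" "v \<in> carrier (F (Suc n))" for f g v
    using cochains_carrier[OF M TD(1)[OF that(1)] deltaD(1)[OF that(2)]]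
      cochains_carrier[OF M TD(2)[OF that(1)] that(2)] by auto
  have Z: "\<zero>\<^bsub>cochain_module M n\<^esub> \<in> cocycles M ?A' n" "\<zero>\<^bsub>cochain_module M (Suc n)\<^esub> \<in> cocycles M A (Suc n)"
    "\<And>f g. f \<in> cocycles M ?A' n \<Longrightarrow> g \<in> cocycles M ?A' n \<Longrightarrow> f \<oplus>\<^bsub>cochain_module M n\<^esub> g \<in> cocycles M ?A' n"
    "\<And>f g. f \<in> cocycles M A (Suc n) \<Longrightarrow> g \<in> cocycles M A (Suc n) \<Longrightarrow> f \<oplus>\<^bsub>cochain_module M (Suc n)\<^esub> g \<in> cocycles M A (Suc n)"
    "\<And>r f. r \<in> carrier R \<Longrightarrow> f \<in> cocycles M ?A' n \<Longrightarrow> r \<odot>\<^bsub>cochain_module M n\<^esub> f \<in> cocycles M ?A' n"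
    "\<And>r f. r \<in> carrier R \<Longrightarrow> f \<in> cocycles M A (Suc n) \<Longrightarrow> r \<odot>\<^bsub>cochain_module M (Suc n)\<^esub> f \<in> cocycles M A (Suc n)"
    using sub(1)[OF A', of n] sub(1)[OF A, of "Suc n"]
    unfolding module.submodule_iff[OF module_cochain_module[OF M]] by simp_all
  show ?thesis
    unfolding cohomology_length_def
  proof (rule chain_length_eq_of_correspondence[where T = T, OF module_cochain_module[OF M] module_cochain_module[OF M]
        sub(1)[OF A'] sub(1)[OF A] sub(2)[OF A'] sub(2)[OF A] sub(3) sub(3)])
    show "T \<subseteq> cocycles M ?A' n \<times> cocycles M A (Suc n)" by (auto simp: T_def)
    show "(\<zero>\<^bsub>cochain_module M n\<^esub>, \<zero>\<^bsub>cochain_module M (Suc n)\<^esub>) \<in> T"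
      unfolding T_def using Z(1,2) xc idealD(2)[OF A] deltaD(1)[of _ n] by (simp add: cochain_module_simps minus_eq)
  next
    fix f f' g g' assume T: "(f, f') \<in> T" "(g, g') \<in> T"
    have "(f (\<delta> n v) \<oplus> g (\<delta> n v)) \<ominus> x \<otimes> (f' v \<oplus> g' v) \<in> A" if v: "v \<in> carrier (F (Suc n))" for v
    proof -
      have "(f (\<delta> n v) \<oplus> g (\<delta> n v)) \<ominus> x \<otimes> (f' v \<oplus> g' v) = (f (\<delta> n v) \<ominus> x \<otimes> f' v) \<oplus> (g (\<delta> n v) \<ominus> x \<otimes> g' v)"
        using Tc[OF T(1) v] Tc[OF T(2) v] xc by algebra
      then show ?thesis using idealD(3)[OF A TD(5)[OF T(1) v] TD(5)[OF T(2) v]] by simp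
    qed
    then show "(f \<oplus>\<^bsub>cochain_module M n\<^esub> g, f' \<oplus>\<^bsub>cochain_module M (Suc n)\<^esub> g') \<in> T"
      unfolding T_def using Z(3)[OF TD(3)[OF T(1)] TD(3)[OF T(2)]] Z(4)[OF TD(4)[OF T(1)] TD(4)[OF T(2)]] deltaD(1)[of _ n]
      by (simp add: cochain_module_simps)
  next
    fix r f f' assume r: "r \<in> carrier R" and T: "(f, f') \<in> T"
    have "r \<otimes> f (\<delta> n v) \<ominus> x \<otimes> (r \<otimes> f' v) \<in> A" if v: "v \<in> carrier (F (Suc n))" for v
    proof -
      have "r \<otimes> f (\<delta> n v) \<ominus> x \<otimes> (r \<otimes> f' v) = r \<otimes> (f (\<delta> n v) \<ominus> x \<otimes> f' v)"
        using Tc[OF T v] xc r by algebra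
      then show ?thesis using idealD(4)[OF A r TD(5)[OF T v]] by simp
    qed
    then show "(r \<odot>\<^bsub>cochain_module M n\<^esub> f, r \<odot>\<^bsub>cochain_module M (Suc n)\<^esub> f') \<in> T"
      unfolding T_def using Z(5)[OF r TD(3)[OF T]] Z(6)[OF r TD(4)[OF T]] deltaD(1)[of _ n]
      by (simp add: cochain_module_simps)
  next
    fix f assume f: "f \<in> cocycles M ?A' n"
    show "\<exists>g. (f, g) \<in> T"
    proof (rule connecting_exists[OF M A x regular f])
      fix g assume "g \<in> cocycles M A (Suc n)" "\<And>v. v \<in> carrier (F (Suc n)) \<Longrightarrow> f (\<delta> n v) \<ominus> x \<otimes> g v \<in> A"
      then show ?thesis using f unfolding T_def by auto
    qed
  next
    fix g assume g: "g \<in> cocycles M A (Suc n)"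
    show "\<exists>f. (f, g) \<in> T"
    proof (rule connecting_surjective[OF M A x regular g])
      fix f assume "f \<in> cocycles M ?A' n" "\<And>v. v \<in> carrier (F (Suc n)) \<Longrightarrow> f (\<delta> n v) \<ominus> x \<otimes> g v \<in> A"
      then show ?thesis using g unfolding T_def by auto
    qed
  next
    fix f g assume T: "(f, g) \<in> T"
    show "f \<in> coboundaries M ?A' n \<longleftrightarrow> g \<in> coboundaries M A (Suc n)"
      using connecting_preserves_coboundary[OF M A x regular _ TD(2)[OF T] TD(5)[OF T]]
        connecting_reflects_coboundary[OF M A x regular TD(1)[OF T] _ TD(5)[OF T] van] by blast
  qed
qed

text \<open>The class of \<open>f\<close> in \<open>H\<^sup>0\<close> is determined by \<open>f e\<close>; conversely \<open>v \<mapsto> \<gamma> v \<otimes> u\<close> is a cocycle if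
  \<open>\<mm>\<close> annihilates the class of \<open>u\<close>.\<close>
lemma cohomology_length_0:
  assumes M: "ideal M R" and A: "ideal A R" and AM: "A \<subseteq> M"
  shows "cohomology_length M A 0
    = chain_length {N. ideal N R \<and> A \<subseteq> N \<and> N \<subseteq> {u \<in> M. \<forall>x\<in>\<mm>. x \<otimes> u \<in> A}}"
    and "cocycles M A 0 \<subseteq> coboundaries M A 0 \<Longrightarrow> u \<in> M \<Longrightarrow> (\<And>x. x \<in> \<mm> \<Longrightarrow> x \<otimes> u \<in> A) \<Longrightarrow> u \<in> A"
proof -
  interpret F: module R "F 0" by (rule module_free_module)
  define soc where "soc = {u \<in> M. \<forall>x\<in>\<mm>. x \<otimes> u \<in> A}"
  note MD = idealD[OF M] and AD = idealD[OF A] and mD = idealD[OF ideal_mm]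
  have soc_ideal: "ideal soc R"
    unfolding ideal_iff soc_def using MD(1-4) AD(2-4) mD(1) by (auto simp: r_distr m_lcomm)
  have A_soc: "A \<subseteq> soc" unfolding soc_def using AM AD(4) mD(1) by auto
  note sD = idealD[OF soc_ideal]
  define T where "T = {(f, u). f \<in> cocycles M A 0 \<and> u \<in> soc \<and> f e \<ominus> u \<in> A}"
  have TD: "f \<in> cocycles M A 0" "f \<in> cochains M 0" "u \<in> soc" "f e \<ominus> u \<in> A" "f e \<in> carrier R" "u \<in> carrier R"
    if "(f, u) \<in> T" for f u
    using that cochains_carrier[OF M _ e(1)] sD(1) by (auto simp: T_def cocycles_def)
  have total: "\<exists>f. (f, u) \<in> T" if u: "u \<in> soc" for u
  proof -
    have uc: "u \<in> carrier R" "u \<in> M" using u MD(1) by (auto simp: soc_def)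
    let ?f = "\<lambda>v\<in>carrier (F 0). \<gamma> v \<otimes> u"
    have "?f \<in> cochains M 0"
      unfolding cochains_def using gammaD MD(4) uc
      by (intro module_hom_restrictI[OF module_free_module]) (simp_all add: self_module_def l_distr m_assoc)
    moreover have "?f (\<delta> 0 v) \<in> A" if v: "v \<in> carrier (F (Suc 0))" for v
      using u delta_image_0 v by (auto simp: soc_def)
    moreover have "\<gamma> e \<otimes> u \<ominus> u = (\<gamma> e \<ominus> \<one>) \<otimes> u" using gammaD(1)[OF e(1)] uc(1) by algebra
    then have "?f e \<ominus> u \<in> A" using u e by (simp add: soc_def)
    ultimately have "(?f, u) \<in> T" using u by (simp add: T_def cocycles_def)
    then show ?thesis by blast
  qed
  have TB: "f \<in> coboundaries M A 0 \<longleftrightarrow> u \<in> A" if T: "(f, u) \<in> T" for f u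
  proof
    note t = TD[OF T]
    assume "f \<in> coboundaries M A 0"
    then have "f e \<in> A" using e(1) t(5) by (auto simp: coboundaries_def differentials_def minus_eq)
    then have "f e \<ominus> (f e \<ominus> u) \<in> A" using t(4) by (rule AD(7))
    moreover have "f e \<ominus> (f e \<ominus> u) = u" using t(5,6) by algebra
    ultimately show "u \<in> A" by simp
  next
    note t = TD[OF T]
    assume "u \<in> A"
    with t(4) have "(f e \<ominus> u) \<oplus> u \<in> A" by (rule AD(3))
    moreover have "(f e \<ominus> u) \<oplus> u = f e" using t(5,6) by algebra
    ultimately have fe: "f e \<in> A" by simp
    have "f v \<in> A" if v: "v \<in> carrier (F 0)" for v
    proof -
      let ?c = "\<gamma> v" and ?w = "v \<oplus>\<^bsub>F 0\<^esub> (\<ominus> \<gamma> v) \<odot>\<^bsub>F 0\<^esub> e"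
      have c: "?c \<in> carrier R" "\<gamma> e \<in> carrier R" using gammaD(1) v e(1) by simp_all
      have ce: "(\<ominus> ?c) \<odot>\<^bsub>F 0\<^esub> e \<in> carrier (F 0)" using c e(1) by simp
      have "\<gamma> ?w = (\<ominus> ?c) \<otimes> (\<gamma> e \<ominus> \<one>)"
        unfolding gammaD(2)[OF v ce] gammaD(3)[OF a_inv_closed[OF c(1)] e(1)] using c by algebra
      then have "?w \<in> \<delta> 0 ` carrier (F (Suc 0))"
        unfolding delta_image_0 using mD(4)[OF _ e(2)] c v ce by simp
      then have "f ?w \<in> A" using t(1) by (auto simp: cocycles_def)
      then have "(f v \<oplus> (\<ominus> ?c) \<otimes> f e) \<oplus> ?c \<otimes> f e \<in> A"
        unfolding cochainsD(2)[OF t(2) v ce] cochainsD(3)[OF t(2) a_inv_closed[OF c(1)] e(1)]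
        by (rule AD(3)[OF _ AD(4)[OF c(1) fe]])
      moreover have "(f v \<oplus> (\<ominus> ?c) \<otimes> f e) \<oplus> ?c \<otimes> f e = f v"
        using cochains_carrier[OF M t(2) v] c(1) t(5) by algebra
      ultimately show ?thesis by simp
    qed
    then show "f \<in> coboundaries M A 0"
      using t(2) cochains_carrier[OF M t(2)] by (simp add: coboundaries_def differentials_def minus_eq)
  qed
  show "u \<in> A" if "cocycles M A 0 \<subseteq> coboundaries M A 0" "u \<in> M" "\<And>x. x \<in> \<mm> \<Longrightarrow> x \<otimes> u \<in> A"
  proof -
    have "u \<in> soc" using that(2,3) by (simp add: soc_def)
    then obtain f where f: "(f, u) \<in> T" using total by blast
    then show ?thesis using TB[OF f] TD(1)[OF f] that(1) by auto
  qed
  note sub = cocycles_submodule[OF M A, of 0] coboundaries_submodule[OF M A, of 0] coboundaries_subset_cocycles[OF M, of A 0]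
  have Z: "\<zero>\<^bsub>cochain_module M 0\<^esub> \<in> cocycles M A 0"
    "\<And>f g. f \<in> cocycles M A 0 \<Longrightarrow> g \<in> cocycles M A 0 \<Longrightarrow> f \<oplus>\<^bsub>cochain_module M 0\<^esub> g \<in> cocycles M A 0"
    "\<And>r f. r \<in> carrier R \<Longrightarrow> f \<in> cocycles M A 0 \<Longrightarrow> r \<odot>\<^bsub>cochain_module M 0\<^esub> f \<in> cocycles M A 0"
    using sub(1) unfolding module.submodule_iff[OF module_cochain_module[OF M]] by simp_all
  have "chain_length {N. submodule N R (cochain_module M 0) \<and> coboundaries M A 0 \<subseteq> N \<and> N \<subseteq> cocycles M A 0}
    = chain_length {N. submodule N R (self_module R) \<and> A \<subseteq> N \<and> N \<subseteq> soc}"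
  proof (rule chain_length_eq_of_correspondence[where T = T, OF module_cochain_module[OF M] module_self_module
        sub(1) _ sub(2) _ sub(3) A_soc])
    show "submodule soc R (self_module R)" "submodule A R (self_module R)"
      using soc_ideal A submodule_self_module_iff by simp_all
    show "T \<subseteq> cocycles M A 0 \<times> soc" by (auto simp: T_def)
    show "(\<zero>\<^bsub>cochain_module M 0\<^esub>, \<zero>\<^bsub>self_module R\<^esub>) \<in> T"
      unfolding T_def using Z(1) e(1) AD(2) sD(2)
      unfolding cochain_module_simps by (simp add: self_module_def minus_eq)
  next
    fix f u g v assume T: "(f, u) \<in> T" "(g, v) \<in> T"
    have "f e \<oplus> g e \<ominus> (u \<oplus> v) = (f e \<ominus> u) \<oplus> (g e \<ominus> v)" using TD(5,6)[OF T(1)] TD(5,6)[OF T(2)] by algebra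
    then have "f e \<oplus> g e \<ominus> (u \<oplus> v) \<in> A" using AD(3)[OF TD(4)[OF T(1)] TD(4)[OF T(2)]] by simp
    then show "(f \<oplus>\<^bsub>cochain_module M 0\<^esub> g, u \<oplus>\<^bsub>self_module R\<^esub> v) \<in> T"
      unfolding cochain_module_simps
      using T Z(2)[unfolded cochain_module_simps] sD(3) e(1) by (simp add: T_def self_module_def)
  next
    fix r f u assume r: "r \<in> carrier R" and T: "(f, u) \<in> T"
    have "r \<otimes> f e \<ominus> r \<otimes> u = r \<otimes> (f e \<ominus> u)" using TD(5,6)[OF T] r by algebra
    then have "r \<otimes> f e \<ominus> r \<otimes> u \<in> A" using AD(4)[OF r TD(4)[OF T]] by simp
    then show "(r \<odot>\<^bsub>cochain_module M 0\<^esub> f, r \<odot>\<^bsub>self_module R\<^esub> u) \<in> T"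
      unfolding cochain_module_simps
      using T r Z(3)[unfolded cochain_module_simps] sD(4) e(1) by (simp add: T_def self_module_def)
  next
    fix f assume f: "f \<in> cocycles M A 0"
    then have fC: "f \<in> cochains M 0" by (simp add: cocycles_def)
    have "f e \<in> soc" using cochainsD(1)[OF fC e(1)] smult_cocycle_0[OF _ f e(1)] by (simp add: soc_def)
    moreover have "f e \<ominus> f e \<in> A" using cochains_carrier[OF M fC e(1)] AD(2) by (simp add: minus_eq r_neg)
    ultimately show "\<exists>u. (f, u) \<in> T" using f by (auto simp: T_def)
  qed (use total TB in auto)
  then show "cohomology_length M A 0
    = chain_length {N. ideal N R \<and> A \<subseteq> N \<and> N \<subseteq> {u \<in> M. \<forall>x\<in>\<mm>. x \<otimes> u \<in> A}}"
    unfolding cohomology_length_def submodule_self_module_iff soc_def .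
qed

end


section \<open>Regular sequences, depth and dimension\<close>

text \<open>A regular sequence \<open>x\<close> on \<open>M/(A 0)\<close>, presented together with the ideals
  \<open>A j = A 0 + (x 0, \<dots>, x (j - 1))M\<close>; all steps of an induction along it then have the same form.\<close>
definition regular_chain ::
    "('a, 'r) ring_scheme \<Rightarrow> 'a set \<Rightarrow> 'a set \<Rightarrow> (nat \<Rightarrow> 'a set) \<Rightarrow> (nat \<Rightarrow> 'a) \<Rightarrow> nat \<Rightarrow> bool" where
  "regular_chain R \<mm> M A x d \<longleftrightarrow> ideal M R \<and> ideal (A 0) R \<and> A 0 \<subseteq> M \<and>
     (\<forall>j<d. x j \<in> \<mm> \<and> A (Suc j) = add_multiples R (A j) (x j) M \<and>
        (\<forall>v\<in>M. x j \<otimes>\<^bsub>R\<^esub> v \<in> A j \<longrightarrow> v \<in> A j))"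

context noetherian_local_ring
begin

lemma regular_chainD:
  assumes "regular_chain R \<mm> M A x d"
  shows "ideal M R" "j < d \<Longrightarrow> x j \<in> \<mm>" "j < d \<Longrightarrow> A (Suc j) = add_multiples R (A j) (x j) M"
    "j < d \<Longrightarrow> v \<in> M \<Longrightarrow> x j \<otimes> v \<in> A j \<Longrightarrow> v \<in> A j"
  using assms unfolding regular_chain_def by simp_all

lemma regular_chain_ideal:
  assumes "regular_chain R \<mm> M A x d" "j \<le> d"
  shows "ideal (A j) R \<and> A j \<subseteq> M"
  using assms(2)
proof (induction j)
  case 0 then show ?case using assms(1) unfolding regular_chain_def by simp
next
  case (Suc j)
  note D = regular_chainD[OF assms(1)]
  have j: "j < d" using Suc by simp
  have "x j \<in> carrier R" using idealD(1)[OF ideal_mm D(2)[OF j]] .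
  then show ?case
    unfolding D(3)[OF j] using Suc add_multiples_ideal(1)[OF _ D(1)] add_multiples_subset[OF D(1)] by simp
qed

lemma regular_chain_initial:
  "regular_chain R \<mm> M A x d \<Longrightarrow> j \<le> d \<Longrightarrow> regular_chain R \<mm> M A x j"
  unfolding regular_chain_def by simp

lemma regular_sequence_iff:
  assumes M: "ideal M R"
  shows "regular_sequence R (self_module R\<lparr>carrier := M\<rparr>) xs \<longleftrightarrow> set xs \<subseteq> carrier R \<and>
     (\<forall>i<length xs. \<forall>v\<in>M. xs ! i \<otimes> v \<in> times_ideal R (set (take i xs)) M \<longrightarrow>
        v \<in> times_ideal R (set (take i xs)) M) \<and> times_ideal R (set xs) M \<noteq> M"
proof (cases "set xs \<subseteq> carrier R")
  case True
  then have "ideal_times R (set (take i xs)) (self_module R\<lparr>carrier := M\<rparr>) = times_ideal R (set (take i xs)) M" for i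
    using set_take_subset[of i xs] by (intro ideal_times_self_module[OF M]) blast
  with ideal_times_self_module[OF M True] show ?thesis
    unfolding regular_sequence_def by (simp add: self_module_def)
qed (simp add: regular_sequence_def)

lemma regular_chain_of_sequence:
  assumes M: "ideal M R" and xs: "set xs \<subseteq> \<mm>" and len: "d \<le> length xs"
    and reg: "\<And>j v. j < d \<Longrightarrow> v \<in> M \<Longrightarrow> xs ! j \<otimes> v \<in> times_ideal R (set (take j xs)) M \<Longrightarrow>
      v \<in> times_ideal R (set (take j xs)) M"
  shows "regular_chain R \<mm> M (\<lambda>j. times_ideal R (set (take j xs)) M) (\<lambda>j. xs ! j) d"
  unfolding regular_chain_def
proof (intro conjI allI impI ballI)
  have xsc: "set xs \<subseteq> carrier R" using xs idealD(1)[OF ideal_mm] by blast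
  show "ideal M R" by (rule M)
  show "ideal (times_ideal R (set (take 0 xs)) M) R" using times_ideal_empty[OF M] zeroideal by simp
  show "times_ideal R (set (take 0 xs)) M \<subseteq> M" using times_ideal_empty[OF M] idealD(2)[OF M] by simp
  fix j assume j: "j < d"
  show "xs ! j \<in> \<mm>" using xs j len by auto
  have "set (take (Suc j) xs) = insert (xs ! j) (set (take j xs))"
    using j len by (simp add: take_Suc_conv_app_nth)
  moreover have "set (take j xs) \<subseteq> carrier R" using xsc set_take_subset[of j xs] by blast
  moreover have "xs ! j \<in> carrier R" using xsc j len by auto
  ultimately show "times_ideal R (set (take (Suc j) xs)) M
      = add_multiples R (times_ideal R (set (take j xs)) M) (xs ! j) M"
    using times_ideal_insert[OF M] by simp
qed (rule reg)

text \<open>The height bound for regular sequences: as \<open>x j\<close> is regular modulo \<open>A j\<close>, a prime above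
  \<open>A (j + 1)\<close> contains a strictly smaller one above \<open>A j\<close>.\<close>
lemma chain_below_prime:
  assumes chain: "regular_chain R \<mm> (carrier R) A x d" and A0: "A 0 = {\<zero>}"
    and "j \<le> d" "primeideal P R" "\<And>i. i < j \<Longrightarrow> x i \<in> P"
  shows "chain_to {P. primeideal P R} j P"
proof -
  note D = regular_chainD[OF chain]
  have sub: "A j \<subseteq> P" if "j \<le> d" "primeideal P R" "\<And>i. i < j \<Longrightarrow> x i \<in> P" for j P
    using that(1,3)
  proof (induction j)
    case 0 then show ?case using A0 that(2) idealD(2)[of P] by (simp add: primeideal_def)
  next
    case (Suc j)
    have "ideal P R" using that(2) by (simp add: primeideal_def)
    with Suc D(3)[of j] show ?case
      unfolding add_multiples_def using idealD(3,5)[of P] by auto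
  qed
  show ?thesis using assms(3-5)
  proof (induction j arbitrary: P)
    case 0 then show ?case by (intro chain_to_0) simp
  next
    case (Suc j)
    have j: "j < d" using Suc by simp
    obtain P' where P': "primeideal P' R" "A j \<subseteq> P'" "P' \<subset> P"
    proof (rule exists_smaller_prime[of "A j" P "x j"])
      show "ideal (A j) R" using regular_chain_ideal[OF chain, of j] j by simp
      show "A j \<subseteq> P" using sub[of j P] Suc by simp
      show "\<And>r. r \<in> carrier R \<Longrightarrow> x j \<otimes> r \<in> A j \<Longrightarrow> r \<in> A j" using D(4)[OF j] .
    qed (use Suc in auto)
    have "x i \<in> P'" if i: "i < j" for i
    proof -
      have "x i \<in> A (Suc i)"
        using D(3)[of i] i j add_multiples_ideal(3)[of "A i" "carrier R" "x i" \<one>]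
          regular_chain_ideal[OF chain, of i] D(1) idealD(1)[OF ideal_mm D(2)[of i]] by simp
      moreover have "k \<le> d \<Longrightarrow> Suc i \<le> k \<Longrightarrow> A (Suc i) \<subseteq> A k" for k
      proof (induction k)
        case (Suc k)
        have "A k \<subseteq> A (Suc k)"
          using D(3)[of k] Suc.prems add_multiples_ideal(2)[of "A k" "carrier R" "x k"]
            regular_chain_ideal[OF chain, of k] D(1) idealD(1)[OF ideal_mm D(2)[of k]] by simp
        with Suc show ?case by (auto simp: le_Suc_eq)
      qed simp
      ultimately have "x i \<in> A j" using i j by (meson Suc_leI less_imp_le subsetD)
      then show ?thesis using P'(2) by blast
    qed
    then have "chain_to {P. primeideal P R} j P'" using Suc.IH[of P'] P'(1) j by simp
    then show ?case using P'(3) Suc.prems(2) by (intro chain_to_Suc) simp_all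
  qed
qed

end

context resolved_residue_field
begin

text \<open>Vanishing of cohomology in degrees below \<open>d\<close> is what a regular sequence of length \<open>d\<close> on \<open>M\<close>
  forces, and it passes to the quotients by any other regular sequence. This makes the depth
  independent of the sequence by which it is measured.\<close>
lemma vanishing_of_regular_chain:
  assumes chain: "regular_chain R \<mm> M A x d"
  shows "j \<le> d \<Longrightarrow> i < d - j \<Longrightarrow> cocycles M (A j) i \<subseteq> coboundaries M (A j) i"
proof (induction j arbitrary: i rule: inc_induct)
  case base then show ?case by simp
next
  case (step j)
  note D = regular_chainD[OF chain]
  have A: "ideal (A j) R" using regular_chain_ideal[OF chain, of j] step by simp
  show ?case
  proof (rule vanishing_up[OF D(1) A D(2)[OF step(2)] D(4)[OF step(2)]])
    show "\<And>i. i < d - Suc j \<Longrightarrow> cocycles M (add_multiples R (A j) (x j) M) i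
        \<subseteq> coboundaries M (add_multiples R (A j) (x j) M) i"
      using step.IH unfolding D(3)[OF step(2)] .
    show "i < Suc (d - Suc j)" using step by simp
  qed
qed

lemma vanishing_along_regular_chain:
  assumes chain: "regular_chain R \<mm> M A x j" and "j \<le> d"
    and "\<And>i. i < d \<Longrightarrow> cocycles M (A 0) i \<subseteq> coboundaries M (A 0) i"
  shows "i < d - j \<Longrightarrow> cocycles M (A j) i \<subseteq> coboundaries M (A j) i"
  using assms(1,2)
proof (induction j arbitrary: i)
  case 0 then show ?case using assms(3) by simp
next
  case (Suc j)
  note D = regular_chainD[OF Suc.prems(2)]
  have A: "ideal (A j) R" using regular_chain_ideal[OF Suc.prems(2), of j] by simp
  have IH: "\<And>i. i < Suc (d - Suc j) \<Longrightarrow> cocycles M (A j) i \<subseteq> coboundaries M (A j) i"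
    using Suc.IH regular_chain_initial[OF Suc.prems(2), of j] Suc.prems(3) by simp
  show ?case
    unfolding D(3)[OF lessI]
    by (rule vanishing_down[OF D(1) A D(2)[OF lessI] D(4)[OF lessI] IH Suc.prems(1)])
qed

lemma cohomology_length_regular_chain:
  assumes chain: "regular_chain R \<mm> M A x d"
  shows "cohomology_length M (A 0) d
    = chain_length {N. ideal N R \<and> A d \<subseteq> N \<and> N \<subseteq> {u \<in> M. \<forall>x\<in>\<mm>. x \<otimes> u \<in> A d}}"
proof -
  note D = regular_chainD[OF chain]
  have "j \<le> d \<Longrightarrow> cohomology_length M (A 0) d = cohomology_length M (A j) (d - j)" for j
  proof (induction j)
    case (Suc j)
    have j: "j < d" using Suc by simp
    have A: "ideal (A j) R" using regular_chain_ideal[OF chain, of j] j by simp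
    have "cohomology_length M (A (Suc j)) (d - Suc j) = cohomology_length M (A j) (Suc (d - Suc j))"
      unfolding D(3)[OF j]
    proof (rule cohomology_length_shift[OF D(1) A D(2)[OF j] D(4)[OF j]])
      show "cocycles M (A j) (d - Suc j) \<subseteq> coboundaries M (A j) (d - Suc j)"
        using j by (intro vanishing_of_regular_chain[OF chain]) simp_all
    qed
    then show ?case using Suc j by (simp add: Suc_diff_Suc)
  qed simp
  from this[of d] show ?thesis
    using cohomology_length_0(1)[OF D(1)] regular_chain_ideal[OF chain, of d] by simp
qed

text \<open>An associated prime \<open>P\<close> of \<open>M/A\<close> has \<open>dim (R/P) \<ge> k\<close> if the cohomology of \<open>M/A\<close> vanishes
  below \<open>k\<close>: for a regular \<open>z\<close> on \<open>M/A\<close>, some associated prime of \<open>M/(A + zM)\<close> lies strictly above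
  \<open>P\<close>, because by Nakayama the submodule annihilated by \<open>P\<close> is not contained in \<open>A + zM\<close>.\<close>
lemma chain_above_associated_prime:
  assumes "ideal M R" "ideal A R" "A \<subseteq> M"
    and "\<And>i. i < k \<Longrightarrow> cocycles M A i \<subseteq> coboundaries M A i"
    and "u \<in> M" "u \<notin> A" "primeideal (annih_mod R A u) R"
    and "chain_to {P. primeideal P R} n (annih_mod R A u)"
  shows "\<exists>Q. chain_to {P. primeideal P R} (n + k) Q"
  using assms
proof (induction k arbitrary: A u n)
  case 0 then show ?case by auto
next
  case (Suc k)
  note M = Suc.prems(1) and A = Suc.prems(2) and AM = Suc.prems(3)
  let ?P = "annih_mod R A u"
  have idP: "ideal ?P R" using Suc.prems(7) by (simp add: primeideal_def)
  obtain z where z: "z \<in> \<mm>" "\<And>v. v \<in> M \<Longrightarrow> z \<otimes> v \<in> A \<Longrightarrow> v \<in> A"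
  proof (rule exists_regular_element[OF A M])
    show "u \<in> A" if "u \<in> M" "\<And>x. x \<in> \<mm> \<Longrightarrow> x \<otimes> u \<in> A" for u
      by (rule cohomology_length_0(2)[OF M A AM Suc.prems(4)[OF zero_less_Suc] that])
  next
    fix z assume "z \<in> \<mm>" "\<And>v. v \<in> M \<Longrightarrow> z \<otimes> v \<in> A \<Longrightarrow> v \<in> A"
    then show thesis using that by simp
  qed
  have zc: "z \<in> carrier R" using idealD(1)[OF ideal_mm z(1)] .
  let ?A' = "add_multiples R A z M"
  have A': "ideal ?A' R" "?A' \<subseteq> M" "A \<subseteq> ?A'"
    using add_multiples_ideal(1,2)[OF A M zc] add_multiples_subset[OF M AM zc] by auto
  have van: "\<And>i. i < k \<Longrightarrow> cocycles M ?A' i \<subseteq> coboundaries M ?A' i"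
    by (rule vanishing_down[OF M A z(1,2) Suc.prems(4)])
  define N where "N = {v \<in> M. \<forall>r\<in>?P. r \<otimes> v \<in> A}"
  have N: "ideal N R"
  proof -
    have "r \<otimes> (v \<oplus> w) \<in> A" if "v \<in> N" "w \<in> N" "r \<in> ?P" for v w r
      using that idealD(3)[OF A] idealD(1)[OF M] idealD(1)[OF idP] by (simp add: N_def r_distr)
    moreover have "r \<otimes> (s \<otimes> v) \<in> A" if "v \<in> N" "s \<in> carrier R" "r \<in> ?P" for v s r
    proof -
      have "r \<otimes> (s \<otimes> v) = s \<otimes> (r \<otimes> v)"
        using that idealD(1)[OF M] idealD(1)[OF idP] by (simp add: N_def m_lcomm)
      then show ?thesis using that idealD(4)[OF A] by (simp add: N_def)
    qed
    moreover have "r \<otimes> \<zero> \<in> A" if "r \<in> ?P" for r using idealD(2)[OF A] idealD(1)[OF idP that] by simp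
    ultimately show ?thesis
      unfolding ideal_iff using idealD[OF M] by (auto simp: N_def)
  qed
  have AN: "A \<subseteq> N" unfolding N_def using AM idealD(4)[OF A] idealD(1)[OF idP] by auto
  have uN: "u \<in> N" unfolding N_def using Suc.prems(5) by (simp add: annih_mod_def)
  obtain w where w: "w \<in> N" "w \<notin> ?A'"
  proof (rule ccontr)
    assume "\<not> thesis"
    then have NA': "N \<subseteq> ?A'" using that by blast
    have "N \<subseteq> add_multiples R A z N"
    proof
      fix v assume v: "v \<in> N"
      then obtain a m where am: "a \<in> A" "m \<in> M" "v = a \<oplus> z \<otimes> m"
        using NA' unfolding add_multiples_def by blast
      have c: "a \<in> carrier R" "m \<in> carrier R" using am idealD(1)[OF A] idealD(1)[OF M] by auto
      have "r \<otimes> m \<in> A" if r: "r \<in> ?P" for r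
      proof (rule z(2))
        have rc: "r \<in> carrier R" using idealD(1)[OF idP r] .
        show "r \<otimes> m \<in> M" using idealD(4)[OF M rc am(2)] .
        have "r \<otimes> v \<ominus> r \<otimes> a \<in> A"
          using v r idealD(7)[OF A _ idealD(4)[OF A rc am(1)]] by (simp add: N_def)
        moreover have "r \<otimes> v \<ominus> r \<otimes> a = z \<otimes> (r \<otimes> m)"
          unfolding am(3) using c rc zc by algebra
        ultimately show "z \<otimes> (r \<otimes> m) \<in> A" by simp
      qed
      then have "m \<in> N" using am(2) by (simp add: N_def)
      with am show "v \<in> add_multiples R A z N" unfolding add_multiples_def by blast
    qed
    from nakayama[OF A N AN z(1) this] uN Suc.prems(6) show False by blast
  qed
  have wM: "w \<in> M" using w by (simp add: N_def)
  obtain u' where u': "u' \<in> M" "u' \<notin> ?A'" "primeideal (annih_mod R ?A' u') R"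
    "annih_mod R ?A' w \<subseteq> annih_mod R ?A' u'"
    using exists_associated_prime[OF A'(1) M wM w(2)] by blast
  have "?P \<subseteq> annih_mod R ?A' w"
  proof
    fix r assume r: "r \<in> ?P"
    then have "r \<otimes> w \<in> A" using w(1) by (simp add: N_def)
    then show "r \<in> annih_mod R ?A' w" using A'(3) idealD(1)[OF idP r] unfolding annih_mod_def by blast
  qed
  moreover have "z \<in> annih_mod R ?A' w"
    using zc add_multiples_ideal(3)[OF A M zc wM] by (simp add: annih_mod_def)
  moreover have "z \<notin> ?P" using z(2)[OF Suc.prems(5)] Suc.prems(6) by (auto simp: annih_mod_def)
  ultimately have "?P \<subset> annih_mod R ?A' u'" using u'(4) by blast
  then have "chain_to {P. primeideal P R} (Suc n) (annih_mod R ?A' u')"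
    using u'(3) by (intro chain_to_Suc[OF Suc.prems(8)]) simp_all
  from Suc.IH[OF M A'(1,2) van u'(1,2,3) this] show ?case by simp
qed

text \<open>Hence the zerodivisors on \<open>M/(x 0, \<dots>, x (j - 1))M\<close> contain no further member of an
  \<open>R\<close>-regular sequence: an associated prime containing it would have height at least \<open>j + 1\<close> and
  coheight at least \<open>d - j\<close>.\<close>
lemma regular_sequence_on_ideal:
  assumes M: "ideal M R" and xs: "set xs \<subseteq> \<mm>" and d: "length xs = d" "krull_dim R = enat d"
    and reg: "regular_sequence R (self_module R) xs"
    and van: "\<And>i. i < d \<Longrightarrow> cocycles M {\<zero>} i \<subseteq> coboundaries M {\<zero>} i"
  shows "regular_chain R \<mm> M (\<lambda>j. times_ideal R (set (take j xs)) M) (\<lambda>j. xs ! j) d"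
proof -
  have self: "self_module R\<lparr>carrier := carrier R\<rparr> = self_module R" by (simp add: self_module_def)
  have xsc: "set xs \<subseteq> carrier R" using xs idealD(1)[OF ideal_mm] by blast
  let ?A = "\<lambda>M j. times_ideal R (set (take j xs)) M"
  have chain: "regular_chain R \<mm> (carrier R) (?A (carrier R)) (\<lambda>j. xs ! j) d"
    using reg d(1) regular_sequence_iff[OF oneideal, of xs] unfolding self
    by (intro regular_chain_of_sequence[OF oneideal xs]) simp_all
  have A0: "?A N 0 = {\<zero>}" if "ideal N R" for N using times_ideal_empty[OF that] by simp
  have "\<forall>v\<in>M. xs ! j \<otimes> v \<in> ?A M j \<longrightarrow> v \<in> ?A M j" if "j < d" for j
    using that
  proof (induction j rule: less_induct)
    case (less j)
    have ch: "regular_chain R \<mm> M (?A M) (\<lambda>j. xs ! j) j"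
      using less by (intro regular_chain_of_sequence[OF M xs]) (use d in auto)
    have A: "ideal (?A M j) R" "?A M j \<subseteq> M" using regular_chain_ideal[OF ch, of j] by auto
    show ?case
    proof (intro ballI impI)
      fix v assume v: "v \<in> M" "xs ! j \<otimes> v \<in> ?A M j"
      show "v \<in> ?A M j"
      proof (rule ccontr)
        assume "v \<notin> ?A M j"
        from exists_associated_prime[OF A(1) M v(1) this] obtain u where
          u: "u \<in> M" "u \<notin> ?A M j" "primeideal (annih_mod R (?A M j) u) R"
            "annih_mod R (?A M j) v \<subseteq> annih_mod R (?A M j) u" .
        have "xs ! i \<in> annih_mod R (?A M j) u" if "i < Suc j" for i
        proof (cases "i = j")
          case True
          have "xs ! j \<in> carrier R" using less.prems xsc d by auto
          then have "xs ! j \<in> annih_mod R (?A M j) v" using v by (simp add: annih_mod_def)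
          with u(4) True show ?thesis by blast
        next
          case False
          then have "i < j" using that by simp
          then have "take j xs ! i \<in> set (take j xs)" "take j xs ! i = xs ! i"
            using less.prems d nth_mem[of i "take j xs"] by simp_all
          then have "xs ! i \<in> set (take j xs)" by simp
          moreover have "set (take j xs) \<subseteq> carrier R" using xsc set_take_subset[of j xs] by blast
          ultimately show ?thesis using times_ideal_mem[OF M _ _ u(1)] by (auto simp: annih_mod_def)
        qed
        then have "chain_to {P. primeideal P R} (Suc j) (annih_mod R (?A M j) u)"
          using less.prems by (intro chain_below_prime[OF chain A0[OF oneideal] _ u(3)]) auto
        from chain_above_associated_prime[OF M A _ u(1-3) this, of "d - j"]
        obtain Q where "chain_to {P. primeideal P R} (Suc j + (d - j)) Q"
          using vanishing_along_regular_chain[OF ch, of d] van less.prems A0[OF M] by auto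
        moreover have "Suc j + (d - j) = Suc d" using less.prems by simp
        ultimately have "chain_to {P. primeideal P R} (Suc d) Q" by (simp only:)
        then have "enat (Suc d) \<le> chain_length {P. primeideal P R}"
          unfolding chain_length_eq_Sup by (intro Sup_upper) blast
        then show False using d(2) unfolding krull_dim_eq_chain_length by simp
      qed
    qed
  qed
  then show ?thesis by (intro regular_chain_of_sequence[OF M xs]) (use d in auto)
qed

end

lemma submodule_carrier_update_iff:
  assumes "module R M" "submodule Z R M"
  shows "submodule N R (M\<lparr>carrier := Z\<rparr>) \<longleftrightarrow> submodule N R M \<and> N \<subseteq> Z"
  using module.submoduleE(1)[OF assms]
  unfolding module.submodule_iff[OF assms(1)] module.submodule_iff[OF module.module_carrier_update[OF assms]]
  by auto

context noetherian_local_ring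
begin

lemma resolved_residue_field_exists:
  obtains rk \<delta> \<gamma> e where "resolved_residue_field R \<mm> rk \<delta> \<gamma> e"
  using free_resolution_cyclic_exists[OF ideal_mm] resolved_residue_field_of_resolution by metis

text \<open>For any resolution, in particular the one chosen in the definition of \<open>Ext\<close>, the module
  \<open>Ext\<^sup>d\<close> is the cohomology for \<open>M = R\<close> and \<open>A = 0\<close>; it is moved along the regular sequence
  to degree \<open>0\<close>.\<close>
lemma module_length_Ext:
  assumes chain: "regular_chain R \<mm> (carrier R) A x d" and A0: "A 0 = {\<zero>}"
  shows "module_length R (Ext R d (quot_module (self_module R) \<mm>) (self_module R))
    = chain_length {N. ideal N R \<and> A d \<subseteq> N \<and> N \<subseteq> {u \<in> carrier R. \<forall>x\<in>\<mm>. x \<otimes> u \<in> A d}}"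
proof -
  define res where "res = (SOME (rk, \<delta>, \<epsilon>). free_resolution R (quot_module (self_module R) \<mm>) rk \<delta> \<epsilon>)"
  obtain rk \<delta> \<epsilon> where r: "res = (rk, \<delta>, \<epsilon>)" by (cases res)
  have "\<exists>t. case t of (rk, \<delta>, \<epsilon>) \<Rightarrow> free_resolution R (quot_module (self_module R) \<mm>) rk \<delta> \<epsilon>"
    using free_resolution_cyclic_exists[OF ideal_mm] by (metis case_prod_conv)
  from someI_ex[OF this] have "free_resolution R (quot_module (self_module R) \<mm>) rk \<delta> \<epsilon>"
    using r unfolding res_def by (simp add: case_prod_unfold)
  from resolved_residue_field_of_resolution[OF this] obtain \<gamma> e where "resolved_residue_field R \<mm> rk \<delta> \<gamma> e" .
  then interpret resolved_residue_field R \<mm> rk \<delta> \<gamma> e .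
  have self: "self_module R\<lparr>carrier := carrier R\<rparr> = self_module R" by (simp add: self_module_def)
  have cc: "cochains (carrier R) n = module_hom R (F n) (self_module R)" for n
    by (simp add: cochains_def self)
  have Z: "ext_cocycles R rk \<delta> (self_module R) d = cocycles (carrier R) {\<zero>} d"
    unfolding ext_cocycles_def cocycles_def cc by (simp add: self_module_def)
  have "differentials (carrier R) d = coboundaries (carrier R) {\<zero>} d"
  proof
    show "differentials (carrier R) d \<subseteq> coboundaries (carrier R) {\<zero>} d"
    proof
      fix f assume f: "f \<in> differentials (carrier R) d"
      note fC = differentialsD(1)[OF oneideal f]
      show "f \<in> coboundaries (carrier R) {\<zero>} d"
        unfolding coboundaries_def using f fC cochains_carrier[OF oneideal fC]
        by (intro CollectI conjI bexI[of _ f]) simp_all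
    qed
    show "coboundaries (carrier R) {\<zero>} d \<subseteq> differentials (carrier R) d"
    proof
      fix f assume "f \<in> coboundaries (carrier R) {\<zero>} d"
      then obtain g where f: "f \<in> cochains (carrier R) d" and g: "g \<in> differentials (carrier R) d"
        and fg: "\<And>v. v \<in> carrier (F d) \<Longrightarrow> f v \<ominus> g v = \<zero>" by (auto simp: coboundaries_def)
      note gC = differentialsD(1)[OF oneideal g]
      have "f = g"
        using f gC fg cochains_carrier[OF oneideal f] cochains_carrier[OF oneideal gC]
        unfolding cc by (intro module_hom_ext[of f R "F d"]) simp_all
      with g show "f \<in> differentials (carrier R) d" by simp
    qed
  qed
  moreover have "ext_coboundaries R rk \<delta> (self_module R) d = differentials (carrier R) d"
    by (cases d) (simp_all add: ext_coboundaries_def differentials_def cc self_module_def)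
  ultimately have B: "ext_coboundaries R rk \<delta> (self_module R) d = coboundaries (carrier R) {\<zero>} d" by simp
  have H: "hom_module R (F d) (self_module R) = cochain_module (carrier R) d" by (simp add: self)
  have E: "Ext R d (quot_module (self_module R) \<mm>) (self_module R) =
    quot_module (cochain_module (carrier R) d\<lparr>carrier := cocycles (carrier R) {\<zero>} d\<rparr>)
      (coboundaries (carrier R) {\<zero>} d)"
    unfolding Ext_def res_def[symmetric] r by (simp add: Z B H[symmetric])
  note sub = cocycles_submodule[OF oneideal zeroideal, of d] coboundaries_submodule[OF oneideal zeroideal, of d]
    coboundaries_subset_cocycles[OF oneideal, of "{\<zero>}" d]
  note mod = module_cochain_module[OF oneideal, of d]
  have "module_length R (Ext R d (quot_module (self_module R) \<mm>) (self_module R)) = cohomology_length (carrier R) {\<zero>} d"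
    unfolding E cohomology_length_def
    by (subst module_length_quot_module[OF module.module_carrier_update[OF mod sub(1)]])
      (auto simp: submodule_carrier_update_iff[OF mod sub(1)] sub intro!: arg_cong[where f = chain_length])
  then show ?thesis using cohomology_length_regular_chain[OF chain] A0 by simp
qed

lemma cm_type_eq:
  assumes chain: "regular_chain R \<mm> (carrier R) A x d" and A0: "A 0 = {\<zero>}" and d: "krull_dim R = enat d"
  shows "cm_type R
    = chain_length {N. ideal N R \<and> A d \<subseteq> N \<and> N \<subseteq> {u \<in> carrier R. \<forall>x\<in>\<mm>. x \<otimes> u \<in> A d}}"
proof -
  have "(THE \<nn>. local_ring R \<nn>) = \<mm>" using local_ring by (intro the_equality) (auto simp: local_ring_def)
  then show ?thesis unfolding cm_type_def Let_def by (simp add: d module_length_Ext[OF chain A0])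
qed

text \<open>The depth of \<open>I\<close> is attained by some regular sequence; it enters only through the vanishing
  of cohomology below \<open>d\<close>.\<close>
lemma regular_chain_on_maximal_cohen_macaulay:
  assumes I: "ideal I R" and d: "length xs = d" "krull_dim R = enat d"
    and xs: "set xs \<subseteq> \<mm>" "regular_sequence R (self_module R) xs"
    and depth: "depth R \<mm> (self_module R\<lparr>carrier := I\<rparr>) = enat d"
  shows "regular_chain R \<mm> I (\<lambda>j. times_ideal R (set (take j xs)) I) (\<lambda>j. xs ! j) d"
proof -
  let ?L = "{enat (length ys) | ys. set ys \<subseteq> \<mm> \<and> regular_sequence R (self_module R\<lparr>carrier := I\<rparr>) ys}"
  have Sup: "Sup ?L = enat d"
    using depth unfolding depth_def by (auto split: if_splits)
  have ex: "enat d \<in> ?L \<or> d = 0"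
  proof (rule ccontr)
    assume "\<not> ?thesis"
    then have n: "enat d \<notin> ?L" "d \<noteq> 0" by auto
    have "l \<le> enat (d - 1)" if l: "l \<in> ?L" for l
    proof -
      have "l \<le> enat d" using Sup_upper[OF l] Sup by simp
      moreover have "l \<noteq> enat d" using n l by auto
      ultimately show ?thesis by (cases l) auto
    qed
    then have "Sup ?L \<le> enat (d - 1)" by (rule Sup_least)
    then show False unfolding Sup using n by simp
  qed
  obtain rk \<delta> \<gamma> e where "resolved_residue_field R \<mm> rk \<delta> \<gamma> e" by (rule resolved_residue_field_exists)
  then interpret resolved_residue_field R \<mm> rk \<delta> \<gamma> e .
  have "cocycles I {\<zero>} i \<subseteq> coboundaries I {\<zero>} i" if i: "i < d" for i
  proof -
    obtain ys where ys: "length ys = d" "set ys \<subseteq> \<mm>" "regular_sequence R (self_module R\<lparr>carrier := I\<rparr>) ys"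
      using ex i by auto
    have "regular_chain R \<mm> I (\<lambda>j. times_ideal R (set (take j ys)) I) (\<lambda>j. ys ! j) d"
      using ys(1,3) regular_sequence_iff[OF I, of ys]
      by (intro regular_chain_of_sequence[OF I ys(2)]) simp_all
    from vanishing_of_regular_chain[OF this, of 0 i] i show ?thesis
      using times_ideal_empty[OF I] by simp
  qed
  then show ?thesis using regular_sequence_on_ideal[OF I xs(1) d xs(2)] by blast
qed

end


section \<open>The quadratic extension \<open>R \<oplus> It\<close>\<close>

lemma (in noetherian_local_ring) socle_ideals:
  assumes J: "ideal J R" and K: "ideal K R" "K \<subseteq> I" and I: "ideal I R"
    and JI: "\<And>r j. r \<in> J \<Longrightarrow> j \<in> I \<Longrightarrow> r \<otimes> j \<in> K"
  shows "ideal {r \<in> carrier R. (\<forall>x\<in>\<mm>. x \<otimes> r \<in> J) \<and> (\<forall>j\<in>I. j \<otimes> r \<in> K)} R"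
    and "J \<subseteq> {r \<in> carrier R. (\<forall>x\<in>\<mm>. x \<otimes> r \<in> J) \<and> (\<forall>j\<in>I. j \<otimes> r \<in> K)}"
    and "ideal {i \<in> I. \<forall>x\<in>\<mm>. x \<otimes> i \<in> K} R"
    and "K \<subseteq> {i \<in> I. \<forall>x\<in>\<mm>. x \<otimes> i \<in> K}"
proof -
  note JD = idealD[OF J] and KD = idealD[OF K(1)] and ID = idealD[OF I] and mD = idealD[OF ideal_mm]
  show "ideal {r \<in> carrier R. (\<forall>x\<in>\<mm>. x \<otimes> r \<in> J) \<and> (\<forall>j\<in>I. j \<otimes> r \<in> K)} R"
    unfolding ideal_iff using JD(2-4) KD(2-4) mD(1) ID(1) by (auto simp: r_distr m_lcomm)
  show "ideal {i \<in> I. \<forall>x\<in>\<mm>. x \<otimes> i \<in> K} R"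
    unfolding ideal_iff using KD(2-4) mD(1) ID(1-4) by (auto simp: r_distr m_lcomm)
  show "J \<subseteq> {r \<in> carrier R. (\<forall>x\<in>\<mm>. x \<otimes> r \<in> J) \<and> (\<forall>j\<in>I. j \<otimes> r \<in> K)}"
    using JD(1,4) mD(1) ID(1) JI m_comm by auto
  show "K \<subseteq> {i \<in> I. \<forall>x\<in>\<mm>. x \<otimes> i \<in> K}" using K(2) KD(4) mD(1) by auto
qed

text \<open>A ring \<open>S = R \<oplus> It\<close> with \<open>t\<^sup>2 = - a t - b\<close>. The map \<open>\<tau>\<close> stands for \<open>i \<mapsto> it\<close>, as \<open>t\<close> itself
  need not belong to \<open>S\<close>.\<close>
locale rees_extension = noetherian_local_ring R \<mm> + S: cring S
  for R :: "('a, 'r) ring_scheme" (structure) and \<mm> and S :: "('c, 's) ring_scheme" +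
  fixes I and a b and \<iota> and \<tau>
  assumes ideal_I: "ideal I R" and I_mm: "I \<subseteq> \<mm>"
    and ab: "a \<in> carrier R" "b \<in> carrier R"
    and iota_closed: "r \<in> carrier R \<Longrightarrow> \<iota> r \<in> carrier S"
    and tau_closed: "i \<in> I \<Longrightarrow> \<tau> i \<in> carrier S"
    and iota_add: "r \<in> carrier R \<Longrightarrow> s \<in> carrier R \<Longrightarrow> \<iota> (r \<oplus> s) = \<iota> r \<oplus>\<^bsub>S\<^esub> \<iota> s"
    and iota_mult: "r \<in> carrier R \<Longrightarrow> s \<in> carrier R \<Longrightarrow> \<iota> (r \<otimes> s) = \<iota> r \<otimes>\<^bsub>S\<^esub> \<iota> s"
    and iota_one: "\<iota> \<one> = \<one>\<^bsub>S\<^esub>"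
    and tau_add: "i \<in> I \<Longrightarrow> j \<in> I \<Longrightarrow> \<tau> (i \<oplus> j) = \<tau> i \<oplus>\<^bsub>S\<^esub> \<tau> j"
    and iota_tau: "r \<in> carrier R \<Longrightarrow> i \<in> I \<Longrightarrow> \<iota> r \<otimes>\<^bsub>S\<^esub> \<tau> i = \<tau> (r \<otimes> i)"
    and tau_tau: "i \<in> I \<Longrightarrow> j \<in> I \<Longrightarrow>
      \<tau> i \<otimes>\<^bsub>S\<^esub> \<tau> j = \<iota> (\<ominus> (b \<otimes> (i \<otimes> j))) \<oplus>\<^bsub>S\<^esub> \<tau> (\<ominus> (a \<otimes> (i \<otimes> j)))"
    and S_cases: "z \<in> carrier S \<Longrightarrow> \<exists>r\<in>carrier R. \<exists>i\<in>I. z = \<iota> r \<oplus>\<^bsub>S\<^esub> \<tau> i"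
    and independent: "r \<in> carrier R \<Longrightarrow> i \<in> I \<Longrightarrow> \<iota> r \<oplus>\<^bsub>S\<^esub> \<tau> i = \<zero>\<^bsub>S\<^esub> \<Longrightarrow> r = \<zero> \<and> i = \<zero>"
begin

lemmas ID = idealD[OF ideal_I]
lemmas mD = idealD[OF ideal_mm]

text \<open>The element \<open>r + it\<close>.\<close>
definition el :: "'a \<Rightarrow> 'a \<Rightarrow> 'c" where
  "el r i = \<iota> r \<oplus>\<^bsub>S\<^esub> \<tau> i"

lemma el_closed: "r \<in> carrier R \<Longrightarrow> i \<in> I \<Longrightarrow> el r i \<in> carrier S"
  unfolding el_def using iota_closed tau_closed by simp

lemma el_cases:
  assumes "s \<in> carrier S" obtains r i where "r \<in> carrier R" "i \<in> I" "s = el r i"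
  using S_cases[OF assms] unfolding el_def by blast

lemma el_add:
  assumes "r \<in> carrier R" "i \<in> I" "s \<in> carrier R" "j \<in> I"
  shows "el r i \<oplus>\<^bsub>S\<^esub> el s j = el (r \<oplus> s) (i \<oplus> j)"
  unfolding el_def using assms iota_closed tau_closed
  by (simp add: iota_add tau_add S.a_ac)

lemma iota_zero: "\<iota> \<zero> = \<zero>\<^bsub>S\<^esub>"
proof -
  have "\<iota> \<zero> \<oplus>\<^bsub>S\<^esub> \<iota> \<zero> = \<iota> \<zero>" using iota_add[of \<zero> \<zero>] by simp
  then show ?thesis using iota_closed[of \<zero>] S.add.l_cancel_one by simp
qed

lemma tau_zero: "\<tau> \<zero> = \<zero>\<^bsub>S\<^esub>"
  using iota_tau[of \<zero> \<zero>] iota_zero ID(2) tau_closed by simp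

lemma el_zero: "el \<zero> \<zero> = \<zero>\<^bsub>S\<^esub>" and el_iota: "r \<in> carrier R \<Longrightarrow> el r \<zero> = \<iota> r"
  and el_tau: "i \<in> I \<Longrightarrow> el \<zero> i = \<tau> i" and el_one: "el \<one> \<zero> = \<one>\<^bsub>S\<^esub>"
  unfolding el_def using iota_zero tau_zero iota_one iota_closed tau_closed by simp_all

lemma el_mult:
  assumes "r \<in> carrier R" "i \<in> I" "s \<in> carrier R" "j \<in> I"
  shows "el r i \<otimes>\<^bsub>S\<^esub> el s j = el (r \<otimes> s \<ominus> b \<otimes> (i \<otimes> j)) ((r \<otimes> j \<oplus> s \<otimes> i) \<ominus> a \<otimes> (i \<otimes> j))"
proof -
  have c: "i \<in> carrier R" "j \<in> carrier R" using assms ID(1) by auto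
  have m: "r \<otimes> j \<in> I" "s \<otimes> i \<in> I" "i \<otimes> j \<in> I" "a \<otimes> (i \<otimes> j) \<in> I" "\<ominus> (a \<otimes> (i \<otimes> j)) \<in> I"
    using assms ab c ID(4,6) by simp_all
  have "el r i \<otimes>\<^bsub>S\<^esub> el s j
    = (\<iota> r \<otimes>\<^bsub>S\<^esub> \<iota> s \<oplus>\<^bsub>S\<^esub> \<tau> i \<otimes>\<^bsub>S\<^esub> \<tau> j) \<oplus>\<^bsub>S\<^esub> (\<iota> r \<otimes>\<^bsub>S\<^esub> \<tau> j \<oplus>\<^bsub>S\<^esub> \<iota> s \<otimes>\<^bsub>S\<^esub> \<tau> i)"
    unfolding el_def using iota_closed[OF assms(1)] iota_closed[OF assms(3)] tau_closed[OF assms(2)]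
      tau_closed[OF assms(4)] by algebra
  also have "\<dots> = (\<iota> (r \<otimes> s) \<oplus>\<^bsub>S\<^esub> (\<iota> (\<ominus> (b \<otimes> (i \<otimes> j))) \<oplus>\<^bsub>S\<^esub> \<tau> (\<ominus> (a \<otimes> (i \<otimes> j)))))
      \<oplus>\<^bsub>S\<^esub> (\<tau> (r \<otimes> j) \<oplus>\<^bsub>S\<^esub> \<tau> (s \<otimes> i))"
    using assms by (simp add: iota_mult tau_tau iota_tau)
  also have "\<dots> = (\<iota> (r \<otimes> s) \<oplus>\<^bsub>S\<^esub> \<iota> (\<ominus> (b \<otimes> (i \<otimes> j)))) \<oplus>\<^bsub>S\<^esub>
      ((\<tau> (r \<otimes> j) \<oplus>\<^bsub>S\<^esub> \<tau> (s \<otimes> i)) \<oplus>\<^bsub>S\<^esub> \<tau> (\<ominus> (a \<otimes> (i \<otimes> j))))"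
    using iota_closed[of "r \<otimes> s"] iota_closed[of "\<ominus> (b \<otimes> (i \<otimes> j))"] tau_closed[OF m(1)] tau_closed[OF m(2)]
      tau_closed[OF m(5)] assms ab c by (simp add: S.a_ac)
  also have "\<dots> = el (r \<otimes> s \<oplus> \<ominus> (b \<otimes> (i \<otimes> j))) ((r \<otimes> j \<oplus> s \<otimes> i) \<oplus> \<ominus> (a \<otimes> (i \<otimes> j)))"
    unfolding el_def using assms ab c m ID(3) by (simp add: iota_add tau_add)
  finally show ?thesis by (simp add: minus_eq)
qed

lemma iota_mult_el:
  assumes "s \<in> carrier R" "r \<in> carrier R" "i \<in> I"
  shows "\<iota> s \<otimes>\<^bsub>S\<^esub> el r i = el (s \<otimes> r) (s \<otimes> i)"
  unfolding el_def using assms iota_closed tau_closed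
  by (simp add: iota_mult iota_tau S.r_distr)

lemma el_eq_iff:
  assumes "r \<in> carrier R" "i \<in> I" "s \<in> carrier R" "j \<in> I"
  shows "el r i = el s j \<longleftrightarrow> r = s \<and> i = j"
proof
  assume eq: "el r i = el s j"
  have c: "i \<in> carrier R" "j \<in> carrier R" using assms ID(1) by auto
  have "el (\<ominus> s) (\<ominus> j) \<oplus>\<^bsub>S\<^esub> el r i = el (\<ominus> s) (\<ominus> j) \<oplus>\<^bsub>S\<^esub> el s j" using eq by simp
  then have "el (\<ominus> s \<oplus> r) (\<ominus> j \<oplus> i) = el (\<ominus> s \<oplus> s) (\<ominus> j \<oplus> j)" using assms ID(6) by (simp add: el_add)
  then have "el (\<ominus> s \<oplus> r) (\<ominus> j \<oplus> i) = \<zero>\<^bsub>S\<^esub>" using assms c el_zero by (simp add: l_neg)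
  then have z: "\<ominus> s \<oplus> r = \<zero>" "\<ominus> j \<oplus> i = \<zero>"
    using independent[of "\<ominus> s \<oplus> r" "\<ominus> j \<oplus> i"] assms ID(3,6) unfolding el_def by auto
  have "r = s \<oplus> (\<ominus> s \<oplus> r)" "i = j \<oplus> (\<ominus> j \<oplus> i)" using assms c by algebra+
  then show "r = s \<and> i = j" unfolding z using assms c by simp
qed simp

text \<open>The set \<open>U + Vt\<close>.\<close>
definition els :: "'a set \<Rightarrow> 'a set \<Rightarrow> 'c set" where
  "els U V = {el r i | r i. r \<in> U \<and> i \<in> V}"

lemma el_mem_els:
  assumes "r \<in> carrier R" "i \<in> I" "U \<subseteq> carrier R" "V \<subseteq> I"
  shows "el r i \<in> els U V \<longleftrightarrow> r \<in> U \<and> i \<in> V"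
  using el_eq_iff[OF assms(1,2)] assms(3,4) unfolding els_def by blast

lemma els_mono: "U \<subseteq> U' \<Longrightarrow> V \<subseteq> V' \<Longrightarrow> els U V \<subseteq> els U' V'"
  unfolding els_def by blast

lemma els_ideal:
  assumes U: "ideal U R" and V: "ideal V R" "V \<subseteq> I"
    and UV: "\<And>r j. r \<in> U \<Longrightarrow> j \<in> I \<Longrightarrow> r \<otimes> j \<in> V" and VU: "\<And>i j. i \<in> V \<Longrightarrow> j \<in> I \<Longrightarrow> i \<otimes> j \<in> U"
  shows "ideal (els U V) S"
  unfolding S.ideal_iff
proof (intro conjI ballI)
  note UD = idealD[OF U] and VD = idealD[OF V(1)]
  show "els U V \<subseteq> carrier S" unfolding els_def using el_closed UD(1) V(2) by auto
  show "\<zero>\<^bsub>S\<^esub> \<in> els U V" unfolding els_def el_zero[symmetric] using UD(2) VD(2) by blast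
next
  note UD = idealD[OF U] and VD = idealD[OF V(1)]
  fix s t assume "s \<in> els U V" "t \<in> els U V"
  then obtain r i r' i' where *: "r \<in> U" "i \<in> V" "r' \<in> U" "i' \<in> V" "s = el r i" "t = el r' i'"
    unfolding els_def by blast
  then have "s \<oplus>\<^bsub>S\<^esub> t = el (r \<oplus> r') (i \<oplus> i')" using UD(1) V(2) by (simp add: el_add subsetD)
  then show "s \<oplus>\<^bsub>S\<^esub> t \<in> els U V" unfolding els_def using * UD(3) VD(3) by blast
next
  note UD = idealD[OF U] and VD = idealD[OF V(1)]
  fix s t assume "s \<in> carrier S" "t \<in> els U V"
  then obtain r' i' where t: "r' \<in> U" "i' \<in> V" "t = el r' i'" unfolding els_def by blast
  obtain r i where "r \<in> carrier R" "i \<in> I" "s = el r i" using el_cases[OF \<open>s \<in> carrier S\<close>] .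
  with t have *: "r \<in> carrier R" "i \<in> I" "r' \<in> U" "i' \<in> V" "s = el r i" "t = el r' i'" by simp_all
  have c: "r' \<in> carrier R" "i' \<in> I" "i \<in> carrier R" "i' \<in> carrier R" using * UD(1) V(2) ID(1) by auto
  have e: "s \<otimes>\<^bsub>S\<^esub> t = el (r \<otimes> r' \<ominus> b \<otimes> (i' \<otimes> i)) ((r \<otimes> i' \<oplus> r' \<otimes> i) \<ominus> a \<otimes> (i \<otimes> i'))"
    unfolding * using el_mult[OF *(1,2) c(1,2)] c by (simp add: m_comm)
  have "r \<otimes> r' \<ominus> b \<otimes> (i' \<otimes> i) \<in> U"
    using UD(7)[OF UD(4)[OF *(1,3)] UD(4)[OF ab(2) VU[OF *(4,2)]]] .
  moreover have "(r \<otimes> i' \<oplus> r' \<otimes> i) \<ominus> a \<otimes> (i \<otimes> i') \<in> V"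
    using VD(7)[OF VD(3)[OF VD(4)[OF *(1,4)] UV[OF *(3,2)]] VD(4)[OF ab(1) VD(4)[OF c(3) *(4)]]] .
  ultimately show "s \<otimes>\<^bsub>S\<^esub> t \<in> els U V" unfolding e els_def by blast
qed

text \<open>The projection of an ideal of \<open>S\<close> to \<open>R\<close>, and its intersection with \<open>It\<close>. Comparable ideals
  with the same projection and intersection are equal.\<close>
definition proj :: "'c set \<Rightarrow> 'a set" where
  "proj N = {r \<in> carrier R. \<exists>i\<in>I. el r i \<in> N}"

definition sect :: "'c set \<Rightarrow> 'a set" where
  "sect N = {i \<in> I. \<tau> i \<in> N}"

lemma proj_ideal:
  assumes N: "ideal N S" shows "ideal (proj N) R"
  unfolding ideal_iff
proof (intro conjI ballI)
  show "proj N \<subseteq> carrier R" unfolding proj_def by blast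
  show "\<zero> \<in> proj N" unfolding proj_def using el_zero S.idealD(2)[OF N] ID(2) zero_closed
    by (intro CollectI conjI bexI[of _ \<zero>]) simp_all
  show "r \<oplus> s \<in> proj N" if rs: "r \<in> proj N" "s \<in> proj N" for r s
  proof -
    obtain i j where *: "r \<in> carrier R" "s \<in> carrier R" "i \<in> I" "j \<in> I" "el r i \<in> N" "el s j \<in> N"
      using rs unfolding proj_def by blast
    then have "el (r \<oplus> s) (i \<oplus> j) \<in> N" using S.idealD(3)[OF N *(5,6)] by (simp add: el_add)
    then show ?thesis unfolding proj_def using * ID(3) by blast
  qed
  show "r \<otimes> s \<in> proj N" if rs: "r \<in> carrier R" "s \<in> proj N" for r s
  proof -
    obtain j where *: "s \<in> carrier R" "j \<in> I" "el s j \<in> N" using rs unfolding proj_def by blast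
    have "el (r \<otimes> s) (r \<otimes> j) \<in> N"
      using S.idealD(4)[OF N iota_closed[OF rs(1)] *(3)] rs * by (simp add: iota_mult_el)
    then show ?thesis unfolding proj_def using * rs(1) ID(4) by blast
  qed
qed

lemma sect_ideal:
  assumes N: "ideal N S" shows "ideal (sect N) R"
  unfolding ideal_iff sect_def
  using ID(1-4) S.idealD(2-4)[OF N] iota_closed
  by (auto simp: tau_zero tau_add iota_tau[symmetric])

lemma eq_of_proj_sect:
  assumes N: "ideal N S" and K: "ideal K S" "K \<subseteq> N" and p: "proj N \<subseteq> proj K" and s: "sect N \<subseteq> sect K"
  shows "N = K"
proof
  show "N \<subseteq> K"
  proof
    fix n assume n: "n \<in> N"
    then obtain r i where ri: "r \<in> carrier R" "i \<in> I" "n = el r i" using el_cases S.idealD(1)[OF N] by metis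
    then have "r \<in> proj K" using n p unfolding proj_def by blast
    then obtain j where j: "j \<in> I" "el r j \<in> K" unfolding proj_def by blast
    have c: "i \<in> carrier R" "j \<in> carrier R" using ri j ID(1) by auto
    have "el (\<ominus> r) (\<ominus> j) = \<ominus>\<^bsub>S\<^esub> el r j"
    proof (rule sym, rule S.minus_equality)
      show "el (\<ominus> r) (\<ominus> j) \<oplus>\<^bsub>S\<^esub> el r j = \<zero>\<^bsub>S\<^esub>"
        using ri j c ID(6) el_zero by (simp add: el_add l_neg)
    qed (use ri j ID(6) el_closed in simp_all)
    then have "el (\<ominus> r) (\<ominus> j) \<in> N" using j K(2) S.idealD(6)[OF N] by auto
    from S.idealD(3)[OF N n this] have "el (r \<oplus> \<ominus> r) (i \<oplus> \<ominus> j) \<in> N"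
      using ri j ID(6) by (simp add: el_add)
    then have "\<tau> (i \<oplus> \<ominus> j) \<in> N" using ri j ID(3,6) el_tau by (simp add: r_neg)
    then have "\<tau> (i \<oplus> \<ominus> j) \<in> K" using s ri j ID(3,6) unfolding sect_def by blast
    from S.idealD(3)[OF K(1) j(2) this] have "el r j \<oplus>\<^bsub>S\<^esub> el \<zero> (i \<oplus> \<ominus> j) \<in> K"
      using ri j ID(3,6) el_tau by simp
    moreover have "el r j \<oplus>\<^bsub>S\<^esub> el \<zero> (i \<oplus> \<ominus> j) = el (r \<oplus> \<zero>) (j \<oplus> (i \<oplus> \<ominus> j))"
      using ri j ID(3,6) by (intro el_add) simp_all
    moreover have "j \<oplus> (i \<oplus> \<ominus> j) = i" using c by algebra
    ultimately show "n \<in> K" using ri by simp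
  qed
qed (rule K(2))

text \<open>An ideal is generated by lifts of generators of its projection to \<open>R\<close> together with generators
  of its intersection with \<open>It\<close>.\<close>
lemma noetherian: "noetherian_ring S"
proof (rule S.noetherian_ringI)
  fix N assume N: "ideal N S"
  obtain G where G: "G \<subseteq> carrier R" "finite G" "proj N = Idl G" using finetely_gen[OF proj_ideal[OF N]] by blast
  obtain H where H: "H \<subseteq> carrier R" "finite H" "sect N = Idl H" using finetely_gen[OF sect_ideal[OF N]] by blast
  have GN: "G \<subseteq> proj N" and HN: "H \<subseteq> sect N" using G H genideal_self by simp_all
  have "\<exists>i. i \<in> I \<and> el g i \<in> N" if "g \<in> G" for g using that GN unfolding proj_def by blast
  then obtain c where c: "\<And>g. g \<in> G \<Longrightarrow> c g \<in> I \<and> el g (c g) \<in> N" by metis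
  define A where "A = (\<lambda>g. el g (c g)) ` G \<union> \<tau> ` H"
  have AN: "A \<subseteq> N" unfolding A_def using c HN unfolding sect_def by auto
  then have AS: "A \<subseteq> carrier S" using S.idealD(1)[OF N] by blast
  have K: "ideal (Idl\<^bsub>S\<^esub> A) S" "A \<subseteq> Idl\<^bsub>S\<^esub> A" "Idl\<^bsub>S\<^esub> A \<subseteq> N"
    using S.genideal_ideal[OF AS] S.genideal_self[OF AS] S.genideal_minimal[OF N AN] by auto
  have "G \<subseteq> proj (Idl\<^bsub>S\<^esub> A)"
  proof
    fix g assume "g \<in> G"
    then have "el g (c g) \<in> Idl\<^bsub>S\<^esub> A" "c g \<in> I" "g \<in> carrier R" using K(2) c G(1) unfolding A_def by auto
    then show "g \<in> proj (Idl\<^bsub>S\<^esub> A)" unfolding proj_def by blast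
  qed
  then have "proj N \<subseteq> proj (Idl\<^bsub>S\<^esub> A)" unfolding G(3) by (rule genideal_minimal[OF proj_ideal[OF K(1)]])
  moreover have "H \<subseteq> sect (Idl\<^bsub>S\<^esub> A)" using K(2) HN unfolding sect_def A_def by auto
  then have "sect N \<subseteq> sect (Idl\<^bsub>S\<^esub> A)" unfolding H(3) by (rule genideal_minimal[OF sect_ideal[OF K(1)]])
  ultimately have "N = Idl\<^bsub>S\<^esub> A" by (rule eq_of_proj_sect[OF N K(1,3)])
  moreover have "finite A" unfolding A_def using G H by simp
  ultimately show "\<exists>A\<subseteq>carrier S. finite A \<and> N = Idl\<^bsub>S\<^esub> A" using AS by blast
qed

text \<open>The conjugate \<open>r - ai - it\<close> of \<open>r + it\<close> plays the role of the other root of a quadratic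
  equation over \<open>R\<close>. Norm and trace replace a general theory of integral extensions.\<close>
lemma el_mult_conjugate:
  assumes "r \<in> carrier R" "i \<in> I"
  shows "el r i \<otimes>\<^bsub>S\<^esub> el (r \<ominus> a \<otimes> i) (\<ominus> i) = \<iota> ((r \<otimes> r \<ominus> a \<otimes> r \<otimes> i) \<oplus> b \<otimes> i \<otimes> i)"
    "el r i \<oplus>\<^bsub>S\<^esub> el (r \<ominus> a \<otimes> i) (\<ominus> i) = \<iota> ((r \<oplus> r) \<ominus> a \<otimes> i)"
proof -
  have c: "i \<in> carrier R" "\<ominus> i \<in> I" "r \<ominus> a \<otimes> i \<in> carrier R" using assms ID(1,6) ab by auto
  have "r \<otimes> (r \<ominus> a \<otimes> i) \<ominus> b \<otimes> (i \<otimes> (\<ominus> i)) = (r \<otimes> r \<ominus> a \<otimes> r \<otimes> i) \<oplus> b \<otimes> i \<otimes> i"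
    using assms(1) c(1) ab by algebra
  moreover have "(r \<otimes> (\<ominus> i) \<oplus> (r \<ominus> a \<otimes> i) \<otimes> i) \<ominus> a \<otimes> (i \<otimes> (\<ominus> i)) = \<zero>"
    using assms(1) c(1) ab by algebra
  ultimately show "el r i \<otimes>\<^bsub>S\<^esub> el (r \<ominus> a \<otimes> i) (\<ominus> i) = \<iota> ((r \<otimes> r \<ominus> a \<otimes> r \<otimes> i) \<oplus> b \<otimes> i \<otimes> i)"
    using el_mult[OF assms c(3,2)] el_iota[of "(r \<otimes> r \<ominus> a \<otimes> r \<otimes> i) \<oplus> b \<otimes> i \<otimes> i"] assms(1) c ab
    by (simp only: a_closed minus_closed m_closed)
  have "r \<oplus> (r \<ominus> a \<otimes> i) = (r \<oplus> r) \<ominus> a \<otimes> i" "i \<oplus> (\<ominus> i) = \<zero>" using assms(1) c(1) ab by algebra+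
  then show "el r i \<oplus>\<^bsub>S\<^esub> el (r \<ominus> a \<otimes> i) (\<ominus> i) = \<iota> ((r \<oplus> r) \<ominus> a \<otimes> i)"
    using el_add[OF assms c(3,2)] assms c ab by (simp add: el_iota)
qed

lemma els_mm_ideal: "ideal (els \<mm> I) S"
  using mD ID I_mm by (intro els_ideal ideal_mm ideal_I) auto

lemma invertible_outside:
  assumes "s \<in> carrier S" "s \<notin> els \<mm> I"
  obtains t where "t \<in> carrier S" "t \<otimes>\<^bsub>S\<^esub> s = \<one>\<^bsub>S\<^esub>"
proof -
  obtain r i where ri: "r \<in> carrier R" "i \<in> I" "s = el r i" using el_cases[OF assms(1)] .
  then have r: "r \<notin> \<mm>" using assms(2) unfolding els_def by blast
  have c: "i \<in> carrier R" "i \<in> \<mm>" "\<ominus> i \<in> I" using ri ID(1,6) I_mm by auto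
  let ?n = "(r \<otimes> r \<ominus> a \<otimes> r \<otimes> i) \<oplus> b \<otimes> i \<otimes> i"
  have nc: "?n \<in> carrier R" using ri c ab by simp
  have "?n \<notin> \<mm>"
  proof
    assume "?n \<in> \<mm>"
    moreover have "a \<otimes> r \<otimes> i \<in> \<mm>" "b \<otimes> i \<otimes> i \<in> \<mm>" using mD(4) c ri ab by simp_all
    ultimately have "(?n \<oplus> a \<otimes> r \<otimes> i) \<ominus> b \<otimes> i \<otimes> i \<in> \<mm>" using mD(3,7) by blast
    moreover have "(?n \<oplus> a \<otimes> r \<otimes> i) \<ominus> b \<otimes> i \<otimes> i = r \<otimes> r" using ri c ab by algebra
    ultimately show False using primeideal.I_prime[OF prime_mm ri(1) ri(1)] r by auto
  qed
  then obtain y where y: "y \<in> carrier R" "y \<otimes> ?n = \<one>" using invertible_outside_mm[OF nc] by blast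
  let ?c = "el (r \<ominus> a \<otimes> i) (\<ominus> i)"
  have cc: "?c \<in> carrier S" "s \<in> carrier S" "\<iota> y \<in> carrier S" using el_closed iota_closed ri c ab y by simp_all
  have "(\<iota> y \<otimes>\<^bsub>S\<^esub> ?c) \<otimes>\<^bsub>S\<^esub> s = \<iota> y \<otimes>\<^bsub>S\<^esub> (s \<otimes>\<^bsub>S\<^esub> ?c)" using cc by algebra
  also have "\<dots> = \<one>\<^bsub>S\<^esub>" unfolding ri(3) el_mult_conjugate(1)[OF ri(1,2)] using y nc iota_one
    by (simp add: iota_mult[symmetric])
  finally show thesis using that[of "\<iota> y \<otimes>\<^bsub>S\<^esub> ?c"] cc by simp
qed

lemma one_notin_els: "\<one>\<^bsub>S\<^esub> \<notin> els \<mm> I"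
  unfolding el_one[symmetric] using el_mem_els[of \<one> \<zero> \<mm> I] ID(2) mD(1) one_notin_mm by auto

lemma ideal_not_subset:
  assumes "ideal N S" "\<not> N \<subseteq> els \<mm> I" shows "N = carrier S"
proof -
  obtain s where s: "s \<in> N" "s \<notin> els \<mm> I" using assms(2) by blast
  have sc: "s \<in> carrier S" using S.idealD(1)[OF assms(1) s(1)] .
  obtain t where t: "t \<in> carrier S" "t \<otimes>\<^bsub>S\<^esub> s = \<one>\<^bsub>S\<^esub>" using invertible_outside[OF sc s(2)] .
  have "\<one>\<^bsub>S\<^esub> \<in> N" using S.idealD(4)[OF assms(1) t(1) s(1)] t(2) by simp
  then show ?thesis by (rule ideal.one_imp_carrier[OF assms(1)])
qed

lemma local: "local_ring S (els \<mm> I)"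
  unfolding local_ring_def
proof (intro conjI allI impI)
  show "cring S" by (rule S.is_cring)
  show "maximalideal (els \<mm> I) S"
  proof (rule maximalidealI[OF els_mm_ideal])
    show "carrier S \<noteq> els \<mm> I" using one_notin_els S.one_closed by metis
    fix N assume "ideal N S" "els \<mm> I \<subseteq> N"
    then show "N = els \<mm> I \<or> N = carrier S" using ideal_not_subset[of N] by blast
  qed
  fix N assume N: "maximalideal N S"
  then have id: "ideal N S" by (simp add: maximalideal_def)
  have sub: "N \<subseteq> els \<mm> I" using ideal_not_subset[OF id] maximalideal.I_notcarr[OF N] by metis
  have "els \<mm> I = N \<or> els \<mm> I = carrier S"
    using S.idealD(1)[OF els_mm_ideal] by (intro maximalideal.I_maximal[OF N els_mm_ideal sub]) blast
  then show "N = els \<mm> I" using one_notin_els S.one_closed by metis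
qed

sublocale S: noetherian_local_ring S "els \<mm> I"
  by (intro noetherian_local_ring.intro noetherian_cring.intro noetherian noetherian_local_ring_axioms.intro
      local S.is_cring)

text \<open>Distinct comparable primes of \<open>S\<close> have distinct contractions: if \<open>s \<in> Q\<close> is not in \<open>P\<close>, its
  norm lies in \<open>Q \<inter> R = P \<inter> R\<close>, so its conjugate lies in \<open>P\<close>; then its trace lies in
  \<open>Q \<inter> R = P \<inter> R\<close> as well, and \<open>s\<close>, the trace minus the conjugate, would be in \<open>P\<close>.\<close>
lemma krull_dim_le: "krull_dim S \<le> krull_dim R"
  unfolding krull_dim_eq_chain_length
proof (rule chain_length_mono[where f = "\<lambda>P. {r \<in> carrier R. \<iota> r \<in> P}"])
  fix P assume "P \<in> {P. primeideal P S}"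
  then have P: "primeideal P S" and id: "ideal P S" by (simp_all add: primeideal_def)
  have "ideal {r \<in> carrier R. \<iota> r \<in> P} R"
    unfolding ideal_iff using S.idealD(2-4)[OF id] iota_closed
    by (auto simp: iota_zero iota_add iota_mult)
  moreover have "\<one> \<notin> {r \<in> carrier R. \<iota> r \<in> P}"
    using iota_one ideal.one_imp_carrier[OF id] primeideal.I_notcarr[OF P] by auto
  then have "carrier R \<noteq> {r \<in> carrier R. \<iota> r \<in> P}" using one_closed by blast
  ultimately show "{r \<in> carrier R. \<iota> r \<in> P} \<in> {P. primeideal P R}"
    using primeideal.I_prime[OF P] iota_closed
    by (intro CollectI primeidealI is_cring) (auto simp: iota_mult)
next
  fix P Q assume "P \<in> {P. primeideal P S}" "Q \<in> {P. primeideal P S}" and PQ: "P \<subset> Q"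
  then have P: "primeideal P S" "ideal P S" and Q: "ideal Q S" by (simp_all add: primeideal_def)
  have "{r \<in> carrier R. \<iota> r \<in> P} \<noteq> {r \<in> carrier R. \<iota> r \<in> Q}"
  proof
    assume eq: "{r \<in> carrier R. \<iota> r \<in> P} = {r \<in> carrier R. \<iota> r \<in> Q}"
    then have down: "\<iota> r \<in> P" if "r \<in> carrier R" "\<iota> r \<in> Q" for r using that by blast
    obtain s where s: "s \<in> Q" "s \<notin> P" using PQ by blast
    then obtain r i where ri: "r \<in> carrier R" "i \<in> I" "s = el r i" using el_cases S.idealD(1)[OF Q] by metis
    have c: "i \<in> carrier R" "\<ominus> i \<in> I" using ri ID(1,6) by auto
    let ?n = "(r \<otimes> r \<ominus> a \<otimes> r \<otimes> i) \<oplus> b \<otimes> i \<otimes> i" and ?c = "el (r \<ominus> a \<otimes> i) (\<ominus> i)"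
    have cc: "?c \<in> carrier S" "s \<in> carrier S" using el_closed ri c ab by simp_all
    have "s \<otimes>\<^bsub>S\<^esub> ?c \<in> Q" using S.idealD(5)[OF Q cc(1) s(1)] .
    then have "s \<otimes>\<^bsub>S\<^esub> ?c \<in> P"
      using down[of ?n] el_mult_conjugate(1)[OF ri(1,2)] ri c ab by simp
    then have cP: "?c \<in> P" using primeideal.I_prime[OF P(1) cc(2,1)] s by blast
    then have "s \<oplus>\<^bsub>S\<^esub> ?c \<in> Q" using S.idealD(3)[OF Q s(1)] PQ by blast
    then have "s \<oplus>\<^bsub>S\<^esub> ?c \<in> P"
      using down[of "(r \<oplus> r) \<ominus> a \<otimes> i"] el_mult_conjugate(2)[OF ri(1,2)] ri c ab by simp
    from S.idealD(7)[OF P(2) this cP] have "(s \<oplus>\<^bsub>S\<^esub> ?c) \<ominus>\<^bsub>S\<^esub> ?c \<in> P" .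
    moreover have "(s \<oplus>\<^bsub>S\<^esub> ?c) \<ominus>\<^bsub>S\<^esub> ?c = s" using cc by algebra
    ultimately show False using s by simp
  qed
  with PQ show "{r \<in> carrier R. \<iota> r \<in> P} \<subset> {r \<in> carrier R. \<iota> r \<in> Q}" by blast
qed

lemma add_multiples_els:
  assumes A: "A \<subseteq> carrier R" and B: "B \<subseteq> I" and x: "x \<in> carrier R"
  shows "add_multiples S (els A B) (\<iota> x) (carrier S)
    = els (add_multiples R A x (carrier R)) (add_multiples R B x I)"
proof -
  have e: "el p q \<oplus>\<^bsub>S\<^esub> \<iota> x \<otimes>\<^bsub>S\<^esub> el r i = el (p \<oplus> x \<otimes> r) (q \<oplus> x \<otimes> i)"
    if "p \<in> A" "q \<in> B" "r \<in> carrier R" "i \<in> I" for p q r i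
    using that A B x ID(4) by (simp add: iota_mult_el el_add subsetD)
  show ?thesis
  proof
    show "add_multiples S (els A B) (\<iota> x) (carrier S)
        \<subseteq> els (add_multiples R A x (carrier R)) (add_multiples R B x I)"
    proof
      fix y assume "y \<in> add_multiples S (els A B) (\<iota> x) (carrier S)"
      then obtain p q s where "p \<in> A" "q \<in> B" "s \<in> carrier S" "y = el p q \<oplus>\<^bsub>S\<^esub> \<iota> x \<otimes>\<^bsub>S\<^esub> s"
        unfolding add_multiples_def els_def by blast
      moreover from this obtain r i where "r \<in> carrier R" "i \<in> I" "s = el r i" using el_cases by metis
      ultimately have "p \<in> A" "q \<in> B" "r \<in> carrier R" "i \<in> I" "y = el (p \<oplus> x \<otimes> r) (q \<oplus> x \<otimes> i)" using e by simp_all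
      then show "y \<in> els (add_multiples R A x (carrier R)) (add_multiples R B x I)"
        unfolding add_multiples_def els_def by blast
    qed
    show "els (add_multiples R A x (carrier R)) (add_multiples R B x I)
        \<subseteq> add_multiples S (els A B) (\<iota> x) (carrier S)"
    proof
      fix y assume "y \<in> els (add_multiples R A x (carrier R)) (add_multiples R B x I)"
      then obtain p q r i where "p \<in> A" "q \<in> B" "r \<in> carrier R" "i \<in> I" "y = el (p \<oplus> x \<otimes> r) (q \<oplus> x \<otimes> i)"
        unfolding add_multiples_def els_def by blast
      then have "y = el p q \<oplus>\<^bsub>S\<^esub> \<iota> x \<otimes>\<^bsub>S\<^esub> el r i" "el r i \<in> carrier S" "el p q \<in> els A B"
        using e el_closed unfolding els_def by auto
      then show "y \<in> add_multiples S (els A B) (\<iota> x) (carrier S)" unfolding add_multiples_def by blast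
    qed
  qed
qed

text \<open>As a module over \<open>R\<close>, the ring \<open>S\<close> is \<open>R \<oplus> I\<close>; regularity is tested on the two summands.\<close>
lemma regular_chain_els:
  assumes A: "regular_chain R \<mm> (carrier R) A x d" "A 0 = {\<zero>}"
    and B: "regular_chain R \<mm> I B x d" "B 0 = {\<zero>}"
  shows "regular_chain S (els \<mm> I) (carrier S) (\<lambda>j. els (A j) (B j)) (\<lambda>j. \<iota> (x j)) d"
    and "els (A 0) (B 0) = {\<zero>\<^bsub>S\<^esub>}"
proof -
  note AD = regular_chainD[OF A(1)] and BD = regular_chainD[OF B(1)]
  show z: "els (A 0) (B 0) = {\<zero>\<^bsub>S\<^esub>}" unfolding els_def A(2) B(2) using el_zero by auto
  show "regular_chain S (els \<mm> I) (carrier S) (\<lambda>j. els (A j) (B j)) (\<lambda>j. \<iota> (x j)) d"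
    unfolding regular_chain_def
  proof (intro conjI allI impI ballI)
    show "ideal (carrier S) S" by (rule S.oneideal)
    show "ideal (els (A 0) (B 0)) S" "els (A 0) (B 0) \<subseteq> carrier S" unfolding z using S.zeroideal by simp_all
    fix j assume j: "j < d"
    have AB: "A j \<subseteq> carrier R" "B j \<subseteq> I"
      using regular_chain_ideal[OF A(1), of j] regular_chain_ideal[OF B(1), of j] j by simp_all
    have xc: "x j \<in> carrier R" using mD(1) AD(2)[OF j] by blast
    have "el (x j) \<zero> \<in> els \<mm> I" using AD(2)[OF j] ID(2) unfolding els_def by blast
    then show "\<iota> (x j) \<in> els \<mm> I" using el_iota[OF xc] by simp
    show "els (A (Suc j)) (B (Suc j)) = add_multiples S (els (A j) (B j)) (\<iota> (x j)) (carrier S)"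
      unfolding AD(3)[OF j] BD(3)[OF j] using add_multiples_els[OF AB xc] by simp
    fix v assume v: "v \<in> carrier S" "\<iota> (x j) \<otimes>\<^bsub>S\<^esub> v \<in> els (A j) (B j)"
    obtain r i where ri: "r \<in> carrier R" "i \<in> I" "v = el r i" using el_cases[OF v(1)] .
    have "el (x j \<otimes> r) (x j \<otimes> i) \<in> els (A j) (B j)" using v(2) ri xc by (simp add: iota_mult_el)
    then have "x j \<otimes> r \<in> A j" "x j \<otimes> i \<in> B j" using el_mem_els[OF _ _ AB] ri xc ID(4) by auto
    then have "r \<in> A j" "i \<in> B j" using AD(4)[OF j ri(1)] BD(4)[OF j ri(2)] by auto
    then show "v \<in> els (A j) (B j)" using ri unfolding els_def by blast
  qed
qed

text \<open>The regular sequence itself provides a chain of primes of length \<open>d\<close> in \<open>S\<close>.\<close>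
lemma krull_dim_eq:
  assumes "regular_chain R \<mm> (carrier R) A x d" "A 0 = {\<zero>}" "regular_chain R \<mm> I B x d" "B 0 = {\<zero>}"
    and d: "krull_dim R = enat d"
  shows "krull_dim S = enat d"
proof (rule antisym)
  show "krull_dim S \<le> enat d" using krull_dim_le d by simp
  have "chain_to {P. primeideal P S} d (els \<mm> I)"
    using S.regular_chainD(2)[OF regular_chain_els(1)[OF assms(1-4)]]
    by (intro S.chain_below_prime[OF regular_chain_els[OF assms(1-4)]] S.prime_mm) auto
  then show "enat d \<le> krull_dim S"
    unfolding krull_dim_eq_chain_length chain_length_eq_Sup by (intro Sup_upper) blast
qed

text \<open>Multiplying \<open>r + it\<close> by \<open>x \<in> \<mm>\<close> gives the conditions \<open>x r \<in> J\<close> and \<open>x i \<in> K\<close>. Multiplying it by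
  \<open>jt\<close> gives \<open>j r \<in> K\<close>, since the remaining terms \<open>b i j\<close> and \<open>a i j\<close> lie in \<open>K\<close> because of
  \<open>j \<in> I \<subseteq> \<mm>\<close>. This is why \<open>a\<close> and \<open>b\<close> do not occur in the result.\<close>
lemma socle_els:
  assumes J: "ideal J R" and K: "ideal K R" "K \<subseteq> I" "K \<subseteq> J"
  shows "{u \<in> carrier S. \<forall>x\<in>els \<mm> I. x \<otimes>\<^bsub>S\<^esub> u \<in> els J K}
    = els {r \<in> carrier R. (\<forall>x\<in>\<mm>. x \<otimes> r \<in> J) \<and> (\<forall>j\<in>I. j \<otimes> r \<in> K)} {i \<in> I. \<forall>x\<in>\<mm>. x \<otimes> i \<in> K}"
    (is "?L = els ?U ?V")
proof
  note JD = idealD[OF J] and KD = idealD[OF K(1)]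
  have Jc: "J \<subseteq> carrier R" using JD(1) by blast
  show "?L \<subseteq> els ?U ?V"
  proof
    fix u assume u: "u \<in> ?L"
    then have uc: "u \<in> carrier S" by simp
    obtain r i where ri: "r \<in> carrier R" "i \<in> I" "u = el r i" using el_cases[OF uc] .
    have ic: "i \<in> carrier R" using ri ID(1) by blast
    have *: "x \<otimes> r \<in> J \<and> x \<otimes> i \<in> K" if x: "x \<in> \<mm>" for x
    proof -
      have xc: "x \<in> carrier R" using x mD(1) by blast
      have "el x \<zero> \<in> els \<mm> I" unfolding els_def using x ID(2) by blast
      then have "\<iota> x \<otimes>\<^bsub>S\<^esub> u \<in> els J K" using u el_iota[OF xc] by auto
      then show ?thesis using el_mem_els[OF _ _ Jc K(2)] ri xc ID(4) by (simp add: iota_mult_el)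
    qed
    have "j \<otimes> r \<in> K" if j: "j \<in> I" for j
    proof -
      have jc: "j \<in> carrier R" using j ID(1) by blast
      have "el \<zero> j \<in> els \<mm> I" unfolding els_def using j mD(2) by blast
      then have "el \<zero> j \<otimes>\<^bsub>S\<^esub> el r i \<in> els J K" using u ri by auto
      then have "(\<zero> \<otimes> i \<oplus> r \<otimes> j) \<ominus> a \<otimes> (j \<otimes> i) \<in> K"
        using el_mult[of \<zero> j r i] el_mem_els[OF _ _ Jc K(2)] j jc ri ic ab ID(3,4,7) by simp
      moreover have "a \<otimes> (j \<otimes> i) \<in> K" using * j I_mm KD(4)[OF ab(1)] by blast
      ultimately have "((\<zero> \<otimes> i \<oplus> r \<otimes> j) \<ominus> a \<otimes> (j \<otimes> i)) \<oplus> a \<otimes> (j \<otimes> i) \<in> K" by (rule KD(3))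
      moreover have "((\<zero> \<otimes> i \<oplus> r \<otimes> j) \<ominus> a \<otimes> (j \<otimes> i)) \<oplus> a \<otimes> (j \<otimes> i) = j \<otimes> r"
        using jc ic ri(1) ab by algebra
      ultimately show ?thesis by simp
    qed
    with * ri show "u \<in> els ?U ?V" unfolding els_def by blast
  qed
  show "els ?U ?V \<subseteq> ?L"
  proof
    fix u assume "u \<in> els ?U ?V"
    then obtain r i where ri: "r \<in> ?U" "i \<in> ?V" "u = el r i" unfolding els_def by blast
    have c: "r \<in> carrier R" "i \<in> I" "i \<in> carrier R" using ri ID(1) by auto
    have "x \<otimes>\<^bsub>S\<^esub> u \<in> els J K" if "x \<in> els \<mm> I" for x
    proof -
      from that obtain m j where mj: "m \<in> \<mm>" "j \<in> I" "x = el m j" unfolding els_def by blast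
      have mc: "m \<in> carrier R" "j \<in> \<mm>" "j \<in> carrier R" using mj mD(1) I_mm ID(1) by auto
      have k: "m \<otimes> i \<in> K" "j \<otimes> i \<in> K" "j \<otimes> r \<in> K" "m \<otimes> r \<in> J" using ri mj mc by simp_all
      have "m \<otimes> r \<ominus> b \<otimes> (j \<otimes> i) \<in> J" using k K(3) JD(4)[OF ab(2)] by (intro JD(7)) auto
      moreover have "(m \<otimes> i \<oplus> r \<otimes> j) \<ominus> a \<otimes> (j \<otimes> i) \<in> K"
        using k KD(4)[OF ab(1)] m_comm[OF mc(3) c(1)] by (intro KD(7) KD(3)) auto
      ultimately show ?thesis
        unfolding mj(3) ri(3) el_mult[OF mc(1) mj(2) c(1,2)] els_def by blast
    qed
    then show "u \<in> ?L" using el_closed[OF c(1,2)] ri(3) by simp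
  qed
qed

text \<open>\<open>It\<close> multiplies \<open>U + Vt\<close> into \<open>J + Kt\<close>, so that every pair of an ideal between \<open>J\<close> and \<open>U\<close> and
  one between \<open>K\<close> and \<open>V\<close> gives an ideal of \<open>S\<close>; length is then additive along \<open>R \<oplus> It\<close>.\<close>
lemma chain_length_els:
  assumes J: "ideal J R" and K: "ideal K R" "K \<subseteq> I" "K \<subseteq> J"
    and U: "ideal U R" "J \<subseteq> U" "\<And>r j. r \<in> U \<Longrightarrow> j \<in> I \<Longrightarrow> r \<otimes> j \<in> K"
    and V: "ideal V R" "K \<subseteq> V" "V \<subseteq> I" "\<And>i j. i \<in> V \<Longrightarrow> j \<in> I \<Longrightarrow> i \<otimes> j \<in> K"
  shows "chain_length {N. ideal N S \<and> els J K \<subseteq> N \<and> N \<subseteq> els U V}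
    = chain_length {N. ideal N R \<and> J \<subseteq> N \<and> N \<subseteq> U} + chain_length {N. ideal N R \<and> K \<subseteq> N \<and> N \<subseteq> V}"
proof (rule antisym)
  have UV: "U \<subseteq> carrier R" "V \<subseteq> I" using idealD(1)[OF U(1)] V(3) by auto
  have idl: "ideal (els N N') S" if "ideal N R" "J \<subseteq> N" "N \<subseteq> U" "ideal N' R" "K \<subseteq> N'" "N' \<subseteq> V" for N N'
  proof (rule els_ideal[OF that(1,4)])
    show "N' \<subseteq> I" using that(6) V(3) by (rule subset_trans)
    show "r \<otimes> j \<in> N'" if "r \<in> N" "j \<in> I" for r j using U(3)[of r j] that \<open>N \<subseteq> U\<close> \<open>K \<subseteq> N'\<close> by auto
    show "i \<otimes> j \<in> N" if "i \<in> N'" "j \<in> I" for i j using V(4)[of i j] that \<open>N' \<subseteq> V\<close> \<open>J \<subseteq> N\<close> K(3) by auto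
  qed
  show "chain_length {N. ideal N S \<and> els J K \<subseteq> N \<and> N \<subseteq> els U V}
    \<le> chain_length {N. ideal N R \<and> J \<subseteq> N \<and> N \<subseteq> U} + chain_length {N. ideal N R \<and> K \<subseteq> N \<and> N \<subseteq> V}"
  proof (rule chain_length_le_add[where f = proj and g = sect])
    have "els J K \<subseteq> els U V" using U(2) V(2) by (rule els_mono)
    moreover have "ideal (els J K) S" using idl[OF J subset_refl U(2) K(1) subset_refl V(2)] .
    ultimately show "{N. ideal N S \<and> els J K \<subseteq> N \<and> N \<subseteq> els U V} \<noteq> {}" by blast
  next
    fix N assume "N \<in> {N. ideal N S \<and> els J K \<subseteq> N \<and> N \<subseteq> els U V}"
    then have N: "ideal N S" "els J K \<subseteq> N" "N \<subseteq> els U V" by auto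
    have "J \<subseteq> proj N"
    proof
      fix r assume r: "r \<in> J"
      have "el r \<zero> \<in> N" using r N(2) idealD(2)[OF K(1)] unfolding els_def by blast
      then show "r \<in> proj N" unfolding proj_def using idealD(1)[OF J r] ID(2) by blast
    qed
    moreover have "proj N \<subseteq> U"
      using N(3) el_mem_els[OF _ _ UV] unfolding proj_def by blast
    ultimately show "proj N \<in> {N. ideal N R \<and> J \<subseteq> N \<and> N \<subseteq> U}" using proj_ideal[OF N(1)] by simp
    have "K \<subseteq> sect N"
    proof
      fix i assume i: "i \<in> K"
      have "el \<zero> i \<in> N" using i N(2) idealD(2)[OF J] unfolding els_def by blast
      then show "i \<in> sect N" unfolding sect_def using i K(2) el_tau by auto
    qed
    moreover have "sect N \<subseteq> V"
    proof
      fix i assume i: "i \<in> sect N"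
      then have "el \<zero> i \<in> els U V" "i \<in> I" using N(3) el_tau unfolding sect_def by auto
      then show "i \<in> V" using el_mem_els[OF zero_closed _ UV] by blast
    qed
    ultimately show "sect N \<in> {N. ideal N R \<and> K \<subseteq> N \<and> N \<subseteq> V}" using sect_ideal[OF N(1)] by simp
  next
    fix X Y :: "'c set" assume "X \<subseteq> Y"
    then show "proj X \<subseteq> proj Y" "sect X \<subseteq> sect Y" unfolding proj_def sect_def by blast+
  next
    fix X Y assume "X \<in> {N. ideal N S \<and> els J K \<subseteq> N \<and> N \<subseteq> els U V}"
      "Y \<in> {N. ideal N S \<and> els J K \<subseteq> N \<and> N \<subseteq> els U V}" "X \<subseteq> Y" "proj X = proj Y" "sect X = sect Y"
    then show "X = Y" using eq_of_proj_sect[of Y X] by simp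
  qed
  show "chain_length {N. ideal N R \<and> J \<subseteq> N \<and> N \<subseteq> U} + chain_length {N. ideal N R \<and> K \<subseteq> N \<and> N \<subseteq> V}
    \<le> chain_length {N. ideal N S \<and> els J K \<subseteq> N \<and> N \<subseteq> els U V}"
    unfolding add.commute[of "chain_length {N. ideal N R \<and> J \<subseteq> N \<and> N \<subseteq> U}"]
  proof (rule chain_length_add_le[where f = "\<lambda>N. els J N" and g = "\<lambda>N. els N V"])
    show "{N. ideal N R \<and> K \<subseteq> N \<and> N \<subseteq> V} \<noteq> {}" using V by blast
    show "{N. ideal N R \<and> J \<subseteq> N \<and> N \<subseteq> U} \<noteq> {}" using U by blast
  next
    fix N assume "N \<in> {N. ideal N R \<and> K \<subseteq> N \<and> N \<subseteq> V}"
    then have N: "ideal N R" "K \<subseteq> N" "N \<subseteq> V" by auto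
    have "els J K \<subseteq> els J N" "els J N \<subseteq> els U V" using N U(2) by (simp_all add: els_mono)
    then show "els J N \<in> {N. ideal N S \<and> els J K \<subseteq> N \<and> N \<subseteq> els U V}"
      using idl[OF J subset_refl U(2) N] by simp
  next
    fix N assume "N \<in> {N. ideal N R \<and> J \<subseteq> N \<and> N \<subseteq> U}"
    then have N: "ideal N R" "J \<subseteq> N" "N \<subseteq> U" by auto
    have "els J K \<subseteq> els N V" "els N V \<subseteq> els U V" using N V(2) by (simp_all add: els_mono)
    then show "els N V \<in> {N. ideal N S \<and> els J K \<subseteq> N \<and> N \<subseteq> els U V}"
      using idl[OF N V(1,2) subset_refl] by simp
  next
    fix X Y assume XY: "X \<in> {N. ideal N R \<and> K \<subseteq> N \<and> N \<subseteq> V}" "Y \<in> {N. ideal N R \<and> K \<subseteq> N \<and> N \<subseteq> V}" "X \<subset> Y"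
    then obtain i where i: "i \<in> Y" "i \<notin> X" by blast
    have "el \<zero> i \<in> els J Y" unfolding els_def using i idealD(2)[OF J] by blast
    moreover have "el \<zero> i \<notin> els J X"
    proof -
      have "i \<in> I" "J \<subseteq> carrier R" "X \<subseteq> I" using i XY V(3) idealD(1)[OF J] by auto
      then show ?thesis using el_mem_els[of \<zero> i J X] i by simp
    qed
    moreover have "els J X \<subseteq> els J Y" using XY(3) by (intro els_mono) auto
    ultimately show "els J X \<subset> els J Y" by blast
  next
    fix X Y assume XY: "X \<in> {N. ideal N R \<and> J \<subseteq> N \<and> N \<subseteq> U}" "Y \<in> {N. ideal N R \<and> J \<subseteq> N \<and> N \<subseteq> U}" "X \<subset> Y"
    then obtain r where r: "r \<in> Y" "r \<notin> X" by blast
    have "el r \<zero> \<in> els Y V" unfolding els_def using r idealD(2)[OF V(1)] by blast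
    moreover have "el r \<zero> \<notin> els X V"
    proof -
      have "r \<in> carrier R" "X \<subseteq> carrier R" using r XY UV by auto
      then show ?thesis using el_mem_els[of r \<zero> X V] r UV ID(2) by simp
    qed
    moreover have "els X V \<subseteq> els Y V" using XY(3) by (intro els_mono) auto
    ultimately show "els X V \<subset> els Y V" by blast
  next
    fix X Y assume "X \<in> {N. ideal N R \<and> K \<subseteq> N \<and> N \<subseteq> V}" "Y \<in> {N. ideal N R \<and> J \<subseteq> N \<and> N \<subseteq> U}"
    then show "els J X \<subseteq> els Y V" by (intro els_mono) simp_all
  qed
qed

lemma cm_type_rees_extension:
  assumes A: "regular_chain R \<mm> (carrier R) A x d" "A 0 = {\<zero>}"
    and B: "regular_chain R \<mm> I B x d" "B 0 = {\<zero>}" and d: "krull_dim R = enat d"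
    and BA: "B d \<subseteq> A d" and AIB: "\<And>r j. r \<in> A d \<Longrightarrow> j \<in> I \<Longrightarrow> r \<otimes> j \<in> B d"
  shows "cm_type S = chain_length {N. ideal N R \<and> A d \<subseteq> N \<and>
      N \<subseteq> {r \<in> carrier R. (\<forall>x\<in>\<mm>. x \<otimes> r \<in> A d) \<and> (\<forall>j\<in>I. j \<otimes> r \<in> B d)}}
    + chain_length {N. ideal N R \<and> B d \<subseteq> N \<and> N \<subseteq> {i \<in> I. \<forall>x\<in>\<mm>. x \<otimes> i \<in> B d}}"
proof -
  have J: "ideal (A d) R" and K: "ideal (B d) R" "B d \<subseteq> I"
    using regular_chain_ideal[OF A(1), of d] regular_chain_ideal[OF B(1), of d] by simp_all
  let ?U = "{r \<in> carrier R. (\<forall>x\<in>\<mm>. x \<otimes> r \<in> A d) \<and> (\<forall>j\<in>I. j \<otimes> r \<in> B d)}"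
  let ?V = "{i \<in> I. \<forall>x\<in>\<mm>. x \<otimes> i \<in> B d}"
  have "cm_type S = chain_length {N. ideal N S \<and> els (A d) (B d) \<subseteq> N \<and> N \<subseteq> els ?U ?V}"
    using S.cm_type_eq[OF regular_chain_els[OF A B] krull_dim_eq[OF A B d]]
    unfolding socle_els[OF J K BA] .
  also have "\<dots> = chain_length {N. ideal N R \<and> A d \<subseteq> N \<and> N \<subseteq> ?U} + chain_length {N. ideal N R \<and> B d \<subseteq> N \<and> N \<subseteq> ?V}"
  proof (rule chain_length_els[OF J K BA])
    show "ideal ?U R" "A d \<subseteq> ?U" "ideal ?V R" "B d \<subseteq> ?V"
      by (rule socle_ideals[OF J K ideal_I AIB]; assumption)+
    show "?V \<subseteq> I" by blast
    show "r \<otimes> j \<in> B d" if "r \<in> ?U" "j \<in> I" for r j using that m_comm[of r j] ID(1) by auto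
    show "i \<otimes> j \<in> B d" if "i \<in> ?V" "j \<in> I" for i j
      using that m_comm[OF ID(1)[of i] ID(1)[of j]] I_mm by auto
  qed
  finally show ?thesis .
qed

end


section \<open>Colon ideals in the total ring of fractions\<close>

context cring
begin

lemma regular_elementsD:
  assumes "s \<in> regular_elements R"
  shows "s \<in> carrier R" "r \<in> carrier R \<Longrightarrow> s \<otimes> r = \<zero> \<Longrightarrow> r = \<zero>"
  using assms unfolding regular_elements_def by auto

lemma regular_cancel:
  assumes "s \<in> regular_elements R" "r \<in> carrier R" "t \<in> carrier R" "r \<otimes> s = t \<otimes> s"
  shows "r = t"
proof -
  note s = regular_elementsD[OF assms(1)]
  have "s \<otimes> (r \<ominus> t) = r \<otimes> s \<ominus> t \<otimes> s" using s(1) assms(2,3) by algebra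
  also have "\<dots> = \<zero>" using assms s(1) by (simp add: minus_eq r_neg)
  finally have "r \<ominus> t = \<zero>" using s(2) assms by simp
  then show ?thesis using assms by simp
qed

lemma regular_one: "\<one> \<in> regular_elements R"
  unfolding regular_elements_def by simp

lemma regular_mult:
  assumes "s \<in> regular_elements R" "t \<in> regular_elements R" shows "s \<otimes> t \<in> regular_elements R"
proof -
  note s = regular_elementsD[OF assms(1)] and t = regular_elementsD[OF assms(2)]
  have "r = \<zero>" if r: "r \<in> carrier R" "s \<otimes> t \<otimes> r = \<zero>" for r
  proof -
    have "s \<otimes> (t \<otimes> r) = \<zero>" using r s(1) t(1) by (simp add: m_assoc)
    then have "t \<otimes> r = \<zero>" using s(2) t(1) r(1) by simp
    then show ?thesis using t(2) r(1) by simp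
  qed
  then show ?thesis using s(1) t(1) unfolding regular_elements_def by auto
qed

lemma fraction_self: "r \<in> carrier R \<Longrightarrow> s \<in> regular_elements R \<Longrightarrow> (r, s) \<in> fraction R r s"
  unfolding fraction_def by simp

lemma fraction_eq_iff:
  assumes r: "r \<in> carrier R" "s \<in> regular_elements R" and r': "r' \<in> carrier R" "s' \<in> regular_elements R"
  shows "fraction R r s = fraction R r' s' \<longleftrightarrow> r \<otimes> s' = r' \<otimes> s"
proof
  assume "fraction R r s = fraction R r' s'"
  then have "(r', s') \<in> fraction R r s" using fraction_self[OF r'] by simp
  then show "r \<otimes> s' = r' \<otimes> s" unfolding fraction_def by simp
next
  have sub: "fraction R r s \<subseteq> fraction R r' s'"
    if r: "r \<in> carrier R" "s \<in> regular_elements R" and r': "r' \<in> carrier R" "s' \<in> regular_elements R"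
      and e: "r \<otimes> s' = r' \<otimes> s" for r s r' s'
  proof (clarify)
    note c = r(1) r'(1) regular_elementsD(1)[OF r(2)] regular_elementsD(1)[OF r'(2)]
    fix p q assume "(p, q) \<in> fraction R r s"
    then have pq: "p \<in> carrier R" "q \<in> regular_elements R" "r \<otimes> q = p \<otimes> s" unfolding fraction_def by auto
    have qc: "q \<in> carrier R" using regular_elementsD(1)[OF pq(2)] .
    have "(r' \<otimes> q) \<otimes> s = (r' \<otimes> s) \<otimes> q" using c qc by algebra
    also have "\<dots> = (r \<otimes> q) \<otimes> s'" unfolding e[symmetric] using c qc by algebra
    also have "\<dots> = (p \<otimes> s') \<otimes> s" unfolding pq(3) using c pq(1) by algebra
    finally have "r' \<otimes> q = p \<otimes> s'" using r(2) c qc pq(1) by - (rule regular_cancel[OF r(2)], simp_all)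
    then show "(p, q) \<in> fraction R r' s'" unfolding fraction_def using pq by simp
  qed
  assume "r \<otimes> s' = r' \<otimes> s"
  then show "fraction R r s = fraction R r' s'" using sub[OF r r'] sub[OF r' r] by auto
qed

lemma UN_fraction:
  assumes r: "r \<in> carrier R" "s \<in> regular_elements R"
    and const: "\<And>p q. p \<in> carrier R \<Longrightarrow> q \<in> regular_elements R \<Longrightarrow> r \<otimes> q = p \<otimes> s \<Longrightarrow> f p q = X"
  shows "(\<Union>(p, q)\<in>fraction R r s. f p q) = X"
proof -
  have "(\<Union>(p, q)\<in>fraction R r s. f p q) = (\<Union>z\<in>fraction R r s. X)"
    by (rule SUP_cong[OF refl]) (auto simp: fraction_def const)
  also have "\<dots> = X" using fraction_self[OF r] by blast
  finally show ?thesis .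
qed

lemma fraction_mult:
  assumes r: "r \<in> carrier R" "s \<in> regular_elements R" and r': "r' \<in> carrier R" "s' \<in> regular_elements R"
  shows "fraction R r s \<otimes>\<^bsub>total_fractions R\<^esub> fraction R r' s' = fraction R (r \<otimes> r') (s \<otimes> s')"
proof -
  note c = r(1) r'(1) regular_elementsD(1)[OF r(2)] regular_elementsD(1)[OF r'(2)]
  have "(\<Union>(p, q)\<in>fraction R r s. \<Union>(p', q')\<in>fraction R r' s'. fraction R (p \<otimes> p') (q \<otimes> q'))
    = fraction R (r \<otimes> r') (s \<otimes> s')"
  proof (intro UN_fraction r r')
    fix p q p' q' assume p: "p \<in> carrier R" "q \<in> regular_elements R" "r \<otimes> q = p \<otimes> s"
      and p': "p' \<in> carrier R" "q' \<in> regular_elements R" "r' \<otimes> q' = p' \<otimes> s'"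
    have qc: "q \<in> carrier R" "q' \<in> carrier R" using p p' regular_elementsD(1) by auto
    have "(p \<otimes> p') \<otimes> (s \<otimes> s') = (p \<otimes> s) \<otimes> (p' \<otimes> s')" using c qc p(1) p'(1) by algebra
    also have "\<dots> = (r \<otimes> r') \<otimes> (q \<otimes> q')" unfolding p(3)[symmetric] p'(3)[symmetric] using c qc by algebra
    finally show "fraction R (p \<otimes> p') (q \<otimes> q') = fraction R (r \<otimes> r') (s \<otimes> s')"
      using c p p' r r' regular_mult by (subst fraction_eq_iff) simp_all
  qed
  then show ?thesis by (simp add: total_fractions_def)
qed

abbreviation frac :: "'a \<Rightarrow> ('a \<times> 'a) set" where
  "frac r \<equiv> fraction R r \<one>"

lemma frac_eq_iff: "r \<in> carrier R \<Longrightarrow> s \<in> carrier R \<Longrightarrow> frac r = frac s \<longleftrightarrow> r = s"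
  using fraction_eq_iff[of r \<one> s \<one>] regular_one by simp

lemma frac_mem_in_fractions:
  "r \<in> carrier R \<Longrightarrow> A \<subseteq> carrier R \<Longrightarrow> frac r \<in> in_fractions R A \<longleftrightarrow> r \<in> A"
  unfolding in_fractions_def using frac_eq_iff by blast

lemma frac_add:
  assumes "r \<in> carrier R" "s \<in> carrier R"
  shows "frac r \<oplus>\<^bsub>total_fractions R\<^esub> frac s = frac (r \<oplus> s)"
proof -
  have "(\<Union>(p, q)\<in>frac r. \<Union>(p', q')\<in>frac s. fraction R (p \<otimes> q' \<oplus> p' \<otimes> q) (q \<otimes> q')) = frac (r \<oplus> s)"
  proof (intro UN_fraction assms regular_one)
    fix p q p' q' assume p: "p \<in> carrier R" "q \<in> regular_elements R" "r \<otimes> q = p \<otimes> \<one>"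
      and p': "p' \<in> carrier R" "q' \<in> regular_elements R" "s \<otimes> q' = p' \<otimes> \<one>"
    have qc: "q \<in> carrier R" "q' \<in> carrier R" using p p' regular_elementsD(1) by auto
    have e: "p = r \<otimes> q" "p' = s \<otimes> q'" using p p' by simp_all
    have "(p \<otimes> q' \<oplus> p' \<otimes> q) \<otimes> \<one> = (r \<oplus> s) \<otimes> (q \<otimes> q')"
      unfolding e using assms qc by algebra
    then show "fraction R (p \<otimes> q' \<oplus> p' \<otimes> q) (q \<otimes> q') = frac (r \<oplus> s)"
      using assms p p' qc regular_mult regular_one by (subst fraction_eq_iff) simp_all
  qed
  then show ?thesis by (simp add: total_fractions_def)
qed

lemma frac_smult:
  assumes "a \<in> carrier R" "r \<in> carrier R"
  shows "a \<odot>\<^bsub>total_fractions R\<^esub> frac r = frac (a \<otimes> r)"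
proof -
  have "(\<Union>(p, q)\<in>frac r. fraction R (a \<otimes> p) q) = frac (a \<otimes> r)"
  proof (intro UN_fraction assms regular_one)
    fix p q assume p: "p \<in> carrier R" "q \<in> regular_elements R" "r \<otimes> q = p \<otimes> \<one>"
    have qc: "q \<in> carrier R" using p regular_elementsD(1) by auto
    have e: "p = r \<otimes> q" using p by simp
    have "(a \<otimes> p) \<otimes> \<one> = (a \<otimes> r) \<otimes> q" unfolding e using assms qc by algebra
    then show "fraction R (a \<otimes> p) q = frac (a \<otimes> r)"
      using assms p qc regular_one by (subst fraction_eq_iff) simp_all
  qed
  then show ?thesis by (simp add: total_fractions_def)
qed

lemma frac_zero: "\<zero>\<^bsub>total_fractions R\<^esub> = frac \<zero>"
  by (simp add: total_fractions_def)

lemma module_in_fractions: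
  assumes U: "ideal U R"
  shows "module R (total_fractions R\<lparr>carrier := in_fractions R U\<rparr>)"
proof -
  note UD = idealD[OF U]
  let ?Q = "total_fractions R\<lparr>carrier := in_fractions R U\<rparr>"
  have "abelian_group ?Q"
  proof (rule abelian_groupI)
    fix X assume "X \<in> carrier ?Q"
    then obtain u where u: "u \<in> U" "X = frac u" by (auto simp: in_fractions_def)
    then have "frac (\<ominus> u) \<oplus>\<^bsub>?Q\<^esub> X = \<zero>\<^bsub>?Q\<^esub>" "frac (\<ominus> u) \<in> carrier ?Q"
      using UD(1,6) by (auto simp: frac_add frac_zero l_neg in_fractions_def)
    then show "\<exists>Y\<in>carrier ?Q. Y \<oplus>\<^bsub>?Q\<^esub> X = \<zero>\<^bsub>?Q\<^esub>" by blast
  qed (use UD in \<open>auto simp: in_fractions_def frac_add frac_zero a_ac intro!: imageI\<close>)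
  then show ?thesis
    by (intro moduleI is_cring)
      (use UD in \<open>auto simp: in_fractions_def frac_add frac_smult l_distr r_distr m_assoc intro!: imageI\<close>)
qed

lemma quot_length_in_fractions:
  assumes U: "ideal U R" and J: "ideal J R" "J \<subseteq> U"
  shows "quot_length R (in_fractions R U) (in_fractions R J)
    = chain_length {N. ideal N R \<and> J \<subseteq> N \<and> N \<subseteq> U}"
proof -
  let ?Q = "total_fractions R\<lparr>carrier := in_fractions R U\<rparr>" and ?M = "self_module R\<lparr>carrier := U\<rparr>"
  let ?B = "in_fractions R J" and ?h = "\<lambda>u\<in>carrier (self_module R\<lparr>carrier := U\<rparr>). frac u"
  have Jc: "J \<subseteq> carrier R" using idealD(1)[OF J(1)] by blast
  note UD = idealD[OF U] and M = module_self_module_ideal[OF U] and Q = module_in_fractions[OF U]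
  have h: "?h \<in> module_hom R ?M ?Q"
    using UD(1,3,4) by (intro module_hom_restrictI[OF M])
      (auto simp: self_module_def in_fractions_def frac_add frac_smult)
  have "?h ` J = ?B" using J(2) by (auto simp: in_fractions_def subset_iff intro!: image_eqI)
  then have B: "submodule ?B R ?Q"
    using module_hom_image_submodule[OF M Q h, of J] submodule_ideal_iff[OF U] J by simp
  note k = module_hom_compose[OF M h coset_hom[OF Q B]]
  have frac_Q: "frac u \<in> carrier ?Q" if "u \<in> U" for u using that by (simp add: in_fractions_def)
  have "{u \<in> carrier ?M. (\<lambda>v\<in>carrier ?M. (\<lambda>q\<in>carrier ?Q. ?B +>\<^bsub>?Q\<^esub> q) (?h v)) u = \<zero>\<^bsub>quot_module ?Q ?B\<^esub>} = J"
    using quot_module_cosets(5)[OF Q B frac_Q] frac_mem_in_fractions[OF UD(1) Jc] frac_Q J(2) by auto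
  moreover have "(\<lambda>v\<in>carrier ?M. (\<lambda>q\<in>carrier ?Q. ?B +>\<^bsub>?Q\<^esub> q) (?h v)) ` carrier ?M = carrier (quot_module ?Q ?B)"
    unfolding quot_module_cosets(1)[OF Q B] using frac_Q by (auto simp: in_fractions_def image_image)
  ultimately show ?thesis
    using module_length_of_surjective_hom[OF M module_quot_module[OF Q B] k]
    unfolding quot_length_def submodule_ideal_iff[OF U] by (simp add: conj_ac)
qed

lemma fraction_mem_colon_iff:
  assumes r: "r \<in> carrier R" "s \<in> regular_elements R" and A: "A \<subseteq> carrier R" and B: "B \<subseteq> carrier R"
  shows "fraction R r s \<in> colon R (in_fractions R A) (in_fractions R B) \<longleftrightarrow> (\<forall>x\<in>B. \<exists>c\<in>A. r \<otimes> x = c \<otimes> s)"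
proof -
  have q: "fraction R r s \<in> carrier (total_fractions R)" using r by (auto simp: total_fractions_def)
  have "fraction R r s \<otimes>\<^bsub>total_fractions R\<^esub> frac x \<in> in_fractions R A \<longleftrightarrow> (\<exists>c\<in>A. r \<otimes> x = c \<otimes> s)"
    if x: "x \<in> B" for x
  proof -
    have xc: "x \<in> carrier R" using x B by blast
    have sc: "s \<in> carrier R" using regular_elementsD(1)[OF r(2)] .
    have "fraction R r s \<otimes>\<^bsub>total_fractions R\<^esub> frac x = fraction R (r \<otimes> x) s"
      using fraction_mult[OF r xc regular_one] sc by simp
    moreover have "fraction R (r \<otimes> x) s = frac c \<longleftrightarrow> r \<otimes> x = c \<otimes> s" if "c \<in> A" for c
      using fraction_eq_iff[of "r \<otimes> x" s c \<one>] r xc that A regular_one by auto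
    ultimately show ?thesis unfolding in_fractions_def by auto
  qed
  then show ?thesis unfolding colon_def using q by (simp add: in_fractions_def)
qed

lemma carrier_total_fractions_cases:
  assumes "q \<in> carrier (total_fractions R)"
  obtains r s where "r \<in> carrier R" "s \<in> regular_elements R" "q = fraction R r s"
  using assms by (auto simp: total_fractions_def)

end

context noetherian_local_ring
begin

text \<open>Let \<open>q = r/s\<close>, so that \<open>q x\<^sub>0 = c\<^sub>0\<close> and \<open>q x\<^sub>1 = c\<^sub>1\<close> with \<open>c\<^sub>0\<close> and \<open>c\<^sub>1\<close> in \<open>(x\<^sub>0, x\<^sub>1, \<dots>)M\<close>. Then
  \<open>x\<^sub>1 c\<^sub>0 = x\<^sub>0 c\<^sub>1\<close>, and as \<open>x\<^sub>1\<close> is regular on \<open>M/x\<^sub>0 M\<close>, this gives \<open>c\<^sub>0 \<in> x\<^sub>0 M\<close>. If \<open>d = 1\<close>, this is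
  clear from the start. Cancelling \<open>x\<^sub>0\<close> shows \<open>q \<in> M\<close>.\<close>
lemma fraction_numerator_in_ideal:
  assumes chain: "regular_chain R \<mm> M B x d" "B 0 = {\<zero>}" "d \<ge> 1"
    and x0: "x 0 \<in> regular_elements R"
    and r: "r \<in> carrier R" "s \<in> regular_elements R"
    and c: "\<And>y. y \<in> \<mm> \<Longrightarrow> \<exists>c\<in>B d. r \<otimes> y = c \<otimes> s"
  obtains m where "m \<in> M" "r = m \<otimes> s"
proof -
  note D = regular_chainD[OF chain(1)]
  have sc: "s \<in> carrier R" using regular_elementsD(1)[OF r(2)] .
  have Bd: "ideal (B d) R" "B d \<subseteq> M" using regular_chain_ideal[OF chain(1), of d] by auto
  have x0c: "x 0 \<in> carrier R" using regular_elementsD(1)[OF x0] .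
  have B1: "B 1 = add_multiples R {\<zero>} (x 0) M" using D(3)[of 0] chain(2,3) by simp
  obtain c0 where c0: "c0 \<in> B d" "r \<otimes> x 0 = c0 \<otimes> s" using c[OF D(2)[of 0]] chain(3) by auto
  have c0c: "c0 \<in> carrier R" "c0 \<in> M" using c0 Bd idealD(1)[OF Bd(1)] by auto
  have "c0 \<in> B 1"
  proof (cases "d = 1")
    case True with c0 show ?thesis by simp
  next
    case False
    then have d: "1 < d" using chain(3) by simp
    obtain c1 where c1: "c1 \<in> B d" "r \<otimes> x 1 = c1 \<otimes> s" using c[OF D(2)[OF d]] by auto
    have c1c: "c1 \<in> carrier R" "c1 \<in> M" using c1 Bd idealD(1)[OF Bd(1)] by auto
    have x1c: "x 1 \<in> carrier R" using D(2)[OF d] idealD(1)[OF ideal_mm] by blast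
    have "(x 1 \<otimes> c0) \<otimes> s = (r \<otimes> x 0) \<otimes> x 1" unfolding c0(2) using c0c x1c sc by algebra
    also have "\<dots> = x 0 \<otimes> (r \<otimes> x 1)" using r x0c x1c by algebra
    also have "\<dots> = (x 0 \<otimes> c1) \<otimes> s" unfolding c1(2) using c1c x0c sc by algebra
    finally have "x 1 \<otimes> c0 = x 0 \<otimes> c1" using c0c c1c x0c x1c by - (rule regular_cancel[OF r(2)], simp_all)
    also have "\<dots> = \<zero> \<oplus> x 0 \<otimes> c1" using x0c c1c by simp
    also have "\<dots> \<in> B 1" unfolding B1 add_multiples_def using c1c by blast
    finally have "x 1 \<otimes> c0 \<in> B 1" .
    then show ?thesis by (rule D(4)[OF d c0c(2)])
  qed
  then obtain m where m: "m \<in> M" "c0 = \<zero> \<oplus> x 0 \<otimes> m" unfolding B1 add_multiples_def by blast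
  have mc: "m \<in> carrier R" using idealD(1)[OF D(1) m(1)] .
  have "r \<otimes> x 0 = (m \<otimes> s) \<otimes> x 0" unfolding c0(2) m(2) using mc x0c sc by algebra
  then have "r = m \<otimes> s" using r(1) mc sc by - (rule regular_cancel[OF x0], simp_all)
  with m(1) that show thesis by blast
qed

text \<open>The colons are taken in \<open>Q(R)\<close>, but by the preceding lemma for \<open>M = R\<close> and for \<open>M = I\<close> their
  elements come from \<open>R\<close> and from \<open>I\<close>.\<close>
lemma colon_eq_in_fractions:
  assumes A: "regular_chain R \<mm> (carrier R) A x d" "A 0 = {\<zero>}" and d: "d \<ge> 1"
    and B: "regular_chain R \<mm> I B x d" "B 0 = {\<zero>}"
  shows "colon R (in_fractions R (A d)) (in_fractions R \<mm>) \<inter> colon R (in_fractions R (B d)) (in_fractions R I)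
      = in_fractions R {r \<in> carrier R. (\<forall>x\<in>\<mm>. x \<otimes> r \<in> A d) \<and> (\<forall>j\<in>I. j \<otimes> r \<in> B d)}"
    and "colon R (in_fractions R (B d)) (in_fractions R \<mm>)
      = in_fractions R {i \<in> I. \<forall>x\<in>\<mm>. x \<otimes> i \<in> B d}"
proof -
  note D = regular_chainD[OF A(1)] and DB = regular_chainD[OF B(1)]
  have x0: "x 0 \<in> regular_elements R"
    unfolding regular_elements_def using D(2)[of 0] D(4)[of 0] A(2) d idealD(1)[OF ideal_mm] by auto
  have mc: "\<mm> \<subseteq> carrier R" and Ic: "I \<subseteq> carrier R" using idealD(1)[OF ideal_mm] idealD(1)[OF DB(1)] by auto
  have Ac: "A d \<subseteq> carrier R" and Bc: "B d \<subseteq> carrier R"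
    using regular_chain_ideal[OF A(1), of d] regular_chain_ideal[OF B(1), of d] Ic by auto
  have one: "frac r \<in> colon R (in_fractions R C) (in_fractions R E) \<longleftrightarrow> (\<forall>x\<in>E. x \<otimes> r \<in> C)"
    if "r \<in> carrier R" "C \<subseteq> carrier R" "E \<subseteq> carrier R" for r C E
  proof -
    have "(\<exists>c\<in>C. r \<otimes> x = c \<otimes> \<one>) \<longleftrightarrow> x \<otimes> r \<in> C" if "x \<in> E" for x
    proof -
      have "x \<in> carrier R" using that \<open>E \<subseteq> carrier R\<close> by blast
      moreover have "c \<otimes> \<one> = c" if "c \<in> C" for c using that \<open>C \<subseteq> carrier R\<close> by auto
      ultimately show ?thesis using m_comm[OF \<open>r \<in> carrier R\<close>, of x] by auto
    qed
    then show ?thesis using fraction_mem_colon_iff[OF that(1) regular_one that(2,3)] by simp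
  qed
  have cases: "\<exists>m\<in>M. q = frac m"
    if q: "q \<in> colon R (in_fractions R (C d)) (in_fractions R \<mm>)"
      and C: "regular_chain R \<mm> M C x d" "C 0 = {\<zero>}" for q M C
  proof -
    have M: "ideal M R" "C d \<subseteq> M" using regular_chainD(1)[OF C(1)] regular_chain_ideal[OF C(1), of d] by auto
    then have Cc: "C d \<subseteq> carrier R" using idealD(1)[OF M(1)] by blast
    have "q \<in> carrier (total_fractions R)" using q unfolding colon_def by blast
    then obtain r s where rs: "r \<in> carrier R" "s \<in> regular_elements R" "q = fraction R r s"
      by (rule carrier_total_fractions_cases)
    have "\<And>y. y \<in> \<mm> \<Longrightarrow> \<exists>c\<in>C d. r \<otimes> y = c \<otimes> s"
      using q fraction_mem_colon_iff[OF rs(1,2) Cc mc] unfolding rs(3) by blast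
    then obtain m where m: "m \<in> M" "r = m \<otimes> s" using fraction_numerator_in_ideal[OF C d x0 rs(1,2)] by blast
    have "m \<in> carrier R" using idealD(1)[OF M(1) m(1)] .
    then have "q = frac m" unfolding rs(3) using fraction_eq_iff[OF rs(1,2) _ regular_one, of m] rs m(2) by simp
    with m(1) show ?thesis by blast
  qed
  show "colon R (in_fractions R (A d)) (in_fractions R \<mm>) \<inter> colon R (in_fractions R (B d)) (in_fractions R I)
      = in_fractions R {r \<in> carrier R. (\<forall>x\<in>\<mm>. x \<otimes> r \<in> A d) \<and> (\<forall>j\<in>I. j \<otimes> r \<in> B d)}"
    (is "?L = in_fractions R ?U")
  proof
    show "?L \<subseteq> in_fractions R ?U"
    proof
      fix q assume q: "q \<in> ?L"
      then obtain m where m: "m \<in> carrier R" "q = frac m" using cases[OF _ A] by blast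
      have "m \<in> ?U" using q one[OF m(1) Ac mc] one[OF m(1) Bc Ic] m unfolding m(2) by blast
      then show "q \<in> in_fractions R ?U" unfolding m(2) in_fractions_def by blast
    qed
    show "in_fractions R ?U \<subseteq> ?L"
      using one[OF _ Ac mc] one[OF _ Bc Ic] unfolding in_fractions_def[of R ?U] by blast
  qed
  show "colon R (in_fractions R (B d)) (in_fractions R \<mm>) = in_fractions R {i \<in> I. \<forall>x\<in>\<mm>. x \<otimes> i \<in> B d}"
    (is "?L' = in_fractions R ?V")
  proof
    show "?L' \<subseteq> in_fractions R ?V"
    proof
      fix q assume q: "q \<in> ?L'"
      then obtain m where m: "m \<in> I" "q = frac m" using cases[OF _ B] by blast
      have "m \<in> ?V" using q one[of m, OF _ Bc mc] m Ic unfolding m(2) by blast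
      then show "q \<in> in_fractions R ?V" unfolding m(2) in_fractions_def by blast
    qed
    show "in_fractions R ?V \<subseteq> ?L'"
      using one[OF _ Bc mc] Ic unfolding in_fractions_def[of R ?V] by blast
  qed
qed

end


section \<open>The quotient of the Rees algebra as a quadratic extension\<close>

context cring
begin

lemma ideals_set_pow_simps:
  "\<one>\<^bsub>ideals_set R\<^esub> = carrier R" "A \<otimes>\<^bsub>ideals_set R\<^esub> B = A \<cdot> B"
  "I [^]\<^bsub>ideals_set R\<^esub> (0::nat) = carrier R"
  "I [^]\<^bsub>ideals_set R\<^esub> Suc n = (I [^]\<^bsub>ideals_set R\<^esub> n) \<cdot> I"
  by (simp_all add: nat_pow_def ideals_set_def)

context
  fixes I assumes I: "ideal I R"
begin

abbreviation (input) ipow :: "nat \<Rightarrow> 'a set" where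
  "ipow n \<equiv> I [^]\<^bsub>ideals_set R\<^esub> n"

lemma ipow_ideal: "ideal (ipow n) R"
  by (induction n) (simp_all add: ideals_set_pow_simps oneideal ideal_prod_is_ideal I)

lemma ipow_one: "ipow 1 = I"
  using ideal_prod_commute[OF I oneideal] ideal_prod_one[OF I]
  by (simp add: ideals_set_pow_simps)

lemma ipow_Suc_subset: "ipow (Suc n) \<subseteq> ipow n"
  using ideal_prod_inter[OF ipow_ideal I, of n] by (simp add: ideals_set_pow_simps)

lemma ipow_mult: "x \<in> ipow m \<Longrightarrow> y \<in> ipow n \<Longrightarrow> x \<otimes> y \<in> ipow (m + n)"
proof (induction n arbitrary: y)
  case 0 then show ?case using idealD(5)[OF ipow_ideal] by (simp add: ideals_set_pow_simps)
next
  case (Suc n)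
  have xc: "x \<in> carrier R" using idealD(1)[OF ipow_ideal Suc.prems(1)] .
  from Suc.prems(2) have "y \<in> ipow n \<cdot> I" by (simp add: ideals_set_pow_simps)
  then have "y \<in> carrier R \<and> x \<otimes> y \<in> ipow (m + n) \<cdot> I"
  proof (induction y rule: ideal_prod.induct)
    case (prod i j)
    have c: "i \<in> carrier R" "j \<in> carrier R" using prod idealD(1)[OF ipow_ideal] idealD(1)[OF I] by auto
    have "(x \<otimes> i) \<otimes> j \<in> ipow (m + n) \<cdot> I" using Suc.IH[OF Suc.prems(1) prod(1)] prod(2) by (rule ideal_prod.prod)
    then show ?case using c xc by (simp add: m_assoc)
  next
    case (sum s1 s2)
    then show ?case using xc by (simp add: r_distr ideal_prod.sum)
  qed
  then show ?case by (simp add: ideals_set_pow_simps)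
qed

end

end

lemma (in UP_cring) coeff_mult_quadratic:
  assumes "a \<in> carrier R" "b \<in> carrier R" "g \<in> carrier P"
  shows "coeff P (g \<otimes>\<^bsub>P\<^esub> (monom P \<one> 2 \<oplus>\<^bsub>P\<^esub> monom P a 1 \<oplus>\<^bsub>P\<^esub> monom P b 0)) (n + 2)
    = coeff P g n \<oplus> a \<otimes> coeff P g (n + 1) \<oplus> b \<otimes> coeff P g (n + 2)"
proof -
  have "g \<otimes>\<^bsub>P\<^esub> (monom P \<one> 2 \<oplus>\<^bsub>P\<^esub> monom P a 1 \<oplus>\<^bsub>P\<^esub> monom P b 0)
    = monom P \<one> 2 \<otimes>\<^bsub>P\<^esub> g \<oplus>\<^bsub>P\<^esub> monom P a 1 \<otimes>\<^bsub>P\<^esub> g \<oplus>\<^bsub>P\<^esub> monom P b 0 \<otimes>\<^bsub>P\<^esub> g"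
    using assms by (simp add: P.r_distr P.m_comm)
  then show ?thesis
    using assms coeff_monom_mult[of \<one> g 2 n] coeff_monom_mult[of a g 1 "n + 1"] coeff_monom_mult[of b g 0 "n + 2"]
    by (simp del: coeff_mult)
qed

text \<open>If \<open>g \<noteq> 0\<close>, the leading coefficient of \<open>g\<close> reappears in the product, two degrees higher.\<close>
lemma (in UP_cring) linear_multiple_of_quadratic_zero:
  assumes "a \<in> carrier R" "b \<in> carrier R" "g \<in> carrier P"
    and r: "r \<in> carrier R" and i: "i \<in> carrier R"
    and eq: "monom P r 0 \<oplus>\<^bsub>P\<^esub> monom P i 1 = g \<otimes>\<^bsub>P\<^esub> (monom P \<one> 2 \<oplus>\<^bsub>P\<^esub> monom P a 1 \<oplus>\<^bsub>P\<^esub> monom P b 0)"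
  shows "r = \<zero> \<and> i = \<zero>"
proof -
  have "g = \<zero>\<^bsub>P\<^esub>"
  proof (rule ccontr)
    assume g: "g \<noteq> \<zero>\<^bsub>P\<^esub>"
    let ?n = "deg R g"
    have "coeff P g (?n + 1) = \<zero>" "coeff P g (?n + 2) = \<zero>" using deg_aboveD[OF _ assms(3)] by simp_all
    then have "coeff P (monom P r 0 \<oplus>\<^bsub>P\<^esub> monom P i 1) (?n + 2) = coeff P g ?n"
      unfolding eq coeff_mult_quadratic[OF assms(1-3)] using assms by simp
    moreover have "coeff P (monom P r 0 \<oplus>\<^bsub>P\<^esub> monom P i 1) (?n + 2) = \<zero>"
      using r i by simp
    ultimately show False using lcoeff_nonzero2[OF assms(3) g] by simp
  qed
  then have z: "monom P r 0 \<oplus>\<^bsub>P\<^esub> monom P i 1 = \<zero>\<^bsub>P\<^esub>" using eq assms by simp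
  have "coeff P (monom P r 0 \<oplus>\<^bsub>P\<^esub> monom P i 1) 0 = \<zero>" "coeff P (monom P r 0 \<oplus>\<^bsub>P\<^esub> monom P i 1) 1 = \<zero>"
    unfolding z by simp_all
  then show ?thesis using r i by simp
qed

lemma (in UP_cring) monom_mult_quadratic:
  assumes "a \<in> carrier R" "b \<in> carrier R" "c \<in> carrier R"
  shows "monom P c n \<otimes>\<^bsub>P\<^esub> (monom P \<one> 2 \<oplus>\<^bsub>P\<^esub> monom P a 1 \<oplus>\<^bsub>P\<^esub> monom P b 0)
    = monom P c (n + 2) \<oplus>\<^bsub>P\<^esub> monom P (c \<otimes> a) (n + 1) \<oplus>\<^bsub>P\<^esub> monom P (c \<otimes> b) n"
  using assms monom_mult[of c \<one> n 2] monom_mult[of c a n 1] monom_mult[of c b n 0]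
  by (simp add: P.r_distr del: monom_mult)

text \<open>With \<open>t\<^sup>2 = - a t - b\<close>, every element of the Rees algebra is reduced to degree at most \<open>1\<close>. The
  representation \<open>r + it\<close> is unique because no nonzero multiple of the quadratic polynomial is that
  short.\<close>
lemma (in noetherian_local_ring) rees_extension_rees_quotient:
  assumes I: "ideal I R" "I \<noteq> carrier R" and ab: "a \<in> carrier R" "b \<in> carrier R"
  obtains \<iota> \<tau> where "rees_extension R \<mm> (rees_quotient R I a b) I a b \<iota> \<tau>"
proof -
  interpret UP: UP_cring R "UP R" by unfold_locales
  let ?P = "UP R" and ?A = "rees_algebra R I"
  let ?mon = "up_ring.monom (UP R)" and ?co = "up_ring.coeff (UP R)"
  let ?q = "quadratic_poly R a b"
  have Isub: "I \<subseteq> \<mm>" using proper_ideal_subset_mm[OF I(1)] ideal.one_imp_carrier[OF I(1)] I(2) by blast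
  note ip = ipow_ideal[OF I(1)] and ID = idealD[OF I(1)]
  have cA: "carrier ?A = {p \<in> carrier ?P. \<forall>n. ?co p n \<in> I [^]\<^bsub>ideals_set R\<^esub> n}"
    by (simp add: rees_algebra_def)
  have opA: "monoid.mult ?A = monoid.mult ?P" "add ?A = add ?P" "\<one>\<^bsub>?A\<^esub> = \<one>\<^bsub>?P\<^esub>" "\<zero>\<^bsub>?A\<^esub> = \<zero>\<^bsub>?P\<^esub>"
    by (simp_all add: rees_algebra_def)
  have sub: "subring (carrier ?A) ?P"
  proof (rule UP.P.subringI)
    show "carrier ?A \<subseteq> carrier ?P" unfolding cA by blast
    show "\<one>\<^bsub>?P\<^esub> \<in> carrier ?A"
      unfolding cA using idealD(2)[OF ip] by (simp add: ideals_set_pow_simps)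
    show "\<ominus>\<^bsub>?P\<^esub> p \<in> carrier ?A" if "p \<in> carrier ?A" for p
      using that idealD(6)[OF ip] unfolding cA by simp
    show "p \<oplus>\<^bsub>?P\<^esub> p' \<in> carrier ?A" if "p \<in> carrier ?A" "p' \<in> carrier ?A" for p p'
      using that idealD(3)[OF ip] unfolding cA by simp
    show "p \<otimes>\<^bsub>?P\<^esub> p' \<in> carrier ?A" if "p \<in> carrier ?A" "p' \<in> carrier ?A" for p p'
    proof -
      have p: "p \<in> carrier ?P" "p' \<in> carrier ?P" using that unfolding cA by auto
      have t: "?co p i \<otimes> ?co p' (n - i) \<in> I [^]\<^bsub>ideals_set R\<^esub> n" if "i \<le> n" for i n
      proof -
        have "?co p i \<in> I [^]\<^bsub>ideals_set R\<^esub> i" "?co p' (n - i) \<in> I [^]\<^bsub>ideals_set R\<^esub> (n - i)"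
          using \<open>p \<in> carrier ?A\<close> \<open>p' \<in> carrier ?A\<close> unfolding cA by auto
        from ipow_mult[OF I(1) this] show ?thesis using that by simp
      qed
      have "(\<Oplus>i\<in>B. ?co p i \<otimes> ?co p' (n - i)) \<in> I [^]\<^bsub>ideals_set R\<^esub> n"
        if "finite B" "B \<subseteq> {..n}" for B n
        using that
      proof (induction B rule: finite_induct)
        case empty then show ?case using idealD(2)[OF ip] by simp
      next
        case (insert i B)
        then have "(\<Oplus>i\<in>insert i B. ?co p i \<otimes> ?co p' (n - i))
          = ?co p i \<otimes> ?co p' (n - i) \<oplus> (\<Oplus>i\<in>B. ?co p i \<otimes> ?co p' (n - i))"
          using p by (intro finsum_insert) auto
        then show ?case using insert t idealD(3)[OF ip] by simp
      qed
      then show ?thesis unfolding cA using p by simp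
    qed
  qed
  have cringA: "cring ?A"
    using UP.P.subcring_iff[of "carrier ?A"] UP.P.subcringI'[OF sub] subringE(1)[OF sub]
    by (simp add: rees_algebra_def)
  interpret A: cring ?A by (rule cringA)
  have AP: "p \<in> carrier ?P" if "p \<in> carrier ?A" for p using that unfolding cA by simp
  have mA: "?mon c n \<in> carrier ?A" if "c \<in> I [^]\<^bsub>ideals_set R\<^esub> n" for c n
    unfolding cA using that idealD(1)[OF ip that] idealD(2)[OF ip] by simp
  have m0: "?mon r 0 \<in> carrier ?A" if "r \<in> carrier R" for r using mA[of r 0] that by (simp add: ideals_set_pow_simps)
  have m1: "?mon i 1 \<in> carrier ?A" if "i \<in> I" for i using mA[of i 1] that ipow_one[OF I(1)] by simp
  have q: "?q \<in> carrier ?P" unfolding quadratic_poly_def using ab by simp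
  let ?N = "(PIdl\<^bsub>?P\<^esub> ?q) \<inter> carrier ?A"
  have Pid: "ideal (PIdl\<^bsub>?P\<^esub> ?q) ?P" using q by (rule UP.P.cgenideal_ideal)
  have N: "ideal ?N ?A"
    unfolding A.ideal_iff using UP.P.idealD(2-4)[OF Pid] A.a_closed A.zero_closed A.m_closed AP
    by (auto simp: opA)
  interpret N: ideal ?N ?A by (rule N)
  let ?S = "rees_quotient R I a b"
  have S: "?S = ?A Quot ?N" by (simp add: rees_quotient_def)
  have cringS: "cring ?S" unfolding S by (rule N.quotient_is_cring[OF cringA])
  interpret S: cring ?S by (rule cringS)
  define \<pi> where "\<pi> p = ?N +>\<^bsub>?A\<^esub> p" for p
  have \<pi>: "\<pi> \<in> ring_hom ?A ?S" unfolding S using N.rcos_ring_hom by (simp add: \<pi>_def[abs_def])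
  note \<pi>D = ring_hom_closed[OF \<pi>] ring_hom_add[OF \<pi>, unfolded opA] ring_hom_mult[OF \<pi>, unfolded opA] ring_hom_one[OF \<pi>]
  have \<pi>zero: "\<pi> p = \<zero>\<^bsub>?S\<^esub> \<longleftrightarrow> p \<in> PIdl\<^bsub>?P\<^esub> ?q" if p: "p \<in> carrier ?A" for p
  proof -
    have "\<zero>\<^bsub>?S\<^esub> = ?N" by (simp add: S FactRing_def)
    moreover have "\<pi> p = ?N \<longleftrightarrow> p \<in> ?N"
      unfolding \<pi>_def using N.rcos_const_imp_mem[OF p] N.a_rcos_const[of p] by blast
    ultimately show ?thesis using p by simp
  qed
  have surj: "\<exists>p\<in>carrier ?A. s = \<pi> p" if "s \<in> carrier ?S" for s
    using that by (auto simp: S FactRing_def A_RCOSETS_def' \<pi>_def)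
  define \<iota> where "\<iota> r = \<pi> (?mon r 0)" for r
  define \<tau> where "\<tau> i = \<pi> (?mon i 1)" for i
  have iadd: "\<iota> (r \<oplus> s) = \<iota> r \<oplus>\<^bsub>?S\<^esub> \<iota> s" if "r \<in> carrier R" "s \<in> carrier R" for r s
    unfolding \<iota>_def using \<pi>D(2)[OF m0 m0] that by simp
  have tadd: "\<tau> (i \<oplus> j) = \<tau> i \<oplus>\<^bsub>?S\<^esub> \<tau> j" if "i \<in> I" "j \<in> I" for i j
    unfolding \<tau>_def using \<pi>D(2)[OF m1 m1] that ID(1) by simp
  \<comment> \<open>\<open>c t\<^bsup>n+2\<^esup> = - a c t\<^bsup>n+1\<^esup> - b c t\<^sup>n\<close> for \<open>c \<in> I\<^bsup>n+2\<^esup>\<close>, with coefficients on the right in the powers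
    of \<open>I\<close> that are required there\<close>
  have rel: "\<pi> (?mon c (n + 2)) = \<pi> (?mon (\<ominus> (c \<otimes> a)) (n + 1)) \<oplus>\<^bsub>?S\<^esub> \<pi> (?mon (\<ominus> (c \<otimes> b)) n)"
    and rel_mem: "\<ominus> (c \<otimes> a) \<in> I [^]\<^bsub>ideals_set R\<^esub> (n + 1)" "\<ominus> (c \<otimes> b) \<in> I [^]\<^bsub>ideals_set R\<^esub> n"
    if c: "c \<in> I [^]\<^bsub>ideals_set R\<^esub> (n + 2)" for c n
  proof -
    have c1: "c \<in> I [^]\<^bsub>ideals_set R\<^esub> (n + 1)" using ipow_Suc_subset[OF I(1), of "n + 1"] c by auto
    then have c2: "c \<in> I [^]\<^bsub>ideals_set R\<^esub> n" using ipow_Suc_subset[OF I(1), of n] by auto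
    have cc: "c \<in> carrier R" using idealD(1)[OF ip c] .
    show mem: "\<ominus> (c \<otimes> a) \<in> I [^]\<^bsub>ideals_set R\<^esub> (n + 1)" "\<ominus> (c \<otimes> b) \<in> I [^]\<^bsub>ideals_set R\<^esub> n"
      by (rule idealD(6)[OF ip idealD(5)[OF ip ab(1) c1]] idealD(6)[OF ip idealD(5)[OF ip ab(2) c2]])+
    have ac: "c \<otimes> a \<in> I [^]\<^bsub>ideals_set R\<^esub> (n + 1)" "c \<otimes> b \<in> I [^]\<^bsub>ideals_set R\<^esub> n"
      by (rule idealD(5)[OF ip ab(1) c1] idealD(5)[OF ip ab(2) c2])+
    let ?w = "?mon c (n + 2) \<oplus>\<^bsub>?P\<^esub> ?mon (c \<otimes> a) (n + 1) \<oplus>\<^bsub>?P\<^esub> ?mon (c \<otimes> b) n"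
    have mm: "?mon c (n + 2) \<in> carrier ?A" "?mon (c \<otimes> a) (n + 1) \<in> carrier ?A" "?mon (c \<otimes> b) n \<in> carrier ?A"
      "?mon (\<ominus> (c \<otimes> a)) (n + 1) \<in> carrier ?A" "?mon (\<ominus> (c \<otimes> b)) n \<in> carrier ?A"
      by (rule mA[OF c] mA[OF ac(1)] mA[OF ac(2)] mA[OF mem(1)] mA[OF mem(2)])+
    have wA: "?w \<in> carrier ?A" using mm(1-3) A.a_closed by (simp add: opA)
    have "?w = ?mon c n \<otimes>\<^bsub>?P\<^esub> ?q" unfolding quadratic_poly_def using UP.monom_mult_quadratic[OF ab cc] by simp
    then have "?w \<in> PIdl\<^bsub>?P\<^esub> ?q" unfolding cgenideal_def using cc UP.monom_closed by blast
    then have "\<pi> ?w = \<zero>\<^bsub>?S\<^esub>" using \<pi>zero[OF wA] by simp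
    then have "\<pi> (?mon c (n + 2)) \<oplus>\<^bsub>?S\<^esub> \<pi> (?mon (c \<otimes> a) (n + 1)) \<oplus>\<^bsub>?S\<^esub> \<pi> (?mon (c \<otimes> b) n) = \<zero>\<^bsub>?S\<^esub>"
      using \<pi>D(2)[OF _ mm(3), of "?mon c (n + 2) \<oplus>\<^bsub>?P\<^esub> ?mon (c \<otimes> a) (n + 1)"] \<pi>D(2)[OF mm(1,2)] A.a_closed[OF mm(1,2)]
      by (simp add: opA)
    moreover have "\<pi> (?mon (\<ominus> d) k) = \<ominus>\<^bsub>?S\<^esub> \<pi> (?mon d k)"
      if d: "d \<in> carrier R" "?mon d k \<in> carrier ?A" "?mon (\<ominus> d) k \<in> carrier ?A" for d k
    proof (rule sym, rule S.minus_equality)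
      have "?mon (\<ominus> d) k \<oplus>\<^bsub>?P\<^esub> ?mon d k = \<zero>\<^bsub>?P\<^esub>"
        using UP.monom_add[of "\<ominus> d" d k] UP.monom_zero[of k] d(1) by (simp add: l_neg)
      then have "\<pi> (?mon (\<ominus> d) k) \<oplus>\<^bsub>?S\<^esub> \<pi> (?mon d k) = \<pi> \<zero>\<^bsub>?P\<^esub>" using \<pi>D(2)[OF d(3,2)] by simp
      also have "\<dots> = \<zero>\<^bsub>?S\<^esub>" using \<pi>zero[OF A.zero_closed, unfolded opA] UP.P.idealD(2)[OF Pid] by simp
      finally show "\<pi> (?mon (\<ominus> d) k) \<oplus>\<^bsub>?S\<^esub> \<pi> (?mon d k) = \<zero>\<^bsub>?S\<^esub>" .
    qed (use \<pi>D(1) d in auto)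
    ultimately have z: "\<pi> (?mon c (n + 2)) \<oplus>\<^bsub>?S\<^esub> \<pi> (?mon (c \<otimes> a) (n + 1)) \<oplus>\<^bsub>?S\<^esub> \<pi> (?mon (c \<otimes> b) n) = \<zero>\<^bsub>?S\<^esub>"
      and e: "\<pi> (?mon (\<ominus> (c \<otimes> a)) (n + 1)) = \<ominus>\<^bsub>?S\<^esub> \<pi> (?mon (c \<otimes> a) (n + 1))"
        "\<pi> (?mon (\<ominus> (c \<otimes> b)) n) = \<ominus>\<^bsub>?S\<^esub> \<pi> (?mon (c \<otimes> b) n)"
      using mm cc ab by auto
    note cl = \<pi>D(1)[OF mm(1)] \<pi>D(1)[OF mm(2)] \<pi>D(1)[OF mm(3)]
    have "x = \<ominus>\<^bsub>?S\<^esub> y \<oplus>\<^bsub>?S\<^esub> \<ominus>\<^bsub>?S\<^esub> w"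
      if "x \<oplus>\<^bsub>?S\<^esub> y \<oplus>\<^bsub>?S\<^esub> w = \<zero>\<^bsub>?S\<^esub>" "x \<in> carrier ?S" "y \<in> carrier ?S" "w \<in> carrier ?S" for x y w
    proof -
      have "x = (x \<oplus>\<^bsub>?S\<^esub> y \<oplus>\<^bsub>?S\<^esub> w) \<oplus>\<^bsub>?S\<^esub> (\<ominus>\<^bsub>?S\<^esub> y \<oplus>\<^bsub>?S\<^esub> \<ominus>\<^bsub>?S\<^esub> w)" using that(2-4) by algebra
      also have "\<dots> = \<ominus>\<^bsub>?S\<^esub> y \<oplus>\<^bsub>?S\<^esub> \<ominus>\<^bsub>?S\<^esub> w" unfolding that(1) using that(2-4) by simp
      finally show ?thesis .
    qed
    from this[OF z cl] show "\<pi> (?mon c (n + 2)) = \<pi> (?mon (\<ominus> (c \<otimes> a)) (n + 1)) \<oplus>\<^bsub>?S\<^esub> \<pi> (?mon (\<ominus> (c \<otimes> b)) n)"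
      unfolding e .
  qed
  define E where "E = {s \<in> carrier ?S. \<exists>r\<in>carrier R. \<exists>i\<in>I. s = \<iota> r \<oplus>\<^bsub>?S\<^esub> \<tau> i}"
  have icl: "\<iota> r \<in> carrier ?S" if "r \<in> carrier R" for r unfolding \<iota>_def using \<pi>D(1) m0 that by simp
  have tcl: "\<tau> i \<in> carrier ?S" if "i \<in> I" for i unfolding \<tau>_def using \<pi>D(1) m1 that by simp
  have Eadd: "s \<oplus>\<^bsub>?S\<^esub> s' \<in> E" if s: "s \<in> E" "s' \<in> E" for s s'
  proof -
    obtain r i r' i' where *: "r \<in> carrier R" "i \<in> I" "s = \<iota> r \<oplus>\<^bsub>?S\<^esub> \<tau> i"
      "r' \<in> carrier R" "i' \<in> I" "s' = \<iota> r' \<oplus>\<^bsub>?S\<^esub> \<tau> i'" using s unfolding E_def by blast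
    then have "s \<oplus>\<^bsub>?S\<^esub> s' = \<iota> (r \<oplus> r') \<oplus>\<^bsub>?S\<^esub> \<tau> (i \<oplus> i')"
      using icl tcl by (simp add: iadd tadd S.a_ac)
    then show ?thesis unfolding E_def using * ID(3) icl tcl by blast
  qed
  have tau0: "\<tau> \<zero> = \<zero>\<^bsub>?S\<^esub>" and iota0: "\<iota> \<zero> = \<zero>\<^bsub>?S\<^esub>"
    unfolding \<tau>_def \<iota>_def UP.monom_zero
    using \<pi>zero[OF A.zero_closed, unfolded opA] UP.P.idealD(2)[OF Pid] by simp_all
  have Emon: "c \<in> I [^]\<^bsub>ideals_set R\<^esub> n \<Longrightarrow> \<pi> (?mon c n) \<in> E" for c n
  proof (induction n arbitrary: c rule: less_induct)
    case (less n)
    consider "n = 0" | "n = 1" | k where "n = k + 2" by (metis One_nat_def Suc_1 add_2_eq_Suc' not0_implies_Suc)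
    then show ?case
    proof cases
      case 1
      then have "c \<in> carrier R" using less.prems by (simp add: ideals_set_pow_simps)
      then have "\<pi> (?mon c n) = \<iota> c \<oplus>\<^bsub>?S\<^esub> \<tau> \<zero>" using 1 icl tau0 by (simp add: \<iota>_def)
      then show ?thesis unfolding E_def using \<open>c \<in> carrier R\<close> ID(2) icl tcl by auto
    next
      case 2
      then have "c \<in> I" using less.prems ipow_one[OF I(1)] by simp
      then have "\<pi> (?mon c n) = \<iota> \<zero> \<oplus>\<^bsub>?S\<^esub> \<tau> c" using 2 tcl iota0 by (simp add: \<tau>_def)
      then show ?thesis unfolding E_def using \<open>c \<in> I\<close> icl tcl by auto
    next
      case 3
      have "c \<in> I [^]\<^bsub>ideals_set R\<^esub> (k + 2)" using less.prems 3 by simp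
      from rel[OF this] rel_mem[OF this] less.IH show ?thesis
        unfolding 3 by (simp add: Eadd)
    qed
  qed
  have Eall: "p \<in> carrier ?A \<Longrightarrow> (\<And>k. k > n \<Longrightarrow> ?co p k = \<zero>) \<Longrightarrow> \<pi> p \<in> E" for p n
  proof (induction n arbitrary: p)
    case 0
    have "p = ?mon (?co p 0) 0"
      using 0 AP by (intro UP.up_eqI) auto
    moreover have "?co p 0 \<in> I [^]\<^bsub>ideals_set R\<^esub> (0::nat)" using 0(1) unfolding cA by blast
    ultimately show ?case using Emon by metis
  next
    case (Suc n)
    let ?c = "?co p (Suc n)"
    have c: "?c \<in> I [^]\<^bsub>ideals_set R\<^esub> (Suc n)" using Suc.prems(1) unfolding cA by blast
    have cc: "?c \<in> carrier R" using idealD(1)[OF ip c] .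
    let ?p = "p \<ominus>\<^bsub>?P\<^esub> ?mon ?c (Suc n)"
    have pP: "p \<in> carrier ?P" using AP Suc.prems(1) .
    have pA: "?p \<in> carrier ?A"
      unfolding cA using pP cc Suc.prems(1) idealD(7)[OF ip _ idealD(2)[OF ip]] idealD(7)[OF ip c c]
      by (auto simp: cA minus_eq)
    have "?co ?p k = \<zero>" if "k > n" for k
    proof (cases "k = Suc n")
      case True then show ?thesis using pP cc by (simp add: minus_eq r_neg)
    next
      case False then show ?thesis using pP cc Suc.prems(2)[of k] that by (simp add: minus_eq)
    qed
    from Suc.IH[OF pA this] Emon[OF c] have "\<pi> ?p \<oplus>\<^bsub>?S\<^esub> \<pi> (?mon ?c (Suc n)) \<in> E" by (rule Eadd)
    moreover have "\<pi> ?p \<oplus>\<^bsub>?S\<^esub> \<pi> (?mon ?c (Suc n)) = \<pi> (?p \<oplus>\<^bsub>?P\<^esub> ?mon ?c (Suc n))"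
      using \<pi>D(2)[OF pA mA[OF c]] by simp
    moreover have "?p \<oplus>\<^bsub>?P\<^esub> ?mon ?c (Suc n) = p"
      using pP cc by (simp add: UP.P.minus_eq UP.P.a_assoc UP.P.l_neg)
    ultimately show ?case by simp
  qed
  have "rees_extension R \<mm> ?S I a b \<iota> \<tau>"
  proof (intro rees_extension.intro rees_extension_axioms.intro noetherian_local_ring_axioms cringS I(1) Isub ab
      icl tcl iadd tadd)
    fix r s assume "r \<in> carrier R" "s \<in> carrier R"
    then show "\<iota> (r \<otimes> s) = \<iota> r \<otimes>\<^bsub>?S\<^esub> \<iota> s"
      unfolding \<iota>_def using \<pi>D(3)[OF m0 m0] UP.monom_mult[of r s 0 0] by simp
  next
    show "\<iota> \<one> = \<one>\<^bsub>?S\<^esub>" unfolding \<iota>_def using \<pi>D(4) by (simp add: opA)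
  next
    fix r i assume "r \<in> carrier R" "i \<in> I"
    then show "\<iota> r \<otimes>\<^bsub>?S\<^esub> \<tau> i = \<tau> (r \<otimes> i)"
      unfolding \<iota>_def \<tau>_def using \<pi>D(3)[OF m0 m1] UP.monom_mult[of r i 0 1] ID(1) by simp
  next
    fix i j assume ij: "i \<in> I" "j \<in> I"
    then have c: "i \<in> carrier R" "j \<in> carrier R" using ID(1) by auto
    have "i \<otimes> j \<in> I [^]\<^bsub>ideals_set R\<^esub> (1 + 1 :: nat)"
      using ij ipow_one[OF I(1)] by (intro ipow_mult[OF I(1)]) simp_all
    then have m: "i \<otimes> j \<in> I [^]\<^bsub>ideals_set R\<^esub> (0 + 2 :: nat)" by (simp add: numeral_2_eq_2)
    have ij_mem: "i \<otimes> j \<in> I" using ID(4) c ij by simp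
    have "\<tau> i \<otimes>\<^bsub>?S\<^esub> \<tau> j = \<pi> (?mon (i \<otimes> j) (0 + 2))"
      unfolding \<tau>_def using \<pi>D(3)[OF m1[OF ij(1)] m1[OF ij(2)]] UP.monom_mult[OF c, of 1 1]
      by (simp add: numeral_2_eq_2)
    also have "\<dots> = \<tau> (\<ominus> (i \<otimes> j \<otimes> a)) \<oplus>\<^bsub>?S\<^esub> \<iota> (\<ominus> (i \<otimes> j \<otimes> b))"
      unfolding \<tau>_def \<iota>_def using rel[OF m] by simp
    also have "\<dots> = \<iota> (\<ominus> (b \<otimes> (i \<otimes> j))) \<oplus>\<^bsub>?S\<^esub> \<tau> (\<ominus> (a \<otimes> (i \<otimes> j)))"
    proof -
      have "i \<otimes> j \<otimes> a = a \<otimes> (i \<otimes> j)" "i \<otimes> j \<otimes> b = b \<otimes> (i \<otimes> j)" using c ab by (simp_all add: m_ac)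
      moreover have "\<ominus> (a \<otimes> (i \<otimes> j)) \<in> I" "\<ominus> (b \<otimes> (i \<otimes> j)) \<in> carrier R" using ij_mem c ab ID(4,6) by simp_all
      ultimately show ?thesis using icl tcl by (simp add: S.a_comm)
    qed
    finally show "\<tau> i \<otimes>\<^bsub>?S\<^esub> \<tau> j = \<iota> (\<ominus> (b \<otimes> (i \<otimes> j))) \<oplus>\<^bsub>?S\<^esub> \<tau> (\<ominus> (a \<otimes> (i \<otimes> j)))" .
  next
    fix z assume "z \<in> carrier ?S"
    then obtain p where p: "p \<in> carrier ?A" "z = \<pi> p" using surj by blast
    have "?co p k = \<zero>" if "k > deg R p" for k using UP.deg_aboveD[OF that AP[OF p(1)]] .
    from Eall[OF p(1) this] show "\<exists>r\<in>carrier R. \<exists>i\<in>I. z = \<iota> r \<oplus>\<^bsub>?S\<^esub> \<tau> i"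
      unfolding p(2) E_def by simp
  next
    fix r i assume ri: "r \<in> carrier R" "i \<in> I" "\<iota> r \<oplus>\<^bsub>?S\<^esub> \<tau> i = \<zero>\<^bsub>?S\<^esub>"
    have mem: "?mon r 0 \<oplus>\<^bsub>?P\<^esub> ?mon i 1 \<in> carrier ?A"
      using A.a_closed[OF m0[OF ri(1)] m1[OF ri(2)]] by (simp add: opA)
    have "\<pi> (?mon r 0 \<oplus>\<^bsub>?P\<^esub> ?mon i 1) = \<zero>\<^bsub>?S\<^esub>"
      using \<pi>D(2)[OF m0[OF ri(1)] m1[OF ri(2)]] ri(3) unfolding \<iota>_def \<tau>_def by simp
    then have "?mon r 0 \<oplus>\<^bsub>?P\<^esub> ?mon i 1 \<in> PIdl\<^bsub>?P\<^esub> ?q" using \<pi>zero[OF mem] by simp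
    then obtain g where "g \<in> carrier ?P" "?mon r 0 \<oplus>\<^bsub>?P\<^esub> ?mon i 1 = g \<otimes>\<^bsub>?P\<^esub> ?q"
      unfolding cgenideal_def by blast
    then show "r = \<zero> \<and> i = \<zero>"
      unfolding quadratic_poly_def
      using UP.linear_multiple_of_quadratic_zero[OF ab _ ri(1) ID(1)[OF ri(2)]] by blast
  qed
  then show thesis by (rule that)
qed


theorem theorem1p3:
  fixes R :: "('a, 'r) ring_scheme" (structure)
    and \<mm> I J :: "'a set" and a b :: 'a and xs :: "'a list" and d :: nat
  assumes "noetherian_ring R" and "local_ring R \<mm>" and "cohen_macaulay_ring R \<mm>"
    and "krull_dim R = enat d" and "d \<ge> 1"
    and "ideal I R" and "I \<noteq> carrier R" and "I \<inter> regular_elements R \<noteq> {}"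
    and "maximal_cohen_macaulay R \<mm> ((self_module R)\<lparr>carrier := I\<rparr>)"
    and "a \<in> carrier R" and "b \<in> carrier R"
    and "length xs = d" and "set xs \<subseteq> \<mm>" and "regular_sequence R (self_module R) xs"
    and "J = Idl (set xs)"
  shows "cm_type (rees_quotient R I a b) =
      quot_length R
        (colon R (in_fractions R J) (in_fractions R \<mm>) \<inter>
         colon R (in_fractions R (J \<cdot> I)) (in_fractions R I))
        (in_fractions R J) +
      quot_length R
        (colon R (in_fractions R (J \<cdot> I)) (in_fractions R \<mm>))
        (in_fractions R (J \<cdot> I))
    \<and> (\<forall>a'\<in>carrier R. \<forall>b'\<in>carrier R.
        cm_type (rees_quotient R I a' b') = cm_type (rees_quotient R I a b))"
proof -
  interpret cring R using assms(2) unfolding local_ring_def by blast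
  interpret noetherian_local_ring R \<mm>
    using assms(1,2) by (intro noetherian_local_ring.intro noetherian_cring.intro
        noetherian_local_ring_axioms.intro is_cring)
  note I = assms(6)
  have xsc: "set xs \<subseteq> carrier R" using assms(13) idealD(1)[OF ideal_mm] by blast
  have J: "J = times_ideal R (set xs) (carrier R)" "J \<cdot> I = times_ideal R (set xs) I"
    using times_ideal_carrier[OF xsc] ideal_prod_Idl[OF I xsc] assms(15) by simp_all
  let ?A = "\<lambda>j. times_ideal R (set (take j xs)) (carrier R)"
  let ?B = "\<lambda>j. times_ideal R (set (take j xs)) I"
  have AB: "?A d = J" "?B d = J \<cdot> I" "?A 0 = {\<zero>}" "?B 0 = {\<zero>}"
    using J assms(12) times_ideal_empty[OF oneideal] times_ideal_empty[OF I] by simp_all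
  have self: "self_module R\<lparr>carrier := carrier R\<rparr> = self_module R" by (simp add: self_module_def)
  have A: "regular_chain R \<mm> (carrier R) ?A (\<lambda>j. xs ! j) d"
    using assms(12,14) regular_sequence_iff[OF oneideal, of xs] unfolding self
    by (intro regular_chain_of_sequence[OF oneideal assms(13)]) simp_all
  have B: "regular_chain R \<mm> I ?B (\<lambda>j. xs ! j) d"
    using assms(4,9,12,13,14) unfolding maximal_cohen_macaulay_def
    by (intro regular_chain_on_maximal_cohen_macaulay[OF I]) simp_all
  have JI: "J \<cdot> I \<subseteq> J" "\<And>r j. r \<in> J \<Longrightarrow> j \<in> I \<Longrightarrow> r \<otimes> j \<in> J \<cdot> I"
    using ideal_prod_inter[OF _ I, of J] genideal_ideal[OF xsc] assms(15) by (auto intro: ideal_prod.prod)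
  let ?U = "{r \<in> carrier R. (\<forall>x\<in>\<mm>. x \<otimes> r \<in> J) \<and> (\<forall>j\<in>I. j \<otimes> r \<in> J \<cdot> I)}"
  let ?V = "{i \<in> I. \<forall>x\<in>\<mm>. x \<otimes> i \<in> J \<cdot> I}"
  have type: "cm_type (rees_quotient R I a b) = chain_length {N. ideal N R \<and> J \<subseteq> N \<and> N \<subseteq> ?U}
      + chain_length {N. ideal N R \<and> J \<cdot> I \<subseteq> N \<and> N \<subseteq> ?V}"
    if ab: "a \<in> carrier R" "b \<in> carrier R" for a b
  proof -
    obtain \<iota> \<tau> where "rees_extension R \<mm> (rees_quotient R I a b) I a b \<iota> \<tau>"
      using rees_extension_rees_quotient[OF I assms(7) ab] .
    from rees_extension.cm_type_rees_extension[OF this A AB(3) B AB(4) assms(4)] JI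
    show ?thesis unfolding AB(1,2) by simp
  qed
  have Jid: "ideal J R" and JIid: "ideal (J \<cdot> I) R" "J \<cdot> I \<subseteq> I"
    using regular_chain_ideal[OF A, of d] regular_chain_ideal[OF B, of d] unfolding AB by auto
  have U: "ideal ?U R" "J \<subseteq> ?U" and V: "ideal ?V R" "J \<cdot> I \<subseteq> ?V"
    using socle_ideals[OF Jid JIid I JI(2)] by simp_all
  show ?thesis
    using type[OF assms(10,11)] type
      quot_length_in_fractions[OF U(1) Jid U(2)] quot_length_in_fractions[OF V(1) JIid(1) V(2)]
      colon_eq_in_fractions[OF A AB(3) assms(5) B AB(4)] unfolding AB(1,2) by simp
qed


end
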